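(* For every $1<p\le2$ and every $T\ge1$ there exists a constant $A(p,T)>0$ such that for every integer $n\ge1$ and every centrally symmetric convex body $K\subset\mathbb{R}^{2n}$ whose associated normed space $X_K$ has type-$p$ constant $T_p(X_K)\le T$, $$\frac{c^Z_{lin}(K)}{c(B^{2n})}\le A(p,T)\left(\frac{\mathrm{Vol}(K)}{\mathrm{Vol}(B^{2n})}\right)^{1/n}.$$
   Context: $\mathbb{R}^{2n}$ has coordinates $(x_1,y_1,\ldots,x_n,y_n)$, the standard symplectic form $\omega_{st}=\sum_{j=1}^n dx_j\wedge dy_j$ and the standard inner product. $B^{2n}$ is the open Euclidean unit ball in $\mathbb{R}^{2n}$, $B^{2k}(r)$ is the open ball of radius $r$ in $\mathbb{R}^{2k}$, and $Z^{2n}(r)=B^2(r)\times\mathbb{R}^{2n-2}$, where the factor $B^2(r)$ is in the $(x_1,y_1)$-plane. $\mathrm{Sp}(\mathbb{R}^{2n})$ is the group of linear maps of $\mathbb{R}^{2n}$ preserving $\omega_{st}$. The linearized cylindrical capacity of $U\subset\mathbb{R}^{2n}$ is $$c^Z_{lin}(U)=\inf\{\pi r^2 : \text{there exists }\psi\in\mathrm{Sp}(\mathbb{R}^{2n})\text{ with }\psi(U)\subset Z^{2n}(r)\}.$$ The quantity $c(B^{2n})$ is the common value $\pi$ taken on $B^{2n}$ by all (normalized) symplectic capacities $c$. A convex body is a bounded convex set with non-empty interior; centrally symmetric means $K=-K$. $X_K$ is $\mathbb{R}^{2n}$ with the norm $\|x\|_K=\inf\{r>0: x\in rK\}$. $\mathrm{Vol}$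 is Lebesgue measure. For a Banach space $X$ and $1\le p\le 2$, the type-$p$ constant $T_p(X)$ is the smallest $C$ such that for all $m$ and all $x_1,\ldots,x_m\in X$, $$\left(\int_{\{-1,1\}^m}\Big\|\sum_{i=1}^m t_ix_i\Big\|_X^2\,d\mu(t)\right)^{1/2}\le C\left(\sum_{i=1}^m\|x_i\|_X^p\right)^{1/p},$$ where $\mu$ is the uniform probability measure on $\{-1,1\}^m$. *)

theory Defs
  imports "HOL-Probability.Probability"
begin

text \<open>
  The dimension is bound inside the statement (the constant must not depend on it), so
  \<open>\<real>\<^sup>m\<close> is an explicit carrier: the extensional functions on \<open>{..<m}\<close>, i.e. the underlying set
  of the product measure \<open>\<Pi>\<^sub>M i\<in>{..<m}. lborel\<close>. The point \<open>(x\<^sub>1, y\<^sub>1, \<dots>, x\<^sub>n, y\<^sub>n)\<close> of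
  \<open>\<real>\<^sup>2\<^sup>n\<close> is represented by \<open>v\<close> with \<open>x\<^sub>j = v (2 * (j - 1))\<close> and \<open>y\<^sub>j = v (2 * (j - 1) + 1)\<close>.
\<close>

definition rspace :: "nat \<Rightarrow> (nat \<Rightarrow> real) set" where
  "rspace m = {..<m} \<rightarrow>\<^sub>E UNIV"

definition vadd :: "nat \<Rightarrow> (nat \<Rightarrow> real) \<Rightarrow> (nat \<Rightarrow> real) \<Rightarrow> nat \<Rightarrow> real" where
  "vadd m x y = (\<lambda>i\<in>{..<m}. x i + y i)"

definition vscale :: "nat \<Rightarrow> real \<Rightarrow> (nat \<Rightarrow> real) \<Rightarrow> nat \<Rightarrow> real" where
  "vscale m a x = (\<lambda>i\<in>{..<m}. a * x i)"

definition enorm :: "nat \<Rightarrow> (nat \<Rightarrow> real) \<Rightarrow> real" where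
  "enorm m x = L2_set x {..<m}"

definition eball :: "nat \<Rightarrow> (nat \<Rightarrow> real) \<Rightarrow> real \<Rightarrow> (nat \<Rightarrow> real) set" where
  "eball m a r = {x \<in> rspace m. enorm m (\<lambda>i. x i - a i) < r}"

definition eball0 :: "nat \<Rightarrow> real \<Rightarrow> (nat \<Rightarrow> real) set" where
  "eball0 m r = eball m (\<lambda>i\<in>{..<m}. 0) r"

text \<open>Convex bodies need not be Borel sets, hence the completion.\<close>

definition Vol :: "nat \<Rightarrow> (nat \<Rightarrow> real) set \<Rightarrow> real" where
  "Vol m K = measure (completion (\<Pi>\<^sub>M i\<in>{..<m}. lborel)) K"

definition symplectic_form :: "nat \<Rightarrow> (nat \<Rightarrow> real) \<Rightarrow> (nat \<Rightarrow> real) \<Rightarrow> real" where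
  "symplectic_form n u v = (\<Sum>j<n. u (2 * j) * v (2 * j + 1) - u (2 * j + 1) * v (2 * j))"

definition linear_map :: "nat \<Rightarrow> ((nat \<Rightarrow> real) \<Rightarrow> (nat \<Rightarrow> real)) \<Rightarrow> bool" where
  "linear_map m \<psi> \<longleftrightarrow>
     \<psi> \<in> rspace m \<rightarrow> rspace m \<and>
     (\<forall>x\<in>rspace m. \<forall>y\<in>rspace m. \<psi> (vadd m x y) = vadd m (\<psi> x) (\<psi> y)) \<and>
     (\<forall>a. \<forall>x\<in>rspace m. \<psi> (vscale m a x) = vscale m a (\<psi> x))"

definition Sp :: "nat \<Rightarrow> ((nat \<Rightarrow> real) \<Rightarrow> (nat \<Rightarrow> real)) set" where
  "Sp n = {\<psi>. linear_map (2 * n) \<psi> \<and>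
     (\<forall>u\<in>rspace (2 * n). \<forall>v\<in>rspace (2 * n).
        symplectic_form n (\<psi> u) (\<psi> v) = symplectic_form n u v)}"

definition cylinder :: "nat \<Rightarrow> real \<Rightarrow> (nat \<Rightarrow> real) set" where
  "cylinder n r = {x \<in> rspace (2 * n). restrict x {..<2} \<in> eball0 2 r}"

text \<open>The value is \<open>\<infinity>\<close> if no linear symplectic image of \<open>U\<close> lies in a cylinder.\<close>

definition cZ_lin :: "nat \<Rightarrow> (nat \<Rightarrow> real) set \<Rightarrow> ereal" where
  "cZ_lin n U = Inf {ereal (pi * r\<^sup>2) | r. 0 < r \<and> (\<exists>\<psi>\<in>Sp n. \<psi> ` U \<subseteq> cylinder n r)}"

text \<open>
  All normalized symplectic capacities \<open>c\<close> satisfy \<open>c (B\<^sup>2\<^sup>n) = \<pi>\<close>, by the normalization axiom.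
\<close>

definition ball_capacity :: real where
  "ball_capacity = pi"

definition convex_body :: "nat \<Rightarrow> (nat \<Rightarrow> real) set \<Rightarrow> bool" where
  "convex_body m K \<longleftrightarrow>
     K \<subseteq> rspace m \<and>
     (\<exists>R. \<forall>x\<in>K. enorm m x \<le> R) \<and>
     (\<forall>x\<in>K. \<forall>y\<in>K. \<forall>u v. 0 \<le> u \<and> 0 \<le> v \<and> u + v = 1 \<longrightarrow>
        vadd m (vscale m u x) (vscale m v y) \<in> K) \<and>
     (\<exists>a\<in>rspace m. \<exists>r>0. eball m a r \<subseteq> K)"

definition centrally_symmetric :: "nat \<Rightarrow> (nat \<Rightarrow> real) set \<Rightarrow> bool" where
  "centrally_symmetric m K \<longleftrightarrow> vscale m (- 1) ` K = K"

definition gauge_norm :: "nat \<Rightarrow> (nat \<Rightarrow> real) set \<Rightarrow> (nat \<Rightarrow> real) \<Rightarrow> real" where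
  "gauge_norm m K x = Inf {r. 0 < r \<and> x \<in> vscale m r ` K}"

definition signs :: "nat \<Rightarrow> (nat \<Rightarrow> real) set" where
  "signs k = {..<k} \<rightarrow>\<^sub>E {- 1, 1}"

text \<open>\<open>type_ineq d N p C\<close>: the space \<open>\<real>\<^sup>d\<close> with norm \<open>N\<close> has type \<open>p\<close> with constant \<open>C\<close>.\<close>

definition type_ineq :: "nat \<Rightarrow> ((nat \<Rightarrow> real) \<Rightarrow> real) \<Rightarrow> real \<Rightarrow> real \<Rightarrow> bool" where
  "type_ineq d N p C \<longleftrightarrow>
     (\<forall>m. \<forall>x. (\<forall>i<m. x i \<in> rspace d) \<longrightarrow>
        sqrt (measure_pmf.expectation (pmf_of_set (signs m))
               (\<lambda>t. (N (\<lambda>k\<in>{..<d}. \<Sum>i<m. t i * x i k))\<^sup>2))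
        \<le> C * (\<Sum>i<m. N (x i) powr p) powr (1 / p))"

definition type_const :: "nat \<Rightarrow> ((nat \<Rightarrow> real) \<Rightarrow> real) \<Rightarrow> real \<Rightarrow> ereal" where
  "type_const d N p = Inf {ereal C | C. 0 \<le> C \<and> type_ineq d N p C}"

end

theory Submission
  imports
    Defs
    "HOL-Complex_Analysis.Complex_Analysis"
    "HOL-Real_Asymp.Real_Asymp"
    "Jordan_Normal_Form.Determinant"
begin

text \<open>
  Let \<open>d = 2 n\<close>, let \<open>J\<close> be the rotation with \<open>\<omega> (z, w) = \<langle>z, J w\<rangle>\<close>, and let \<open>h\<close> be the support function
  of \<open>K\<close>. Two vectors with \<open>\<omega> (a, b) = 1\<close> can be moved to the first two basis vectors by a linear
  symplectic map, which then puts \<open>K\<close> into a cylinder of squared radius about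
  \<open>h (J a)\<^sup>2 + h (J b)\<^sup>2\<close> (\<open>cZ_lin_le\<close>). So the capacity can only exceed \<open>2 \<pi> / \<mu>\<close> if
  \<open>\<omega> (a, b) \<le> \<mu> h (J a) h (J b)\<close> for all \<open>a\<close> and \<open>b\<close>, and by the bipolar theorem this means that \<open>J\<close> maps
  the polar body of \<open>K\<close> into \<open>\<mu> K\<close> (\<open>N_Jf_le\<close>). A lower bound for the product of the volumes of \<open>K\<close> and
  its polar of the order \<open>(c / n)\<^sup>d\<close>, a reverse Santalo inequality, then bounds the volume of \<open>K\<close> from
  below by \<open>(c / (\<mu> n))\<^sup>n\<close>, which is the claim because the Euclidean ball has volume at most
  \<open>(\<pi> e / n)\<^sup>n\<close>.

  The reverse Santalo inequality comes from Lewis' position and \<open>K\<close>-convexity. Choose a basis \<open>U\<close> of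
  maximal determinant among those with normalised Rademacher average at most \<open>1\<close>. A variational argument
  (\<open>lewis_position\<close>) bounds the pairing of the dual basis \<open>V\<close> with any system \<open>W\<close> by \<open>d\<close> times the
  Rademacher average of \<open>W\<close>. If the Rademacher projection is bounded by \<open>A\<close>, this says that the
  Rademacher average of \<open>V\<close> in the dual norm is at most \<open>2 d A\<close> (\<open>dual_position\<close>). Averages over the
  vertices of a cube dominate averages over the solid cube, so half of the parallelepiped spanned
  by \<open>U\<close> lies in a multiple of \<open>K\<close>, and half of the one spanned by \<open>V\<close> in a multiple of the order \<open>d\<close> of
  the polar (\<open>emeasure_ball_ge\<close>). The determinants of \<open>U\<close> and \<open>V\<close> cancel (\<open>volume_lower_bound\<close>).

  That type \<open>p > 1\<close> bounds the Rademacher projection independently of the dimension is a theorem of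
  Pisier (\<open>K_convexity\<close>). Let \<open>N\<close> be the operator that multiplies Walsh functions by their degree;
  the contractions \<open>e\<^sup>-\<^sup>t\<^sup>N\<close> are averages of conditional expectations. A product of \<open>k\<close> operators
  \<open>1 - E\<close>, with commuting conditional expectations \<open>E\<close>, is an alternating sum of \<open>2\<^sup>k\<close> contractions,
  and type excludes that its norm is close to \<open>2\<^sup>k\<close> (\<open>mult_prod_one_minus_avg\<close>). Hence
  \<open>(1 - e\<^sup>-\<^sup>t\<^sup>N)\<^sup>k\<close> has norm at most \<open>2\<^sup>k - 1/2\<close>, and \<open>\<eta> + e\<^sup>-\<^sup>t\<^sup>N\<close> has an inverse bounded uniformly in
  \<open>t\<close> for some \<open>\<eta> < 1\<close>. This bounds the resolvent of \<open>N\<close> on the edges of a sector that contains its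
  spectrum (\<open>cmult_resolvent\<close>), and a contour integral along the edges produces the projection onto
  degree one (\<open>mult_degree_one\<close>).
\<close>

section \<open>Multipliers on vector-valued Walsh polynomials\<close>

text \<open>
  Functions on the discrete cube with values in a normed space are studied through their Walsh
  expansions. Vectors are sequences of reals and norms are functions of sequences, so that one
  type serves all dimensions. The constant Walsh function is left out (\<open>freqs\<close>): on the
  functions of mean zero that remain, the number operator is invertible.
\<close>

definition walsh :: "nat set \<Rightarrow> (nat \<Rightarrow> real) \<Rightarrow> real" where
  "walsh A t = (\<Prod>i\<in>A. t i)"

definition cube_norm :: "((nat \<Rightarrow> real) \<Rightarrow> real) \<Rightarrow> nat \<Rightarrow> ((nat \<Rightarrow> real) \<Rightarrow> nat \<Rightarrow> real) \<Rightarrow> real" where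
  "cube_norm N m f = L2_set (\<lambda>t. N (f t)) (signs m)"

definition freqs :: "nat \<Rightarrow> nat set set" where
  "freqs m = Pow {..<m} - {{}}"

definition wpoly :: "nat \<Rightarrow> (nat set \<Rightarrow> nat \<Rightarrow> real) \<Rightarrow> (nat \<Rightarrow> real) \<Rightarrow> nat \<Rightarrow> real" where
  "wpoly m x t = (\<lambda>k. \<Sum>A\<in>freqs m. walsh A t * x A k)"

lemma finite_signs [simp]: "finite (signs m)"
  by (auto simp: signs_def intro: finite_PiE)

lemma card_signs: "card (signs m) = 2 ^ m"
  by (simp add: signs_def card_PiE numeral_2_eq_2)

lemma signs_cases: "t \<in> signs m \<Longrightarrow> i < m \<Longrightarrow> t i = 1 \<or> t i = -1"
  by (auto simp: signs_def PiE_def Pi_def)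

lemma finite_freqs [simp]: "finite (freqs m)"
  by (simp add: freqs_def)

lemma freqs_subset: "A \<in> freqs m \<Longrightarrow> A \<subseteq> {..<m}" "A \<in> freqs m \<Longrightarrow> A \<noteq> {}"
  by (auto simp: freqs_def)

lemma abs_walsh: "t \<in> signs m \<Longrightarrow> A \<subseteq> {..<m} \<Longrightarrow> \<bar>walsh A t\<bar> = 1"
  unfolding walsh_def abs_prod
  by (rule prod.neutral) (use signs_cases in fastforce)

lemma cube_norm_sq: "(cube_norm N m f)\<^sup>2 = (\<Sum>t\<in>signs m. (N (f t))\<^sup>2)"
  by (simp add: cube_norm_def L2_set_def sum_nonneg)

locale seminorm_fun =
  fixes N :: "(nat \<Rightarrow> real) \<Rightarrow> real"
  assumes N_add: "N (\<lambda>k. x k + y k) \<le> N x + N y"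
    and N_scale: "N (\<lambda>k. c * x k) = \<bar>c\<bar> * N x"
begin

lemma N_zero: "N (\<lambda>k. 0) = 0"
  using N_scale[of 0 "\<lambda>k. 0"] by simp

lemma N_uminus: "N (\<lambda>k. - x k) = N x"
  using N_scale[of "-1" x] by simp

lemma N_nonneg: "0 \<le> N x"
  using N_add[of x "\<lambda>k. - x k"] by (simp add: N_zero N_uminus)

lemma N_sum: "N (\<lambda>k. \<Sum>i\<in>I. f i k) \<le> (\<Sum>i\<in>I. N (f i))"
proof (induction I rule: infinite_finite_induct)
  case (insert i I)
  then show ?case using N_add[of "f i" "\<lambda>k. \<Sum>i\<in>I. f i k"] by auto
qed (auto simp: N_zero)

lemma N_sum_scale: "N (\<lambda>k. \<Sum>i\<in>I. c i * x i k) \<le> (\<Sum>i\<in>I. \<bar>c i\<bar> * N (x i))"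
  using N_sum[of "\<lambda>i k. c i * x i k" I] by (simp add: N_scale)

lemma N_diff: "N (\<lambda>k. x k - y k) \<le> N x + N y"
  using N_add[of x "\<lambda>k. - y k"] by (simp add: N_uminus)

abbreviation "Lnorm \<equiv> cube_norm N"

lemma Lnorm_nonneg: "0 \<le> Lnorm m f"
  by (simp add: cube_norm_def L2_set_nonneg)

lemma Lnorm_cong: "(\<And>t. t \<in> signs m \<Longrightarrow> f t = g t) \<Longrightarrow> Lnorm m f = Lnorm m g"
  unfolding cube_norm_def by (rule L2_set_cong) auto

lemma Lnorm_add: "Lnorm m (\<lambda>t k. f t k + g t k) \<le> Lnorm m f + Lnorm m g"
proof -
  have "Lnorm m (\<lambda>t k. f t k + g t k) \<le> L2_set (\<lambda>t. N (f t) + N (g t)) (signs m)"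
    unfolding cube_norm_def by (intro L2_set_mono N_add N_nonneg)
  also have "\<dots> \<le> Lnorm m f + Lnorm m g"
    unfolding cube_norm_def by (rule L2_set_triangle_ineq)
  finally show ?thesis .
qed

lemma Lnorm_scale: "Lnorm m (\<lambda>t k. c * f t k) = \<bar>c\<bar> * Lnorm m f"
  unfolding cube_norm_def N_scale by (simp add: L2_set_right_distrib)

lemma Lnorm_zero: "Lnorm m (\<lambda>t k. 0) = 0"
  using Lnorm_scale[of m 0 "\<lambda>t k. 0"] by simp

lemma Lnorm_diff: "Lnorm m (\<lambda>t k. f t k - g t k) \<le> Lnorm m f + Lnorm m g"
  using Lnorm_add[of m f "\<lambda>t k. - g t k"] Lnorm_scale[of m "-1" g] by simp

lemma Lnorm_sum: "Lnorm m (\<lambda>t k. \<Sum>i\<in>I. f i t k) \<le> (\<Sum>i\<in>I. Lnorm m (f i))"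
proof (induction I rule: infinite_finite_induct)
  case (insert i I)
  then show ?case using Lnorm_add[of m "f i" "\<lambda>t k. \<Sum>i\<in>I. f i t k"] by auto
qed (auto simp: Lnorm_zero)

text \<open>
  \<open>mult m a B\<close> bounds by \<open>B\<close> the norm of the Fourier multiplier with symbol \<open>a\<close>. Quantifying over
  coefficient families instead of functions makes composition of multipliers trivial.
\<close>

definition mult :: "nat \<Rightarrow> (nat set \<Rightarrow> real) \<Rightarrow> real \<Rightarrow> bool" where
  "mult m a B \<longleftrightarrow> 0 \<le> B \<and>
     (\<forall>x. Lnorm m (wpoly m (\<lambda>A k. a A * x A k)) \<le> B * Lnorm m (wpoly m x))"

lemma multD: "mult m a B \<Longrightarrow> Lnorm m (wpoly m (\<lambda>A k. a A * x A k)) \<le> B * Lnorm m (wpoly m x)"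
  by (simp add: mult_def)

lemma mult_nonneg: "mult m a B \<Longrightarrow> 0 \<le> B"
  by (simp add: mult_def)

lemma wpoly_cong: "(\<And>A. A \<in> freqs m \<Longrightarrow> x A = y A) \<Longrightarrow> wpoly m x = wpoly m y"
  by (auto simp: wpoly_def fun_eq_iff intro!: sum.cong)

lemma mult_cong: "mult m a B \<Longrightarrow> (\<And>A. A \<in> freqs m \<Longrightarrow> a A = b A) \<Longrightarrow> mult m b B"
proof -
  assume a: "mult m a B" and eq: "\<And>A. A \<in> freqs m \<Longrightarrow> a A = b A"
  have "wpoly m (\<lambda>A k. a A * x A k) = wpoly m (\<lambda>A k. b A * x A k)" for x
    by (rule wpoly_cong) (simp add: eq)
  with a show ?thesis by (simp add: mult_def)
qed

lemma mult_weaken: "mult m a B \<Longrightarrow> B \<le> C \<Longrightarrow> mult m a C"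
  unfolding mult_def by (meson Lnorm_nonneg mult_right_mono order_trans)

lemma mult_one: "mult m (\<lambda>A. 1) 1"
  by (simp add: mult_def)

lemma wpoly_add: "wpoly m (\<lambda>A k. x A k + y A k) = (\<lambda>t k. wpoly m x t k + wpoly m y t k)"
  by (simp add: wpoly_def distrib_left sum.distrib fun_eq_iff)

lemma wpoly_scale: "wpoly m (\<lambda>A k. c * x A k) = (\<lambda>t k. c * wpoly m x t k)"
  by (simp add: wpoly_def sum_distrib_left fun_eq_iff algebra_simps)

lemma mult_add: "mult m a B \<Longrightarrow> mult m b C \<Longrightarrow> mult m (\<lambda>A. a A + b A) (B + C)"
proof -
  assume ab: "mult m a B" "mult m b C"
  have "Lnorm m (wpoly m (\<lambda>A k. (a A + b A) * x A k)) \<le> (B + C) * Lnorm m (wpoly m x)" for x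
    using Lnorm_add[of m "wpoly m (\<lambda>A k. a A * x A k)" "wpoly m (\<lambda>A k. b A * x A k)"]
      multD[OF ab(1), of x] multD[OF ab(2), of x]
    by (simp add: wpoly_add[symmetric] distrib_right)
  with ab show ?thesis by (auto simp: mult_def)
qed

lemma mult_scale: "mult m a B \<Longrightarrow> mult m (\<lambda>A. c * a A) (\<bar>c\<bar> * B)"
proof -
  assume a: "mult m a B"
  have "Lnorm m (wpoly m (\<lambda>A k. c * a A * x A k)) \<le> \<bar>c\<bar> * B * Lnorm m (wpoly m x)" for x
    using mult_left_mono[OF multD[OF a, of x], of "\<bar>c\<bar>"]
    by (simp add: mult.assoc wpoly_scale Lnorm_scale)
  with a show ?thesis by (auto simp: mult_def)
qed

lemma mult_zero: "mult m (\<lambda>A. 0) 0"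
  using mult_scale[OF mult_one, of m 0] by simp

lemma mult_minus: "mult m a B \<Longrightarrow> mult m b C \<Longrightarrow> mult m (\<lambda>A. a A - b A) (B + C)"
  using mult_add[OF _ mult_scale, of m a B b C "-1"] by simp

lemma mult_sum: "(\<And>i. i \<in> I \<Longrightarrow> mult m (a i) (B i)) \<Longrightarrow> mult m (\<lambda>A. \<Sum>i\<in>I. a i A) (\<Sum>i\<in>I. B i)"
  by (induction I rule: infinite_finite_induct) (auto simp: mult_zero intro: mult_add)

lemma mult_prod: "mult m a B \<Longrightarrow> mult m b C \<Longrightarrow> mult m (\<lambda>A. a A * b A) (B * C)"
proof -
  assume ab: "mult m a B" "mult m b C"
  have "Lnorm m (wpoly m (\<lambda>A k. a A * b A * x A k)) \<le> B * C * Lnorm m (wpoly m x)" for x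
    using multD[OF ab(1), of "\<lambda>A k. b A * x A k"]
      mult_left_mono[OF multD[OF ab(2), of x] mult_nonneg[OF ab(1)]]
    by (simp add: mult.assoc)
  with ab show ?thesis by (auto simp: mult_def)
qed

lemma mult_power: "mult m a B \<Longrightarrow> mult m (\<lambda>A. a A ^ j) (B ^ j)"
  by (induction j) (auto simp: mult_one intro: mult_prod)

lemma mult_finite_prod:
  "(\<And>i. i \<in> I \<Longrightarrow> mult m (a i) 1) \<Longrightarrow> mult m (\<lambda>A. \<Prod>i\<in>I. a i A) 1"
proof (induction I rule: infinite_finite_induct)
  case (insert i I)
  then show ?case using mult_prod[of m "a i" 1 "\<lambda>A. \<Prod>i\<in>I. a i A" 1] by simp
qed (auto simp: mult_one)

text \<open>If \<open>g = f + b g\<close>, then \<open>\<parallel>g\<parallel> \<le> \<parallel>f\<parallel> + B \<parallel>g\<parallel>\<close>; this replaces summing the Neumann series.\<close>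

lemma mult_inverse:
  assumes b: "mult m b B" and "B < 1" and ne: "\<And>A. A \<in> freqs m \<Longrightarrow> b A \<noteq> 1"
  shows "mult m (\<lambda>A. 1 / (1 - b A)) (1 / (1 - B))"
proof -
  have "Lnorm m (wpoly m (\<lambda>A k. 1 / (1 - b A) * x A k)) \<le> 1 / (1 - B) * Lnorm m (wpoly m x)" for x
  proof -
    let ?g = "\<lambda>A k. 1 / (1 - b A) * x A k"
    have "wpoly m ?g = wpoly m (\<lambda>A k. x A k + b A * ?g A k)"
      by (rule wpoly_cong) (use ne in \<open>auto simp: fun_eq_iff field_simps\<close>)
    then have "Lnorm m (wpoly m ?g) \<le> Lnorm m (wpoly m x) + B * Lnorm m (wpoly m ?g)"
      using Lnorm_add[of m "wpoly m x" "wpoly m (\<lambda>A k. b A * ?g A k)"] multD[OF b, of ?g]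
      unfolding wpoly_add by simp
    then show ?thesis using \<open>B < 1\<close> by (simp add: field_simps)
  qed
  then show ?thesis using \<open>B < 1\<close> by (simp add: mult_def)
qed

lemma Lnorm_wpoly_le:
  "Lnorm m (wpoly m x) \<le> (\<Sum>A\<in>freqs m. Lnorm m (\<lambda>t. x A))"
proof -
  have "Lnorm m (wpoly m x) = Lnorm m (\<lambda>t k. \<Sum>A\<in>freqs m. walsh A t * x A k)"
    by (rule Lnorm_cong) (simp add: wpoly_def)
  also have "\<dots> \<le> (\<Sum>A\<in>freqs m. Lnorm m (\<lambda>t k. walsh A t * x A k))"
    by (rule Lnorm_sum)
  also have "\<dots> = (\<Sum>A\<in>freqs m. Lnorm m (\<lambda>t. x A))"
    unfolding cube_norm_def
    by (intro sum.cong refl L2_set_cong) (auto simp: N_scale abs_walsh freqs_subset)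
  finally show ?thesis .
qed

text \<open>
  In finite dimensions pointwise convergence of symbols is convergence of operators. The filter is
  kept general because the limits below run along sequences as well as along tagged divisions.
\<close>

lemma mult_limit:
  assumes nontriv: "Fl \<noteq> bot" and a: "\<forall>\<^sub>F n in Fl. mult m (a n) (B n)"
    and lim: "\<And>A. A \<in> freqs m \<Longrightarrow> ((\<lambda>n. a n A) \<longlongrightarrow> b A) Fl" and limB: "(B \<longlongrightarrow> C) Fl"
  shows "mult m b C"
proof -
  have "Lnorm m (wpoly m (\<lambda>A k. b A * x A k)) \<le> C * Lnorm m (wpoly m x)" for x
  proof (rule tendsto_le[OF nontriv])
    have "((\<lambda>n. B n * Lnorm m (wpoly m x)
             + (\<Sum>A\<in>freqs m. \<bar>b A - a n A\<bar> * Lnorm m (\<lambda>t. x A))) \<longlongrightarrow>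
          C * Lnorm m (wpoly m x) + (\<Sum>A\<in>freqs m. \<bar>b A - b A\<bar> * Lnorm m (\<lambda>t. x A))) Fl"
      by (intro tendsto_intros limB lim)
    then show "((\<lambda>n. B n * Lnorm m (wpoly m x)
             + (\<Sum>A\<in>freqs m. \<bar>b A - a n A\<bar> * Lnorm m (\<lambda>t. x A))) \<longlongrightarrow> C * Lnorm m (wpoly m x)) Fl"
      by simp
    show "((\<lambda>n. Lnorm m (wpoly m (\<lambda>A k. b A * x A k))) \<longlongrightarrow> Lnorm m (wpoly m (\<lambda>A k. b A * x A k))) Fl"
      by simp
    have "Lnorm m (wpoly m (\<lambda>A k. b A * x A k)) \<le> B n * Lnorm m (wpoly m x)
             + (\<Sum>A\<in>freqs m. \<bar>b A - a n A\<bar> * Lnorm m (\<lambda>t. x A))" if a: "mult m (a n) (B n)" for n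
    proof -
      have "(\<lambda>A k. b A * x A k) = (\<lambda>A k. a n A * x A k + (b A - a n A) * x A k)"
        by (simp add: fun_eq_iff algebra_simps)
      then have "Lnorm m (wpoly m (\<lambda>A k. b A * x A k))
          \<le> Lnorm m (wpoly m (\<lambda>A k. a n A * x A k)) + Lnorm m (wpoly m (\<lambda>A k. (b A - a n A) * x A k))"
        by (simp add: wpoly_add Lnorm_add)
      also have "Lnorm m (wpoly m (\<lambda>A k. (b A - a n A) * x A k))
          \<le> (\<Sum>A\<in>freqs m. \<bar>b A - a n A\<bar> * Lnorm m (\<lambda>t. x A))"
        using Lnorm_wpoly_le[of m "\<lambda>A k. (b A - a n A) * x A k"]
          Lnorm_scale[of m _ "\<lambda>t. x _"] by simp
      finally show ?thesis using multD[OF a, of x] by linarith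
    qed
    with a show "\<forall>\<^sub>F n in Fl. Lnorm m (wpoly m (\<lambda>A k. b A * x A k)) \<le> B n * Lnorm m (wpoly m x)
             + (\<Sum>A\<in>freqs m. \<bar>b A - a n A\<bar> * Lnorm m (\<lambda>t. x A))"
      by (rule eventually_mono)
  qed
  moreover have "0 \<le> C"
  proof (rule tendsto_lowerbound[OF limB _ nontriv])
    show "\<forall>\<^sub>F n in Fl. 0 \<le> B n" using a by (rule eventually_mono) (rule mult_nonneg)
  qed
  ultimately show ?thesis by (simp add: mult_def)
qed

text \<open>Reversing the \<open>i\<close>-th sign permutes the cube.\<close>

lemma mult_flip:
  assumes "i < m"
  shows "mult m (\<lambda>A. if i \<in> A then -1 else 1) 1"
proof -
  define F where "F t = t(i := - t i)" for t :: "nat \<Rightarrow> real"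
  have bij: "bij_betw F (signs m) (signs m)"
    by (rule bij_betwI[where g = F])
      (use assms in \<open>auto simp: F_def signs_def PiE_def Pi_def extensional_def fun_eq_iff\<close>)
  have w: "walsh A (F t) = (if i \<in> A then -1 else 1) * walsh A t" if "A \<in> freqs m" for A t
  proof -
    have fin: "finite A" using freqs_subset[OF that] finite_subset by blast
    show ?thesis
    proof (cases "i \<in> A")
      case True
      then have "walsh A (F t) = F t i * (\<Prod>j\<in>A-{i}. F t j)" "walsh A t = t i * (\<Prod>j\<in>A-{i}. t j)"
        using fin by (simp_all add: walsh_def prod.remove)
      moreover have "(\<Prod>j\<in>A-{i}. F t j) = (\<Prod>j\<in>A-{i}. t j)" by (rule prod.cong) (auto simp: F_def)
      ultimately show ?thesis using True by (simp add: F_def)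
    next
      case False
      then show ?thesis by (auto simp: walsh_def F_def intro!: prod.cong)
    qed
  qed
  have "Lnorm m (wpoly m (\<lambda>A k. (if i \<in> A then -1 else 1) * x A k)) = Lnorm m (wpoly m x)" for x
  proof -
    have "wpoly m (\<lambda>A k. (if i \<in> A then -1 else 1) * x A k) t = wpoly m x (F t)" for t
      unfolding wpoly_def by (intro ext sum.cong refl) (simp add: w)
    then have "Lnorm m (wpoly m (\<lambda>A k. (if i \<in> A then -1 else 1) * x A k))
        = sqrt (\<Sum>t\<in>signs m. (N (wpoly m x (F t)))\<^sup>2)"
      by (simp add: cube_norm_def L2_set_def)
    also have "\<dots> = sqrt (\<Sum>t\<in>signs m. (N (wpoly m x t))\<^sup>2)"
      using sum.reindex_bij_betw[OF bij, of "\<lambda>t. (N (wpoly m x t))\<^sup>2"] by simp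
    finally show ?thesis by (simp add: cube_norm_def L2_set_def)
  qed
  then show ?thesis by (simp add: mult_def)
qed

lemma mult_avg1: "i < m \<Longrightarrow> mult m (\<lambda>A. if i \<in> A then 0 else 1) 1"
proof -
  assume i: "i < m"
  have "mult m (\<lambda>A. 1/2 * (1 + (if i \<in> A then -1 else 1))) (\<bar>1/2\<bar> * (1 + 1))"
    by (intro mult_scale mult_add mult_one mult_flip i)
  then have "mult m (\<lambda>A. 1/2 * (1 + (if i \<in> A then -1 else 1))) 1" by simp
  then show ?thesis by (rule mult_cong) auto
qed

text \<open>\<open>avg S\<close> is the multiplier of the conditional expectation that averages out the signs in \<open>S\<close>.\<close>

definition avg :: "nat set \<Rightarrow> nat set \<Rightarrow> real" where
  "avg S A = (if A \<inter> S = {} then 1 else 0)"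

lemma avg_Un: "avg (S \<union> S') A = avg S A * avg S' A"
  by (auto simp: avg_def)

lemma mult_avg:
  assumes "S \<subseteq> {..<m}"
  shows "mult m (avg S) 1"
proof -
  have fin: "finite S" using assms finite_subset by blast
  have "mult m (\<lambda>A. \<Prod>i\<in>S. (if i \<in> A then 0 else 1)) 1"
    by (rule mult_finite_prod) (use assms in \<open>auto intro: mult_avg1\<close>)
  moreover have "(\<Prod>i\<in>S. (if i \<in> A then 0 else 1)) = avg S A" for A
  proof (cases "A \<inter> S = {}")
    case True
    then have "(\<Prod>i\<in>S. (if i \<in> A then 0 else 1::real)) = (\<Prod>i\<in>S. 1)"
      by (intro prod.cong) auto
    with True show ?thesis by (simp add: avg_def)
  next
    case False
    then have "(\<Prod>i\<in>S. (if i \<in> A then 0 else 1::real)) = 0"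
      using fin by (intro prod_zero) auto
    with False show ?thesis by (simp add: avg_def)
  qed
  ultimately show ?thesis by simp
qed

end

section \<open>Consequences of type\<close>

text \<open>Young's inequality against the quadratic mean: \<open>u powr (p / 2) \<le> (p / 2) u + 1 - p / 2\<close> for \<open>u \<ge> 0\<close>.\<close>

lemma power_mean_powr:
  fixes y :: "nat \<Rightarrow> real"
  assumes y: "\<And>j. j < k \<Longrightarrow> 0 \<le> y j" and p: "0 < p" "p \<le> 2" and k: "0 < k"
  shows "(\<Sum>j<k. y j powr p) powr (2 / p) \<le> real k powr (2 / p) * ((\<Sum>j<k. (y j)\<^sup>2) / k)"
proof -
  define S where "S = (\<Sum>j<k. (y j)\<^sup>2) / k"
  have S0: "0 \<le> S" by (simp add: S_def sum_nonneg)
  show ?thesis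
  proof (cases "S = 0")
    case True
    then have "(\<Sum>j<k. (y j)\<^sup>2) = 0" using k by (simp add: S_def)
    then have "y j = 0" if "j < k" for j using that by (simp add: sum_nonneg_eq_0_iff)
    then have "(\<Sum>j<k. y j powr p) = 0" by simp
    then show ?thesis using S0 by (simp flip: S_def)
  next
    case False
    with S0 have S: "0 < S" by simp
    have "y j powr p \<le> S powr (p/2) * (p/2 * ((y j)\<^sup>2 / S) + (1 - p/2))" if "j < k" for j
    proof (cases "y j = 0")
      case True
      then show ?thesis using p S by simp
    next
      case False
      with y[OF that] have yj: "0 < y j" by simp
      have "((y j)\<^sup>2 / S) powr (p/2) * 1 powr (1 - p/2) \<le> p/2 * ((y j)\<^sup>2 / S) + (1 - p/2) * 1"
        by (rule Youngs_inequality_0) (use p yj S in auto)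
      moreover have "((y j)\<^sup>2 / S) powr (p/2) = y j powr p / S powr (p/2)"
        using yj S by (simp add: powr_divide powr_powr flip: powr_numeral)
      ultimately show ?thesis using S by (simp add: field_simps)
    qed
    then have "(\<Sum>j<k. y j powr p) \<le> (\<Sum>j<k. S powr (p/2) * (p/2 * ((y j)\<^sup>2 / S) + (1 - p/2)))"
      by (intro sum_mono) auto
    also have "\<dots> = S powr (p/2) * (p/2 * ((\<Sum>j<k. (y j)\<^sup>2) / S) + k * (1 - p/2))"
      by (simp add: sum.distrib flip: sum_distrib_left sum_divide_distrib)
    also have "(\<Sum>j<k. (y j)\<^sup>2) = k * S" using k by (simp add: S_def)
    finally have "(\<Sum>j<k. y j powr p) \<le> S powr (p/2) * k"
      using S by (simp add: algebra_simps)
    then have "(\<Sum>j<k. y j powr p) powr (2/p) \<le> (S powr (p/2) * k) powr (2/p)"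
      by (intro powr_mono2 sum_nonneg) (use p in auto)
    also have "\<dots> = S * k powr (2/p)"
      using S p by (simp add: powr_mult powr_powr)
    finally show ?thesis by (simp add: S_def mult.commute)
  qed
qed

text \<open>The type inequality, with the average over the signs written out and squared.\<close>

locale type_fun = seminorm_fun +
  fixes p C :: real
  assumes p1: "1 < p" and p2: "p \<le> 2" and C0: "0 \<le> C"
    and type_bound: "(\<Sum>t\<in>signs k. (N (\<lambda>i. \<Sum>j<k. t j * x j i))\<^sup>2) / 2 ^ k
                       \<le> C\<^sup>2 * (\<Sum>j<k. N (x j) powr p) powr (2 / p)"
begin

text \<open>
  Type passes from the space to square integrable functions on the cube by integrating the type
  inequality pointwise. Consequently \<open>k\<close> functions of norm at most \<open>L\<close> cannot have all their signed
  sums of norm close to \<open>k L\<close>: the space contains no almost isometric copy of \<open>\<ell>\<^sub>1\<^sup>k\<close>.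
\<close>

lemma Lnorm_type:
  assumes F: "\<And>j. j < k \<Longrightarrow> Lnorm m (F j) \<le> L" and k: "0 < k"
    and low: "\<And>s. s \<in> signs k \<Longrightarrow> l \<le> Lnorm m (\<lambda>t i. \<Sum>j<k. s j * F j t i)" and "0 \<le> l"
  shows "l \<le> C * k powr (1 / p) * L"
proof -
  have "0 \<le> L" using F[OF k] Lnorm_nonneg order_trans by blast
  have "2 ^ k * l\<^sup>2 = (\<Sum>s\<in>signs k. l\<^sup>2)" by (simp add: card_signs)
  also have "\<dots> \<le> (\<Sum>s\<in>signs k. (Lnorm m (\<lambda>t i. \<Sum>j<k. s j * F j t i))\<^sup>2)"
    by (intro sum_mono power_mono low \<open>0 \<le> l\<close>)
  also have "\<dots> = (\<Sum>t\<in>signs m. \<Sum>s\<in>signs k. (N (\<lambda>i. \<Sum>j<k. s j * F j t i))\<^sup>2)"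
    unfolding cube_norm_sq by (rule sum.swap)
  also have "\<dots> \<le> (\<Sum>t\<in>signs m. 2 ^ k * (C\<^sup>2 * (\<Sum>j<k. N (F j t) powr p) powr (2 / p)))"
    using type_bound[where k = k and x = "\<lambda>j. F j t" for t]
    by (intro sum_mono) (simp add: field_simps)
  also have "\<dots> \<le> (\<Sum>t\<in>signs m. 2 ^ k * (C\<^sup>2 * (k powr (2 / p) * ((\<Sum>j<k. (N (F j t))\<^sup>2) / k))))"
    by (intro sum_mono mult_left_mono power_mean_powr) (use p1 p2 k N_nonneg in auto)
  also have "\<dots> = 2 ^ k * C\<^sup>2 * k powr (2 / p) / k * (\<Sum>j<k. (Lnorm m (F j))\<^sup>2)"
    unfolding cube_norm_sq by (subst sum.swap[where A = "{..<k}"]) (simp add: sum_distrib_left sum_divide_distrib algebra_simps)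
  also have "\<dots> \<le> 2 ^ k * C\<^sup>2 * k powr (2 / p) / k * (\<Sum>j<k. L\<^sup>2)"
    by (intro mult_left_mono sum_mono power_mono F Lnorm_nonneg) auto
  also have "\<dots> = 2 ^ k * (C * k powr (1 / p) * L)\<^sup>2"
    using k by (simp add: power_mult_distrib powr_powr flip: powr_numeral)
  finally have "l\<^sup>2 \<le> (C * k powr (1 / p) * L)\<^sup>2" by simp
  then show ?thesis using C0 \<open>0 \<le> L\<close> by (simp add: abs_le_square_iff[symmetric] \<open>0 \<le> l\<close>)
qed

end

context seminorm_fun
begin

lemma avg_UNION: "finite A \<Longrightarrow> avg (\<Union>i\<in>A. S i) F = (\<Prod>i\<in>A. avg (S i) F)"
  by (induction A rule: finite_induct) (auto simp: avg_Un, simp add: avg_def)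

lemma prod_one_minus_avg:
  fixes k :: nat
  shows "(\<Prod>i<k. 1 - avg (S i) F) = (\<Sum>A\<in>Pow {..<k}. (-1) ^ card A * avg (\<Union>i\<in>A. S i) F)"
proof -
  have "(\<Prod>i<k. 1 - avg (S i) F) = (\<Prod>i<k. - avg (S i) F + 1)" by simp
  also have "\<dots> = (\<Sum>A\<in>Pow {..<k}. (\<Prod>i\<in>A. - avg (S i) F) * (\<Prod>i\<in>{..<k} - A. 1))"
    by (rule prod_add) simp
  also have "\<dots> = (\<Sum>A\<in>Pow {..<k}. (-1) ^ card A * avg (\<Union>i\<in>A. S i) F)"
    by (intro sum.cong refl) (auto simp: prod_uminus avg_UNION finite_subset)
  finally show ?thesis .
qed

end

text \<open>
  Along the chain \<open>{..<j} \<union> B\<close> the parity of the cardinality changes exactly at the indices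
  outside \<open>B\<close>, so every pattern of signs is, up to a global sign, the parity pattern of some chain.
\<close>

lemma chain_parity:
  assumes s: "s \<in> signs k"
  obtains B where "B \<subseteq> {..<k}"
    "\<And>j. j < k \<Longrightarrow> s j = s 0 * (-1) ^ card ({..<0} \<union> B) * (-1) ^ card ({..<j} \<union> B)"
proof
  define B where "B = {j. Suc j < k \<and> s j = s (Suc j)}"
  show B: "B \<subseteq> {..<k}" by (auto simp: B_def)
  then have fin: "finite B" using finite_subset by blast
  show "s j = s 0 * (-1) ^ card ({..<0} \<union> B) * (-1) ^ card ({..<j} \<union> B)" if "j < k" for j
    using that
  proof (induction j)
    case 0
    then show ?case by (simp flip: power_mult_distrib)
  next
    case (Suc j)
    show ?case
    proof (cases "j \<in> B")
      case True
      then have "{..<Suc j} \<union> B = {..<j} \<union> B" by (auto simp: less_Suc_eq)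
      with True Suc show ?thesis by (simp add: B_def)
    next
      case False
      then have "{..<Suc j} \<union> B = insert j ({..<j} \<union> B)" by (auto simp: less_Suc_eq)
      then have "card ({..<Suc j} \<union> B) = Suc (card ({..<j} \<union> B))" using False fin by simp
      moreover have "s (Suc j) = - s j"
        using False Suc.prems signs_cases[OF s, of j] signs_cases[OF s, of "Suc j"]
        by (auto simp: B_def)
      ultimately show ?thesis using Suc by simp
    qed
  qed
qed

context type_fun
begin

text \<open>
  Pisier's lemma. The product is an alternating sum of \<open>2\<^sup>k\<close> contractions. If its norm were close to
  \<open>2\<^sup>k\<close>, then almost no cancellation would occur in any subfamily, in particular along every chain
  \<open>{..<j} \<union> B\<close>. Since the conditional expectation over \<open>B\<close> maps the chain \<open>{..<j}\<close> to that one, and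
  since every pattern of signs comes from some \<open>B\<close>, the functions of the chain \<open>{..<j}\<close> would span
  an almost isometric copy of \<open>\<ell>\<^sub>1\<^sup>k\<close>, against the type of the space.
\<close>

lemma mult_prod_one_minus_avg:
  assumes S: "\<And>i. i < k \<Longrightarrow> S i \<subseteq> {..<m}" and k: "0 < k" and big: "C * k powr (1 / p) \<le> k / 2"
  shows "mult m (\<lambda>F. \<Prod>i<k. 1 - avg (S i) F) (2 ^ k - 1 / 2)"
proof -
  define P where "P F = (\<Prod>i<k. 1 - avg (S i) F)" for F
  define X where "X A F = avg (\<Union>i\<in>A. S i) F" for A F
  have multX: "mult m (X A) 1" if "A \<subseteq> {..<k}" for A
    unfolding X_def by (rule mult_avg) (use S that in blast)
  have P: "P F = (\<Sum>A\<in>Pow {..<k}. (-1) ^ card A * X A F)" for F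
    by (simp add: P_def X_def prod_one_minus_avg)
  have X_Un: "X (A \<union> B) F = X A F * X B F" for A B F
    by (simp add: X_def avg_Un SUP_union flip: avg_Un)
  have rest: "mult m (\<lambda>F. P F - (-1) ^ card A * X A F) (2 ^ k - 1)" if A: "A \<subseteq> {..<k}" for A
  proof -
    have "mult m (\<lambda>F. \<Sum>A'\<in>Pow {..<k} - {A}. (-1) ^ card A' * X A' F) (\<Sum>A'\<in>Pow {..<k} - {A}. \<bar>(-1) ^ card A'\<bar> * 1)"
      by (intro mult_sum mult_scale multX) auto
    then show ?thesis using A
      by (simp add: P sum.remove[of _ A] card_Pow power_abs)
  qed
  have "Lnorm m (wpoly m (\<lambda>F i. P F * x F i)) \<le> (2 ^ k - 1/2) * Lnorm m (wpoly m x)" for x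
  proof -
    define L where "L = Lnorm m (wpoly m x)"
    define y where "y = Lnorm m (wpoly m (\<lambda>F i. P F * x F i))"
    define G where "G j = wpoly m (\<lambda>F i. X {..<j} F * x F i)" for j
    have L0: "0 \<le> L" by (simp add: L_def Lnorm_nonneg)
    have GL: "Lnorm m (G j) \<le> L" if "j < k" for j
      using multD[OF multX, of "{..<j}" x] that by (auto simp: G_def L_def)
    have low: "k * y - k * (2 ^ k - 1) * L \<le> Lnorm m (\<lambda>t i. \<Sum>j<k. s j * G j t i)" if s: "s \<in> signs k" for s
    proof -
      obtain B where B: "B \<subseteq> {..<k}"
        "\<And>j. j < k \<Longrightarrow> s j = s 0 * (-1) ^ card ({..<0} \<union> B) * (-1) ^ card ({..<j} \<union> B)"
        using chain_parity[OF s] by metis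
      define \<sigma> where "\<sigma> = s 0 * (-1) ^ card ({..<0} \<union> B)"
      have \<sigma>: "\<bar>\<sigma>\<bar> = 1" using signs_cases[OF s k] by (auto simp: \<sigma>_def abs_mult power_abs)
      have sgn: "(-1) ^ card ({..<j} \<union> B) = \<sigma> * s j" if "j < k" for j
      proof -
        have "\<sigma> * s j = \<sigma> * \<sigma> * (-1) ^ card ({..<j} \<union> B)" using B(2)[OF that] by (simp add: \<sigma>_def)
        also have "\<sigma> * \<sigma> = 1" using \<sigma> by (metis abs_mult_self_eq mult_1)
        finally show ?thesis by simp
      qed
      \<comment> \<open>Each summand lacks one of the \<open>2\<^sup>k\<close> terms of \<open>P\<close>, hence has norm at most \<open>2\<^sup>k - 1\<close>.\<close>
      define R where "R F = (\<Sum>j<k. P F - (-1) ^ card ({..<j} \<union> B) * X ({..<j} \<union> B) F)" for F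
      have multR: "mult m R (k * (2 ^ k - 1))"
      proof -
        have "mult m R (\<Sum>j<k. 2 ^ k - 1)"
          unfolding R_def by (intro mult_sum rest) (use B(1) in auto)
        then show ?thesis by simp
      qed
      have kP: "k * P F = R F + \<sigma> * (X B F * (\<Sum>j<k. s j * X {..<j} F))" for F
        unfolding R_def
        by (simp add: sum_subtractf sgn X_Un sum_distrib_left algebra_simps)
      have lin: "wpoly m (\<lambda>F i. (\<Sum>j<k. s j * X {..<j} F) * x F i) = (\<lambda>t i. \<Sum>j<k. s j * G j t i)"
        unfolding G_def wpoly_def
        by (intro ext) (simp add: sum_distrib_left sum_distrib_right algebra_simps, rule sum.swap)
      have "k * y = Lnorm m (wpoly m (\<lambda>F i. k * P F * x F i))"
        unfolding y_def by (simp add: mult.assoc wpoly_scale Lnorm_scale)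
      also have "\<dots> = Lnorm m (\<lambda>t i. wpoly m (\<lambda>F i. R F * x F i) t i
          + wpoly m (\<lambda>F i. \<sigma> * (X B F * ((\<Sum>j<k. s j * X {..<j} F) * x F i))) t i)"
        unfolding kP wpoly_add[symmetric] by (simp add: algebra_simps)
      also have "\<dots> \<le> Lnorm m (wpoly m (\<lambda>F i. R F * x F i))
          + Lnorm m (wpoly m (\<lambda>F i. \<sigma> * (X B F * ((\<Sum>j<k. s j * X {..<j} F) * x F i))))"
        by (rule Lnorm_add)
      also have "\<dots> = Lnorm m (wpoly m (\<lambda>F i. R F * x F i))
          + Lnorm m (wpoly m (\<lambda>F i. X B F * ((\<Sum>j<k. s j * X {..<j} F) * x F i)))"
        by (simp add: wpoly_scale Lnorm_scale \<sigma>)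
      also have "\<dots> \<le> k * (2 ^ k - 1) * L + 1 * Lnorm m (wpoly m (\<lambda>F i. (\<Sum>j<k. s j * X {..<j} F) * x F i))"
        unfolding L_def by (intro add_mono multD multR multX B)
      finally show ?thesis unfolding lin by simp
    qed
    have "k * y - k * (2 ^ k - 1) * L \<le> k / 2 * L"
    proof (cases "0 \<le> k * y - k * (2 ^ k - 1) * L")
      case True
      have "k * y - k * (2 ^ k - 1) * L \<le> C * k powr (1 / p) * L"
        by (rule Lnorm_type[OF GL k low True])
      also have "\<dots> \<le> k / 2 * L" using big L0 by (intro mult_right_mono)
      finally show ?thesis .
    next
      case False
      moreover have "0 \<le> k / 2 * L" using L0 by simp
      ultimately show ?thesis by linarith
    qed
    then have "k * y \<le> k * ((2 ^ k - 1/2) * L)" by (simp add: algebra_simps)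
    then show ?thesis using k by (simp add: y_def L_def)
  qed
  moreover have "(0::real) \<le> 2 ^ k - 1 / 2" using one_le_power[of "2::real" k] by linarith
  ultimately show ?thesis unfolding mult_def P_def by blast
qed

end

context seminorm_fun
begin

text \<open>
  Operators that are averages of commuting operators inherit a bound on products of \<open>k\<close>
  operators: expand the \<open>k\<close>-th power of the average.
\<close>

lemma mult_power_convex:
  assumes "\<And>f. (\<And>l. l < k \<Longrightarrow> f l \<in> I) \<Longrightarrow> mult m (\<lambda>F. \<Prod>l<k. b (f l) F) \<theta>"
    and w: "\<And>S. S \<in> I \<Longrightarrow> 0 \<le> w S" "sum w I = 1" and I: "finite I"
  shows "mult m (\<lambda>F. (\<Sum>S\<in>I. w S * b S F) ^ k) \<theta>"
proof -
  let ?PI = "{..<k} \<rightarrow>\<^sub>E I"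
  have "mult m (\<lambda>F. \<Sum>f\<in>?PI. (\<Prod>l<k. w (f l)) * (\<Prod>l<k. b (f l) F)) (\<Sum>f\<in>?PI. \<bar>\<Prod>l<k. w (f l)\<bar> * \<theta>)"
    by (intro mult_sum mult_scale assms(1)) auto
  moreover have "(\<Sum>S\<in>I. w S * b S F) ^ k = (\<Sum>f\<in>?PI. (\<Prod>l<k. w (f l)) * (\<Prod>l<k. b (f l) F))" for F
    using prod_sum_PiE[of "{..<k}" "\<lambda>_. I" "\<lambda>_ S. w S * b S F"] I by (simp add: prod.distrib)
  moreover have "(\<Sum>f\<in>?PI. \<bar>\<Prod>l<k. w (f l)\<bar> * \<theta>) = \<theta>"
  proof -
    have "(\<Sum>f\<in>?PI. \<bar>\<Prod>l<k. w (f l)\<bar> * \<theta>) = (\<Sum>f\<in>?PI. \<Prod>l<k. w (f l)) * \<theta>"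
      unfolding sum_distrib_right
      by (intro sum.cong refl) (auto simp: abs_prod w(1) PiE_def Pi_def intro!: prod.cong)
    also have "(\<Sum>f\<in>?PI. \<Prod>l<k. w (f l)) = 1"
      using prod_sum_PiE[of "{..<k}" "\<lambda>_. I" "\<lambda>_ S. w S"] I by (simp add: w)
    finally show ?thesis by simp
  qed
  ultimately show ?thesis by simp
qed

text \<open>The noise operator averages the \<open>avg S\<close> over a random set \<open>S\<close>.\<close>

lemma noise_convex:
  fixes \<rho> :: real and m :: nat
  assumes F: "F \<subseteq> {..<m}"
  shows "\<rho> ^ card F = (\<Sum>S\<in>Pow {..<m}. (1 - \<rho>) ^ card S * \<rho> ^ card ({..<m} - S) * avg S F)"
proof -
  have avg: "(\<Prod>i\<in>S. (1 - \<rho>) * (if i \<in> F then 0 else 1)) = (1 - \<rho>) ^ card S * avg S F"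
    if "finite S" for S
    using that by (induction S) (auto simp: avg_def)
  have "\<rho> ^ card F = (\<Prod>i<m. (if i \<in> F then \<rho> else 1))"
    using F by (simp add: prod.If_cases Int_absorb1)
  also have "\<dots> = (\<Prod>i<m. (1 - \<rho>) * (if i \<in> F then 0 else 1) + \<rho>)"
    by (intro prod.cong) auto
  also have "\<dots> = (\<Sum>S\<in>Pow {..<m}. (1 - \<rho>) ^ card S * avg S F * \<rho> ^ card ({..<m} - S))"
    by (subst prod_add) (auto intro!: sum.cong simp: avg finite_subset)
  finally show ?thesis by (simp add: mult_ac)
qed

lemma noise_weights: "(\<Sum>S\<in>Pow {..<m}. (1 - \<rho>) ^ card S * \<rho> ^ card ({..<m} - S)) = 1"
  for \<rho> :: real and m :: nat
  using noise_convex[of "{}" m \<rho>] by (simp add: avg_def)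

lemma mult_noise:
  assumes "0 \<le> \<rho>" "\<rho> \<le> 1"
  shows "mult m (\<lambda>F. \<rho> ^ card F) 1"
proof -
  have "mult m (\<lambda>F. \<Sum>S\<in>Pow {..<m}. (1 - \<rho>) ^ card S * \<rho> ^ card ({..<m} - S) * avg S F)
      (\<Sum>S\<in>Pow {..<m}. \<bar>(1 - \<rho>) ^ card S * \<rho> ^ card ({..<m} - S)\<bar> * 1)"
    by (intro mult_sum mult_scale mult_avg) auto
  also have "(\<Sum>S\<in>Pow {..<m}. \<bar>(1 - \<rho>) ^ card S * \<rho> ^ card ({..<m} - S)\<bar> * 1) = 1"
    using assms by (simp add: abs_mult noise_weights)
  finally show ?thesis
    by (rule mult_cong) (simp add: noise_convex[OF freqs_subset(1)])
qed

end

context type_fun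
begin

lemma mult_one_minus_noise:
  assumes \<rho>: "0 \<le> \<rho>" "\<rho> \<le> 1" and k: "0 < k" and big: "C * k powr (1 / p) \<le> k / 2"
  shows "mult m (\<lambda>F. (1 - \<rho> ^ card F) ^ k) (2 ^ k - 1 / 2)"
proof -
  let ?w = "\<lambda>S. (1 - \<rho>) ^ card S * \<rho> ^ card ({..<m} - S)"
  have "mult m (\<lambda>F. (\<Sum>S\<in>Pow {..<m}. ?w S * (1 - avg S F)) ^ k) (2 ^ k - 1 / 2)"
    by (rule mult_power_convex)
      (use \<rho> in \<open>auto intro!: mult_prod_one_minus_avg k big simp: noise_weights\<close>)
  then show ?thesis
    by (rule mult_cong)
      (simp add: noise_convex[OF freqs_subset(1)] right_diff_distrib sum_subtractf noise_weights)
qed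

end

section \<open>The resolvent of the number operator\<close>

context seminorm_fun
begin

text \<open>
  A complex multiplier is measured by its real rotations, so that the space need not be
  complexified.
\<close>

definition cmult :: "nat \<Rightarrow> (nat set \<Rightarrow> complex) \<Rightarrow> real \<Rightarrow> bool" where
  "cmult m a B \<longleftrightarrow> (\<forall>\<zeta>. cmod \<zeta> = 1 \<longrightarrow> mult m (\<lambda>F. Re (\<zeta> * a F)) B)"

lemma cmultD: "cmult m a B \<Longrightarrow> cmod \<zeta> = 1 \<Longrightarrow> mult m (\<lambda>F. Re (\<zeta> * a F)) B"
  by (simp add: cmult_def)

lemma cmult_cong: "cmult m a B \<Longrightarrow> (\<And>F. F \<in> freqs m \<Longrightarrow> a F = b F) \<Longrightarrow> cmult m b B"
  unfolding cmult_def using mult_cong by (smt (verit))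

lemma cmult_mono: "cmult m a B \<Longrightarrow> B \<le> C \<Longrightarrow> cmult m a C"
  unfolding cmult_def using mult_weaken by blast

lemma cmult_zero: "cmult m (\<lambda>F. 0) 0"
  by (simp add: cmult_def mult_zero)

lemma cmult_add: "cmult m a B \<Longrightarrow> cmult m b C \<Longrightarrow> cmult m (\<lambda>F. a F + b F) (B + C)"
  unfolding cmult_def by (simp add: distrib_left mult_add)

lemma cmult_sum: "(\<And>i. i \<in> I \<Longrightarrow> cmult m (a i) (B i)) \<Longrightarrow> cmult m (\<lambda>F. \<Sum>i\<in>I. a i F) (\<Sum>i\<in>I. B i)"
  by (induction I rule: infinite_finite_induct) (auto simp: cmult_zero intro: cmult_add)

lemma cmult_scale:
  assumes a: "cmult m a B"
  shows "cmult m (\<lambda>F. c * a F) (cmod c * B)"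
  unfolding cmult_def
proof (intro allI impI)
  fix \<zeta> :: complex assume \<zeta>: "cmod \<zeta> = 1"
  show "mult m (\<lambda>F. Re (\<zeta> * (c * a F))) (cmod c * B)"
  proof (cases "c = 0")
    case True
    then show ?thesis by (simp add: mult_zero)
  next
    case False
    have "mult m (\<lambda>F. cmod c * Re (\<zeta> * (c / cmod c) * a F)) (\<bar>cmod c\<bar> * B)"
      by (intro mult_scale cmultD[OF a]) (simp add: norm_mult norm_divide \<zeta> False)
    moreover have "cmod c * Re (\<zeta> * (c / cmod c) * a F) = Re (\<zeta> * (c * a F))" for F
    proof -
      have "cmod c * Re w = Re (of_real (cmod c) * w)" for w by simp
      then have "cmod c * Re (\<zeta> * (c / cmod c) * a F) = Re (of_real (cmod c) * (\<zeta> * (c / cmod c) * a F))" .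
      also have "of_real (cmod c) * (\<zeta> * (c / cmod c) * a F) = \<zeta> * (c * a F)"
        using False by (simp add: field_simps)
      finally show ?thesis .
    qed
    ultimately show ?thesis by simp
  qed
qed

lemma cmult_mult:
  assumes b: "mult m b B" and a: "cmult m a C"
  shows "cmult m (\<lambda>F. of_real (b F) * a F) (B * C)"
  unfolding cmult_def
proof (intro allI impI)
  fix \<zeta> :: complex assume \<zeta>: "cmod \<zeta> = 1"
  have "mult m (\<lambda>F. b F * Re (\<zeta> * a F)) (B * C)"
    by (intro mult_prod b cmultD[OF a \<zeta>])
  moreover have "b F * Re (\<zeta> * a F) = Re (\<zeta> * (of_real (b F) * a F))" for F
    by (simp add: algebra_simps)
  ultimately show "mult m (\<lambda>F. Re (\<zeta> * (of_real (b F) * a F))) (B * C)" by simp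
qed

lemma cmult_const: "cmult m (\<lambda>F. c) (cmod c)"
  unfolding cmult_def
proof (intro allI impI)
  fix \<zeta> :: complex assume \<zeta>: "cmod \<zeta> = 1"
  have "mult m (\<lambda>F. Re (\<zeta> * c) * 1) (\<bar>Re (\<zeta> * c)\<bar> * 1)"
    by (intro mult_scale mult_one)
  moreover have "\<bar>Re (\<zeta> * c)\<bar> \<le> cmod c"
    using abs_Re_le_cmod[of "\<zeta> * c"] by (simp add: norm_mult \<zeta>)
  ultimately show "mult m (\<lambda>F. Re (\<zeta> * c)) (cmod c)" by (auto intro: mult_weaken)
qed

lemma cmult_limit:
  assumes "Fl \<noteq> bot" "\<forall>\<^sub>F n in Fl. cmult m (a n) (B n)"
    "\<And>A. A \<in> freqs m \<Longrightarrow> ((\<lambda>n. a n A) \<longlongrightarrow> b A) Fl" "(B \<longlongrightarrow> C) Fl"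
  shows "cmult m b C"
  unfolding cmult_def
proof (intro allI impI)
  fix \<zeta> :: complex assume \<zeta>: "cmod \<zeta> = 1"
  show "mult m (\<lambda>F. Re (\<zeta> * b F)) C"
  proof (rule mult_limit[OF assms(1) _ _ assms(4)])
    show "\<forall>\<^sub>F n in Fl. mult m (\<lambda>F. Re (\<zeta> * a n F)) (B n)"
      using assms(2) by (rule eventually_mono) (rule cmultD[OF _ \<zeta>])
    show "((\<lambda>n. Re (\<zeta> * a n A)) \<longlongrightarrow> Re (\<zeta> * b A)) Fl" if "A \<in> freqs m" for A
      by (intro tendsto_intros assms(3) that)
  qed
qed

text \<open>The multipliers of norm at most \<open>B\<close> form a closed convex set, so integrals stay inside.\<close>

lemma cmult_integral:
  fixes a :: "real \<Rightarrow> nat set \<Rightarrow> complex" and b :: "real \<Rightarrow> real"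
  assumes a: "\<And>s. c \<le> s \<Longrightarrow> s \<le> d \<Longrightarrow> cmult m (a s) (b s)"
    and int: "\<And>F. F \<in> freqs m \<Longrightarrow> ((\<lambda>s. a s F) has_integral I F) {c..d}"
    and intb: "(b has_integral J) {c..d}"
  shows "cmult m I J"
proof (rule cmult_limit)
  let ?S = "\<lambda>(f :: real \<Rightarrow> complex) p. \<Sum>(x, K)\<in>p. measure lborel K *\<^sub>R f x"
  show "division_filter (cbox c d) \<noteq> bot" by (rule division_filter_not_empty)
  show "((\<lambda>p. \<Sum>(x, K)\<in>p. measure lborel K *\<^sub>R a x F) \<longlongrightarrow> I F) (division_filter (cbox c d))"
    if "F \<in> freqs m" for F
    using int[OF that] unfolding box_real(2)[symmetric] has_integral_cbox .
  show "((\<lambda>p. \<Sum>(x, K)\<in>p. measure lborel K *\<^sub>R b x) \<longlongrightarrow> J) (division_filter (cbox c d))"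
    using intb unfolding box_real(2)[symmetric] has_integral_cbox .
  have "cmult m (\<lambda>F. \<Sum>(x, K)\<in>p. measure lborel K *\<^sub>R a x F) (\<Sum>(x, K)\<in>p. measure lborel K *\<^sub>R b x)"
    if p: "p tagged_division_of cbox c d" for p
  proof -
    have "cmult m (\<lambda>F. \<Sum>z\<in>p. of_real (measure lborel (snd z)) * a (fst z) F)
        (\<Sum>z\<in>p. cmod (of_real (measure lborel (snd z))) * b (fst z))"
    proof (intro cmult_sum cmult_scale a)
      fix z assume "z \<in> p"
      then have "fst z \<in> cbox c d"
        using p tagged_division_ofD(2,3)[OF p, of "fst z" "snd z"] by auto
      then show "c \<le> fst z" "fst z \<le> d" by (auto simp: box_real)
    qed
    then show ?thesis by (simp add: case_prod_beta scaleR_conv_of_real)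
  qed
  then show "\<forall>\<^sub>F p in division_filter (cbox c d).
      cmult m (\<lambda>F. \<Sum>(x, K)\<in>p. measure lborel K *\<^sub>R a x F) (\<Sum>(x, K)\<in>p. measure lborel K *\<^sub>R b x)"
    by (intro eventually_division_filter_tagged_division[THEN eventually_mono])
qed

lemma mult_exp:
  fixes s :: real
  assumes "0 \<le> s"
  shows "mult m (\<lambda>F. exp (- (s * card F))) 1"
  using mult_noise[of "exp (- s)" m] assms
  by (simp add: exp_of_nat_mult[symmetric] mult.commute)

text \<open>
  The resolvent of the number operator \<open>N\<close> (multiplication by the degree), as the inverse of \<open>\<eta> + e\<^sup>-\<^sup>t\<^sup>N = e\<^sup>-\<^sup>t\<^sup>N - e\<^sup>-\<^sup>t\<^sup>z\<close> composed with
  an integral of the semigroup.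
\<close>

lemma cmult_resolvent:
  fixes t \<eta> :: real and z :: complex
  assumes inv: "mult m (\<lambda>F. 1 / (\<eta> + exp (- (t * card F)))) M"
    and t: "0 < t" and \<eta>: "0 < \<eta>" and z: "exp (- (t * z)) = - of_real \<eta>" and Rez: "0 \<le> Re z"
  shows "cmult m (\<lambda>F. 1 / (z - card F)) (M * t)"
proof -
  define I where "I F = (of_real (exp (- (t * card F))) + of_real \<eta>) / (z - card F)" for F :: "nat set"
  have ne: "z \<noteq> of_nat j" for j
  proof
    assume zj: "z = of_nat j"
    have "exp (- (of_real t * z)) = of_real (exp (- (t * real j)))"
      unfolding zj by (simp flip: exp_of_real)
    then have "of_real (exp (- (t * real j))) = (of_real (- \<eta>) :: complex)" using z by simp
    then have "exp (- (t * real j)) = - \<eta>" using of_real_eq_iff by blast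
    then show False using \<eta> by (smt (verit) exp_gt_zero)
  qed
  have "cmult m I t"
  proof (rule cmult_integral)
    show "((\<lambda>_::real. 1::real) has_integral t) {0..t}"
      using has_integral_const_real[of "1::real" 0 t] t by simp
    show "cmult m (\<lambda>F. of_real (exp (- (s * card F))) * exp (- (of_real (t - s) * z))) 1"
      if s: "0 \<le> s" "s \<le> t" for s :: real
    proof -
      have "cmod (exp (- (of_real (t - s) * z))) \<le> 1" using s Rez by simp
      then have "cmult m (\<lambda>F. exp (- (of_real (t - s) * z))) 1" by (rule cmult_mono[OF cmult_const])
      then show ?thesis using cmult_mult[OF mult_exp[OF s(1)]] by fastforce
    qed
    fix F assume "F \<in> freqs m"
    define w where "w = z - card F"
    have w: "w \<noteq> 0" using ne[of "card F"] by (simp add: w_def)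
    let ?h = "\<lambda>s. exp (- (of_real t * z) + of_real s * w) / w"
    have "((\<lambda>s. exp (- (of_real t * z) + of_real s * w)) has_integral (?h t - ?h 0)) {0..t}"
    proof (rule fundamental_theorem_of_calculus)
      show "(?h has_vector_derivative exp (- (of_real t * z) + of_real s * w)) (at s within {0..t})" for s
        by (rule has_vector_derivative_real_field) (use w in \<open>auto intro!: derivative_eq_intros\<close>)
    qed (use t in simp)
    moreover have "?h t - ?h 0 = I F"
    proof -
      have "exp (- (of_real t * z) + of_real t * w) = of_real (exp (- (t * card F)))"
        by (simp add: w_def algebra_simps flip: exp_of_real)
      then show ?thesis
        by (simp add: I_def z w_def[symmetric] add_divide_distrib)
    qed
    moreover have "exp (- (of_real t * z) + of_real s * w)
        = of_real (exp (- (s * card F))) * exp (- (of_real (t - s) * z))" for s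
      by (simp add: w_def algebra_simps flip: exp_add exp_of_real)
    ultimately show "((\<lambda>s. of_real (exp (- (s * card F))) * exp (- (of_real (t - s) * z))) has_integral I F) {0..t}"
      by simp
  qed
  from cmult_mult[OF inv this] show ?thesis
  proof (rule cmult_cong)
    fix F :: "nat set"
    have "\<eta> + exp (- (t * card F)) \<noteq> 0" using \<eta> by (smt (verit) exp_gt_zero)
    then have "(of_real (\<eta> + exp (- (t * card F))) :: complex) \<noteq> 0" using of_real_eq_0_iff by blast
    then show "of_real (1 / (\<eta> + exp (- (t * card F)))) * I F = 1 / (z - card F)"
      by (simp add: I_def divide_simps add.commute)
  qed
qed

end

section \<open>Contour integration\<close>

definition entire_sinc :: "complex \<Rightarrow> complex" where
  "entire_sinc z = (if z = 1 then - of_real pi else sin (of_real pi * z) / (z - 1))"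

lemma sin_complex_pi: "sin (complex_of_real pi) = 0"
  by (metis of_real_0 sin_of_real sin_pi)

lemma entire_sinc_holomorphic: "entire_sinc holomorphic_on UNIV"
proof -
  let ?f = "\<lambda>z :: complex. sin (of_real pi * z)"
  have "?f holomorphic_on UNIV" by (intro holomorphic_intros)
  then have hol: "(\<lambda>z. if z = 1 then deriv ?f 1 else (?f z - ?f 1) / (z - 1)) holomorphic_on UNIV"
    by (rule pole_lemma) simp
  have deriv: "deriv ?f 1 = - of_real pi"
  proof (rule DERIV_imp_deriv)
    have "cos (complex_of_real pi) = -1" by (metis cos_of_real cos_pi of_real_1 of_real_minus)
    then show "(?f has_field_derivative - of_real pi) (at 1)"
      by (auto intro!: derivative_eq_intros)
  qed
  have eq: "entire_sinc = (\<lambda>z. if z = 1 then - of_real pi else (?f z - ?f 1) / (z - 1))"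
    by (simp add: entire_sinc_def fun_eq_iff sin_complex_pi)
  show ?thesis unfolding eq using hol unfolding deriv .
qed

lemma entire_sinc_of_nat:
  assumes "1 \<le> j"
  shows "entire_sinc (of_nat j) = (if j = 1 then - of_real pi else 0)"
proof -
  have "complex_of_real pi * of_nat j = of_real (pi * real j)" by simp
  then have "sin (complex_of_real pi * of_nat j) = 0" by (simp only: sin_of_real sin_npi2 of_real_0)
  then show ?thesis using assms by (auto simp: entire_sinc_def)
qed

lemma norm_entire_sinc_le:
  assumes "c \<le> cmod (z - 1)" "0 < c"
  shows "cmod (entire_sinc z) \<le> exp (pi * \<bar>Im z\<bar>) / c"
proof -
  have "cmod (sin (of_real pi * z)) \<le> exp (pi * \<bar>Im z\<bar>)"
    using cmod_sin_le_exp[of 1 "of_real pi * z"] by (simp add: abs_mult)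
  moreover have "z \<noteq> 1" using assms by auto
  ultimately show ?thesis
    using assms by (simp add: entire_sinc_def norm_divide frac_le)
qed

text \<open>
  The symbol that is fed into the holomorphic functional calculus. The sine kills the degrees
  \<open>2, 3, 4, \<dots>\<close> and the pole at \<open>1\<close> rescues degree one. On the rays \<open>r (\<beta> \<plusminus> i \<pi>)\<close> the sine grows like
  \<open>exp (\<pi>\<^sup>2 r)\<close>; the coefficient of the exponential is chosen to leave a decay \<open>exp (- r)\<close>. The factor
  \<open>z\<close> compensates the singularity of the resolvent bound at the apex \<open>0\<close>.
\<close>

definition select1 :: "real \<Rightarrow> complex \<Rightarrow> complex" where
  "select1 \<beta> z = z * exp (- (of_real ((1 + pi\<^sup>2) / \<beta>) * z)) * entire_sinc z"

lemma select1_holomorphic: "select1 \<beta> holomorphic_on S"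
  unfolding select1_def
  by (intro holomorphic_intros holomorphic_on_subset[OF entire_sinc_holomorphic]) auto

lemma select1_of_nat:
  "1 \<le> j \<Longrightarrow> select1 \<beta> (of_nat j) =
     (if j = 1 then - of_real (pi * exp (- ((1 + pi\<^sup>2) / \<beta>))) else 0)"
proof -
  assume j: "1 \<le> j"
  define c where "c = (1 + pi\<^sup>2) / \<beta>"
  have "exp (- (of_real c * of_nat 1)) = complex_of_real (exp (- c))"
    by (simp flip: exp_of_real)
  then show ?thesis
    unfolding select1_def c_def[symmetric] entire_sinc_of_nat[OF j] by auto
qed

text \<open>Here \<open>\<sigma> = \<plusminus>1\<close> selects one of the two edges of the sector.\<close>

lemma select1_ray:
  assumes \<beta>: "0 < \<beta>" and r: "0 \<le> r" and \<sigma>: "\<bar>\<sigma>\<bar> = 1"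
  shows "cmod (select1 \<beta> (of_real r * Complex \<beta> (\<sigma> * pi))) \<le> r * (\<beta>\<^sup>2 + pi\<^sup>2) / pi * exp (- r)"
proof -
  define \<omega> where "\<omega> = Complex \<beta> (\<sigma> * pi)"
  have s2: "\<sigma>\<^sup>2 = 1" using \<sigma> by (metis power2_abs power_one)
  have \<omega>2: "(cmod \<omega>)\<^sup>2 = \<beta>\<^sup>2 + pi\<^sup>2" by (simp add: \<omega>_def cmod_power2 power_mult_distrib s2)
  have \<omega>0: "0 < cmod \<omega>" using \<beta> by (auto simp: \<omega>_def complex_eq_iff)
  have "pi \<le> cmod (of_real r * \<omega> - 1) * cmod \<omega>"
  proof -
    have "pi = \<bar>Im ((of_real r * \<omega> - 1) * cnj \<omega>)\<bar>"
      using \<sigma> by (simp add: \<omega>_def algebra_simps abs_mult)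
    also have "\<dots> \<le> cmod ((of_real r * \<omega> - 1) * cnj \<omega>)" by (rule abs_Im_le_cmod)
    finally show ?thesis by (simp add: norm_mult)
  qed
  then have dist: "pi / cmod \<omega> \<le> cmod (of_real r * \<omega> - 1)" using \<omega>0 by (simp add: field_simps)
  have "cmod (entire_sinc (of_real r * \<omega>)) \<le> exp (pi * \<bar>Im (of_real r * \<omega>)\<bar>) / (pi / cmod \<omega>)"
    by (rule norm_entire_sinc_le[OF dist]) (use \<omega>0 in simp)
  also have "\<dots> = exp (pi\<^sup>2 * r) * cmod \<omega> / pi"
    using \<sigma> r by (simp add: \<omega>_def abs_mult power2_eq_square mult_ac)
  finally have "cmod (select1 \<beta> (of_real r * \<omega>))
      \<le> r * cmod \<omega> * exp (- ((1 + pi\<^sup>2) * r)) * (exp (pi\<^sup>2 * r) * cmod \<omega> / pi)"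
    unfolding select1_def norm_mult
    using \<beta> r by (intro mult_mono) (auto simp: \<omega>_def)
  also have "\<dots> = r * (cmod \<omega>)\<^sup>2 / pi * (exp (- ((1 + pi\<^sup>2) * r)) * exp (pi\<^sup>2 * r))"
    by (simp add: power2_eq_square)
  also have "exp (- ((1 + pi\<^sup>2) * r)) * exp (pi\<^sup>2 * r) = exp (- r)"
    by (simp add: algebra_simps flip: exp_add)
  finally show ?thesis by (simp add: \<omega>_def[symmetric] \<omega>2)
qed

lemma ray_avoids_nat:
  assumes "1 \<le> j" "\<bar>\<sigma>\<bar> = 1"
  shows "of_real r * Complex \<beta> (\<sigma> * pi) \<noteq> of_nat j"
  using assms by (auto simp: complex_eq_iff)

lemma triangle_interior:
  assumes \<beta>: "0 < \<beta>" and R: "0 < R" and j: "0 < x" "x < R * \<beta>"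
  shows "of_real x \<in> interior (convex hull {0, of_real R * Complex \<beta> (- pi), of_real R * Complex \<beta> pi})"
proof (rule interiorI)
  let ?U = "{z. 0 < Re z} \<inter> {z. Re z < R * \<beta>} \<inter> {z. Im z - pi / \<beta> * Re z < 0} \<inter> {z. - Im z - pi / \<beta> * Re z < 0}"
  show "open ?U"
    by (intro open_Int open_Collect_less continuous_intros)
  show "of_real x \<in> ?U" using \<beta> R j by auto
  show "?U \<subseteq> convex hull {0, of_real R * Complex \<beta> (- pi), of_real R * Complex \<beta> pi}"
  proof
    fix z assume z: "z \<in> ?U"
    define u where "u = (Re z / (R * \<beta>) - Im z / (R * pi)) / 2"
    define v where "v = (Re z / (R * \<beta>) + Im z / (R * pi)) / 2"
    have uv: "u + v = Re z / (R * \<beta>)" "v - u = Im z / (R * pi)"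
      by (simp_all add: u_def v_def field_simps)
    have "0 \<le> u" "0 \<le> v" using z \<beta> R by (simp_all add: u_def v_def field_simps)
    moreover have "u + v \<le> 1" using z \<beta> R by (simp add: uv)
    moreover have "z = (1 - u - v) *\<^sub>R 0 + u *\<^sub>R (of_real R * Complex \<beta> (- pi)) + v *\<^sub>R (of_real R * Complex \<beta> pi)"
    proof (rule complex_eqI)
      have "Re z = (u + v) * (R * \<beta>)" using \<beta> R by (simp add: uv)
      then show "Re z = Re ((1 - u - v) *\<^sub>R 0 + u *\<^sub>R (of_real R * Complex \<beta> (- pi)) + v *\<^sub>R (of_real R * Complex \<beta> pi))"
        by (simp add: algebra_simps)
      have "Im z = (v - u) * (R * pi)" using R by (simp add: uv)
      then show "Im z = Im ((1 - u - v) *\<^sub>R 0 + u *\<^sub>R (of_real R * Complex \<beta> (- pi)) + v *\<^sub>R (of_real R * Complex \<beta> pi))"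
        by (simp add: algebra_simps)
    qed
    ultimately show "z \<in> convex hull {0, of_real R * Complex \<beta> (- pi), of_real R * Complex \<beta> pi}"
      unfolding convex_hull_3 by (intro CollectI exI[of _ "1 - u - v"] exI[of _ u] exI[of _ v]) auto
  qed
qed

definition edge_int :: "real \<Rightarrow> real \<Rightarrow> real \<Rightarrow> nat \<Rightarrow> complex" where
  "edge_int \<beta> \<sigma> R j =
     contour_integral (linepath 0 (of_real R * Complex \<beta> (\<sigma> * pi))) (\<lambda>z. select1 \<beta> z / (z - of_nat j))"

lemma edge_integrable:
  assumes "1 \<le> j" "\<bar>\<sigma>\<bar> = 1"
  shows "(\<lambda>z. select1 \<beta> z / (z - of_nat j)) contour_integrable_on linepath 0 (of_real R * Complex \<beta> (\<sigma> * pi))"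
proof (rule contour_integrable_continuous_linepath)
  have "z \<noteq> of_nat j" if "z \<in> closed_segment 0 (of_real R * Complex \<beta> (\<sigma> * pi))" for z
  proof -
    from that obtain u where "z = u *\<^sub>R (of_real R * Complex \<beta> (\<sigma> * pi))"
      by (auto simp: in_segment)
    then have "z = of_real (u * R) * Complex \<beta> (\<sigma> * pi)" by (simp add: scaleR_conv_of_real)
    then show ?thesis using ray_avoids_nat[OF assms] by metis
  qed
  then show "continuous_on (closed_segment 0 (of_real R * Complex \<beta> (\<sigma> * pi))) (\<lambda>z. select1 \<beta> z / (z - of_nat j))"
    by (intro continuous_intros holomorphic_on_imp_continuous_on select1_holomorphic) auto
qed

text \<open>Cauchy's formula over the triangle \<open>0, n (\<beta> - i \<pi>), n (\<beta> + i \<pi>)\<close>, whose vertical side contributes nothing in the limit.\<close>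

lemma edge_int_limit:
  assumes \<beta>: "0 < \<beta>" and j: "1 \<le> j"
  shows "(\<lambda>n. edge_int \<beta> (-1) (real n) j - edge_int \<beta> 1 (real n) j)
           \<longlonglongrightarrow> 2 * of_real pi * \<i> * select1 \<beta> (of_nat j)"
proof -
  let ?f = "\<lambda>z. select1 \<beta> z / (z - of_nat j)"
  define \<omega> where "\<omega> = Complex \<beta> pi"
  define \<omega>' where "\<omega>' = Complex \<beta> (- pi)"
  have bound: "cmod (edge_int \<beta> (-1) R j - edge_int \<beta> 1 R j - 2 * of_real pi * \<i> * select1 \<beta> (of_nat j))
       \<le> R * cmod \<omega> * exp (- R) * (2 * pi * R)" if R: "0 < R" "j + 1 \<le> R * \<beta>" for R
  proof -
    define a where "a = of_real R * \<omega>'"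
    define b where "b = of_real R * \<omega>"
    have int: "of_nat j \<in> interior (convex hull {0, a, b})"
      using triangle_interior[OF \<beta> R(1), of "real j"] j R(2) by (simp add: a_def b_def \<omega>_def \<omega>'_def)
    let ?\<gamma> = "linepath 0 a +++ linepath a b +++ linepath b 0"
    have f1: "?f contour_integrable_on linepath 0 a" and f3: "?f contour_integrable_on linepath 0 b"
      using edge_integrable[OF j, of "-1" \<beta> R] edge_integrable[OF j, of 1 \<beta> R]
      by (simp_all add: a_def b_def \<omega>_def \<omega>'_def)
    have f3': "?f contour_integrable_on linepath b 0"
      using f3 by (metis contour_integrable_reversepath_eq reversepath_linepath valid_path_linepath)
    have side: "Re z = R * \<beta>" "\<bar>Im z\<bar> \<le> R * pi" if "z \<in> closed_segment a b" for z
    proof -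
      from that obtain u where u: "0 \<le> u" "u \<le> 1" "z = (1 - u) *\<^sub>R a + u *\<^sub>R b"
        by (auto simp: in_segment)
      show "Re z = R * \<beta>" by (simp add: u(3) a_def b_def \<omega>_def \<omega>'_def algebra_simps)
      have "Im z = R * pi * (2 * u - 1)" by (simp add: u(3) a_def b_def \<omega>_def \<omega>'_def algebra_simps)
      then have "\<bar>Im z\<bar> = R * pi * \<bar>2 * u - 1\<bar>" using R by (simp add: abs_mult)
      also have "\<dots> \<le> R * pi * 1" using u R by (intro mult_left_mono) auto
      finally show "\<bar>Im z\<bar> \<le> R * pi" by simp
    qed
    have far: "1 \<le> cmod (z - of_nat j)" "1 \<le> cmod (z - 1)" if "z \<in> closed_segment a b" for z
    proof -
      have "1 \<le> Re (z - of_nat j)" "1 \<le> Re (z - 1)" using side(1)[OF that] R(2) j by auto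
      then show "1 \<le> cmod (z - of_nat j)" "1 \<le> cmod (z - 1)"
        using complex_Re_le_cmod order_trans by blast+
    qed
    have f2: "?f contour_integrable_on linepath a b"
    proof (rule contour_integrable_continuous_linepath)
      have "z \<noteq> of_nat j" if "z \<in> closed_segment a b" for z using far(1)[OF that] by auto
      then show "continuous_on (closed_segment a b) ?f"
        by (intro continuous_intros holomorphic_on_imp_continuous_on select1_holomorphic) auto
    qed
    have w: "winding_number ?\<gamma> (of_nat j) = 1"
      using winding_number_triangle[OF int] R(1) j
      by (simp add: a_def \<omega>'_def algebra_simps)
    have "(?f has_contour_integral (2 * pi * \<i> * winding_number ?\<gamma> (of_nat j) * select1 \<beta> (of_nat j))) ?\<gamma>"
    proof (rule Cauchy_integral_formula_convex_simple[where S = UNIV])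
      have "of_nat j \<notin> path_image ?\<gamma>"
      proof
        assume "of_nat j \<in> path_image ?\<gamma>"
        moreover have "z \<noteq> of_nat j" if "z \<in> closed_segment 0 (of_real R * Complex \<beta> (\<sigma> * pi))" "\<bar>\<sigma>\<bar> = 1" for z \<sigma>
        proof -
          from that obtain u where "z = u *\<^sub>R (of_real R * Complex \<beta> (\<sigma> * pi))"
            by (auto simp: in_segment)
          then have "z = of_real (u * R) * Complex \<beta> (\<sigma> * pi)" by (simp add: scaleR_conv_of_real)
          then show ?thesis using ray_avoids_nat[OF j that(2)] by metis
        qed
        from this[of _ "-1"] this[of _ 1] have "of_nat j \<notin> closed_segment 0 a" "of_nat j \<notin> closed_segment 0 b"
          by (auto simp: a_def b_def \<omega>_def \<omega>'_def)
        moreover have "of_nat j \<notin> closed_segment a b" using far(1) by fastforce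
        ultimately show False by (auto simp: path_image_join closed_segment_commute)
      qed
      then show "path_image ?\<gamma> \<subseteq> UNIV - {of_nat j}" by auto
    qed (auto intro: select1_holomorphic)
    then have "contour_integral ?\<gamma> ?f = 2 * pi * \<i> * select1 \<beta> (of_nat j)"
      unfolding w by (simp add: contour_integral_unique)
    moreover have "contour_integral ?\<gamma> ?f
        = contour_integral (linepath 0 a) ?f + (contour_integral (linepath a b) ?f + contour_integral (linepath b 0) ?f)"
      using f1 f2 f3' by simp
    moreover have "contour_integral (linepath b 0) ?f = - contour_integral (linepath 0 b) ?f"
      using contour_integral_reversepath[of "linepath 0 b" ?f] by simp
    ultimately have "edge_int \<beta> (-1) R j - edge_int \<beta> 1 R j - 2 * of_real pi * \<i> * select1 \<beta> (of_nat j)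
        = - contour_integral (linepath a b) ?f"
      by (simp add: edge_int_def a_def b_def \<omega>_def \<omega>'_def algebra_simps)
    moreover have "cmod (contour_integral (linepath a b) ?f) \<le> R * cmod \<omega> * exp (- R) * cmod (b - a)"
    proof (rule has_contour_integral_bound_linepath)
      show "(?f has_contour_integral contour_integral (linepath a b) ?f) (linepath a b)"
        by (rule has_contour_integral_integral[OF f2])
      show "0 \<le> R * cmod \<omega> * exp (- R)" using R by simp
      fix z assume z: "z \<in> closed_segment a b"
      have "cmod z \<le> R * cmod \<omega>"
      proof -
        have "z \<in> convex hull {a, b}" using z by (simp add: segment_convex_hull)
        moreover have "cmod a = R * cmod \<omega>" "cmod b = R * cmod \<omega>"
          unfolding a_def b_def norm_mult using R by (simp_all add: \<omega>_def \<omega>'_def cmod_def)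
        ultimately show ?thesis
          using hull_minimal[of "{a, b}" "cball 0 (R * cmod \<omega>)" convex] by auto
      qed
      moreover have "cmod (entire_sinc z) \<le> exp (pi * (R * pi)) / 1"
      proof -
        have "cmod (entire_sinc z) \<le> exp (pi * \<bar>Im z\<bar>) / 1"
          by (rule norm_entire_sinc_le[OF far(2)[OF z]]) simp
        also have "\<dots> \<le> exp (pi * (R * pi)) / 1" using side(2)[OF z] by simp
        finally show ?thesis .
      qed
      moreover have "cmod (exp (- (of_real ((1 + pi\<^sup>2) / \<beta>) * z))) = exp (- ((1 + pi\<^sup>2) * R))"
        using \<beta> by (simp add: side(1)[OF z])
      ultimately have "cmod (select1 \<beta> z) \<le> R * cmod \<omega> * exp (- ((1 + pi\<^sup>2) * R)) * (exp (pi * (R * pi)) / 1)"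
        unfolding select1_def norm_mult using R by (intro mult_mono) auto
      also have "\<dots> = R * cmod \<omega> * exp (- R)"
        by (simp add: power2_eq_square algebra_simps flip: exp_add)
      finally have "cmod (select1 \<beta> z) / cmod (z - of_nat j) \<le> R * cmod \<omega> * exp (- R) / 1"
        using far(1)[OF z] R by (intro frac_le) auto
      then show "cmod (?f z) \<le> R * cmod \<omega> * exp (- R)" by (simp add: norm_divide)
    qed
    moreover have "cmod (b - a) = 2 * pi * R"
    proof -
      have "b - a = Complex 0 (2 * pi * R)"
        by (simp add: a_def b_def \<omega>_def \<omega>'_def complex_eq_iff)
      then show ?thesis using R by (simp add: cmod_def)
    qed
    ultimately show ?thesis by simp
  qed
  have "(\<lambda>n. edge_int \<beta> (-1) (real n) j - edge_int \<beta> 1 (real n) j - 2 * of_real pi * \<i> * select1 \<beta> (of_nat j)) \<longlonglongrightarrow> 0"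
  proof (rule Lim_null_comparison)
    have "\<forall>\<^sub>F n in sequentially. (j + 1) / \<beta> + 1 \<le> real n"
      by (rule eventually_mono[OF eventually_ge_at_top[of "nat \<lceil>(j + 1) / \<beta> + 1\<rceil>"]]) linarith
    then show "\<forall>\<^sub>F n in sequentially. cmod (edge_int \<beta> (-1) (real n) j - edge_int \<beta> 1 (real n) j
        - 2 * of_real pi * \<i> * select1 \<beta> (of_nat j)) \<le> real n * cmod \<omega> * exp (- real n) * (2 * pi * real n)"
    proof (rule eventually_mono)
      fix n :: nat assume n: "(j + 1) / \<beta> + 1 \<le> real n"
      have "0 \<le> (j + 1) / \<beta>" using \<beta> by simp
      then have "0 < real n" using n by linarith
      moreover have "(j + 1) / \<beta> \<le> real n" using n by linarith
      then have "j + 1 \<le> real n * \<beta>" using \<beta> by (simp add: field_simps)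
      ultimately show "cmod (edge_int \<beta> (-1) (real n) j - edge_int \<beta> 1 (real n) j
        - 2 * of_real pi * \<i> * select1 \<beta> (of_nat j)) \<le> real n * cmod \<omega> * exp (- real n) * (2 * pi * real n)"
        by (rule bound)
    qed
    show "(\<lambda>n. real n * cmod \<omega> * exp (- real n) * (2 * pi * real n)) \<longlonglongrightarrow> 0"
      by real_asymp
  qed
  then show ?thesis using LIM_zero_iff by blast
qed

context seminorm_fun
begin

text \<open>
  On the edge point \<open>r (\<beta> \<plusminus> i \<pi>)\<close> one has \<open>exp (- z / r) = - \<eta>\<close>, so the resolvent is bounded by \<open>M / r\<close>
  there. Integrating it against \<open>select1\<close> along the two edges gives a multiple of the projection
  onto degree one. This is Kato's theorem on holomorphic semigroups, restricted to the one
  consequence that matters.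
\<close>

lemma mult_degree_one:
  assumes \<eta>: "0 < \<eta>" "\<eta> < 1" and \<beta>: "\<beta> = - ln \<eta>"
    and inv: "\<And>t :: real. 0 < t \<Longrightarrow> mult m (\<lambda>F. 1 / (\<eta> + exp (- (t * card F)))) M"
  shows "mult m (\<lambda>F. if card F = 1 then 1 else 0)
    (M * (\<beta>\<^sup>2 + pi\<^sup>2) * sqrt (\<beta>\<^sup>2 + pi\<^sup>2) / (pi * pi\<^sup>2 * exp (- ((1 + pi\<^sup>2) / \<beta>))))"
proof -
  have \<beta>0: "0 < \<beta>" using \<eta> by (simp add: \<beta>)
  have M0: "0 \<le> M" using mult_nonneg[OF inv[of 1]] by simp
  define D where "D = M * (\<beta>\<^sup>2 + pi\<^sup>2) / pi * sqrt (\<beta>\<^sup>2 + pi\<^sup>2)"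
  have D0: "0 \<le> D" using M0 by (simp add: D_def)
  have card: "1 \<le> card F" if "F \<in> freqs m" for F
    using freqs_subset[OF that] by (metis One_nat_def Suc_leI card_gt_0_iff finite_lessThan finite_subset)
  have edge: "cmult m (\<lambda>F. edge_int \<beta> \<sigma> R (card F)) D" if R: "0 < R" and \<sigma>: "\<bar>\<sigma>\<bar> = 1" for R \<sigma>
  proof -
    define \<omega> where "\<omega> = Complex \<beta> (\<sigma> * pi)"
    have s2: "\<sigma>\<^sup>2 = 1" using \<sigma> by (metis power2_abs power_one)
    have \<omega>n: "cmod \<omega> = sqrt (\<beta>\<^sup>2 + pi\<^sup>2)" by (simp add: \<omega>_def cmod_def power_mult_distrib s2)
    let ?z = "\<lambda>s. of_real (s * R) * \<omega>"
    let ?c = "\<lambda>s. select1 \<beta> (?z s) * (of_real R * \<omega>)"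
    have "cmult m (\<lambda>F. edge_int \<beta> \<sigma> R (card F)) (D * (1 - exp (- R)))"
    proof (rule cmult_integral)
      show "((\<lambda>s. D * (R * exp (- (s * R)))) has_integral D * (1 - exp (- R))) {0..1}"
      proof -
        have "((\<lambda>s. D * (R * exp (- (s * R)))) has_integral (- (D * exp (- (1 * R))) - - (D * exp (- (0 * R))))) {0..1}"
          by (rule fundamental_theorem_of_calculus)
            (auto intro!: derivative_eq_intros simp flip: has_real_derivative_iff_has_vector_derivative)
        then show ?thesis by (simp add: algebra_simps)
      qed
      show "((\<lambda>s. ?c s * (1 / (?z s - card F))) has_integral edge_int \<beta> \<sigma> R (card F)) {0..1}"
        if F: "F \<in> freqs m" for F
      proof -
        have "((\<lambda>z. select1 \<beta> z / (z - of_nat (card F))) has_contour_integral edge_int \<beta> \<sigma> R (card F))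
            (linepath 0 (of_real R * \<omega>))"
          unfolding edge_int_def \<omega>_def
          by (intro has_contour_integral_integral edge_integrable card F \<sigma>)
        then show ?thesis
          unfolding has_contour_integral_linepath
          by (simp add: linepath_def scaleR_conv_of_real mult_ac)
      qed
      fix s :: real assume s: "0 \<le> s" "s \<le> 1"
      show "cmult m (\<lambda>F. ?c s * (1 / (?z s - card F))) (D * (R * exp (- (s * R))))"
      proof (cases "s = 0")
        case True
        have "0 \<le> D * (R * exp (- (s * R)))" using D0 R by simp
        with True show ?thesis by (auto simp: select1_def intro: cmult_mono[OF cmult_zero])
      next
        case False
        define r where "r = s * R"
        have r: "0 < r" using s False R by (simp add: r_def)
        have "cmult m (\<lambda>F. 1 / (of_real r * \<omega> - card F)) (M * (1 / r))"
        proof (rule cmult_resolvent[OF inv])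
          have "exp (- (of_real (1 / r) * (of_real r * \<omega>))) = exp (- \<omega>)" using r by simp
          also have "\<dots> = of_real (exp (- \<beta>)) * cis (- (\<sigma> * pi))"
            by (simp add: \<omega>_def exp_eq_polar)
          also have "cis (- (\<sigma> * pi)) = -1" using \<sigma> by (auto simp: abs_if complex_eq_iff split: if_splits)
          also have "exp (- \<beta>) = \<eta>" using \<eta> by (simp add: \<beta>)
          finally show "exp (- (of_real (1 / r) * (of_real r * \<omega>))) = - of_real \<eta>" by simp
        qed (use r \<eta> \<beta>0 in \<open>auto simp: \<omega>_def\<close>)
        then have "cmult m (\<lambda>F. ?c s * (1 / (?z s - card F))) (cmod (?c s) * (M * (1 / r)))"
          unfolding r_def by (rule cmult_scale)
        moreover have "cmod (?c s) * (M * (1 / r)) \<le> D * (R * exp (- (s * R)))"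
        proof -
          have "cmod (?c s) * (M * (1 / r)) = cmod (select1 \<beta> (of_real r * \<omega>)) * (R * cmod \<omega> * (M * (1 / r)))"
            using R by (simp add: norm_mult r_def)
          also have "\<dots> \<le> (r * (\<beta>\<^sup>2 + pi\<^sup>2) / pi * exp (- r)) * (R * cmod \<omega> * (M * (1 / r)))"
            unfolding \<omega>_def using r R M0 \<sigma> by (intro mult_right_mono select1_ray \<beta>0) auto
          also have "\<dots> = D * (R * exp (- (s * R)))"
            using r False by (simp add: D_def \<omega>n r_def)
          finally show ?thesis .
        qed
        ultimately show ?thesis by (rule cmult_mono)
      qed
    qed
    then show ?thesis by (rule cmult_mono) (use D0 in \<open>simp add: mult_left_le\<close>)
  qed
  have lim: "cmult m (\<lambda>F. 2 * of_real pi * \<i> * select1 \<beta> (of_nat (card F))) (D + D)"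
  proof (rule cmult_limit)
    show "(\<lambda>n. edge_int \<beta> (-1) (real n) (card F) - edge_int \<beta> 1 (real n) (card F))
        \<longlonglongrightarrow> 2 * of_real pi * \<i> * select1 \<beta> (of_nat (card F))" if "F \<in> freqs m" for F
      by (rule edge_int_limit[OF \<beta>0 card[OF that]])
    have "cmult m (\<lambda>F. edge_int \<beta> (-1) (real n) (card F) - edge_int \<beta> 1 (real n) (card F)) (D + D)"
      if "0 < n" for n
      using cmult_add[OF edge[of n "-1"] cmult_scale[OF edge[of n 1], of "-1"]] that by simp
    then show "\<forall>\<^sub>F n in sequentially.
        cmult m (\<lambda>F. edge_int \<beta> (-1) (real n) (card F) - edge_int \<beta> 1 (real n) (card F)) (D + D)"
      by (intro eventually_mono[OF eventually_gt_at_top[of 0]])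
  qed auto
  define e where "e = exp (- ((1 + pi\<^sup>2) / \<beta>))"
  have e: "0 < e" by (simp add: e_def)
  have "mult m (\<lambda>F. 1 / (2 * pi * pi * e) * Re (\<i> * (2 * of_real pi * \<i> * select1 \<beta> (of_nat (card F)))))
      (\<bar>1 / (2 * pi * pi * e)\<bar> * (D + D))"
    by (intro mult_scale cmultD[OF lim]) simp
  moreover have "1 / (2 * pi * pi * e) * Re (\<i> * (2 * of_real pi * \<i> * select1 \<beta> (of_nat (card F))))
      = (if card F = 1 then 1 else 0)" if "F \<in> freqs m" for F
    using card[OF that] e by (simp add: select1_of_nat e_def[symmetric])
  ultimately have "mult m (\<lambda>F. if card F = 1 then 1 else 0) (\<bar>1 / (2 * pi * pi * e)\<bar> * (D + D))"
    by (rule mult_cong)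
  moreover have "\<bar>1 / (2 * pi * pi * e)\<bar> * (D + D)
      = M * (\<beta>\<^sup>2 + pi\<^sup>2) * sqrt (\<beta>\<^sup>2 + pi\<^sup>2) / (pi * pi\<^sup>2 * e)"
    using e by (simp add: D_def power2_eq_square field_simps)
  ultimately show ?thesis by (simp add: e_def)
qed

end

section \<open>K-convexity\<close>

context type_fun
begin

text \<open>
  Were \<open>1 - e\<^sup>-\<^sup>t\<^sup>N\<close> only known to have norm at most \<open>2\<close>, the inverse of \<open>\<eta> + e\<^sup>-\<^sup>t\<^sup>N\<close> would be out of
  reach of a Neumann series for \<open>\<eta> < 1\<close>. The gain \<open>2\<^sup>k - 1/2\<close> for the \<open>k\<close>-th power leaves room for an \<open>\<eta>\<close> slightly below \<open>1\<close>.
  Writing \<open>u = (1 - x) / (1 + \<eta>)\<close>, one has \<open>1 / (\<eta> + x) = (1 + u + \<dots> + u\<^sup>k\<^sup>-\<^sup>1) / ((1 + \<eta>) (1 - u\<^sup>k))\<close>.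
\<close>

lemma mult_inverse_noise:
  fixes t \<eta> :: real
  assumes k: "0 < k" and big: "C * k powr (1 / p) \<le> k / 2" and t: "0 < t"
    and \<eta>: "\<eta> = 1 - 1 / (k * 2 ^ (k + 1))" and q: "q = (2 ^ k - 1 / 2) / (1 + \<eta>) ^ k"
  shows "mult m (\<lambda>F. 1 / (\<eta> + exp (- (t * card F))))
    (1 / (1 + \<eta>) * ((\<Sum>s<k. (2 / (1 + \<eta>)) ^ s) * (1 / (1 - q))))" "0 < \<eta>" "\<eta> < 1" "q < 1"
proof -
  define \<delta> where "\<delta> = 1 / (real k * 2 ^ (k + 1))"
  have \<delta>0: "0 < \<delta>" using k by (simp add: \<delta>_def)
  have "1 * 2 \<le> real k * 2 ^ (k + 1)" using k by (intro mult_mono) auto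
  then have \<delta>1: "\<delta> \<le> 1 / 2" by (simp add: \<delta>_def field_simps)
  have \<eta>\<delta>: "\<eta> = 1 - \<delta>" by (simp add: \<eta> \<delta>_def)
  show \<eta>0: "0 < \<eta>" and \<eta>1: "\<eta> < 1" using \<delta>0 \<delta>1 by (auto simp: \<eta>\<delta>)
  have "2 ^ k - 1 / 2 < (2::real) ^ k * (1 - real k * (\<delta> / 2))"
    using k by (simp add: \<delta>_def field_simps)
  also have "\<dots> \<le> 2 ^ k * (1 - \<delta> / 2) ^ k"
    using Bernoulli_inequality[of "- (\<delta> / 2)" k] \<delta>1 by (intro mult_left_mono) auto
  also have "\<dots> = (1 + \<eta>) ^ k" by (simp add: \<eta>\<delta> flip: power_mult_distrib)
  finally show q1: "q < 1" using \<eta>0 by (simp add: q)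
  define \<rho> where "\<rho> = exp (- t)"
  have \<rho>: "0 < \<rho>" "\<rho> \<le> 1" using t by (auto simp: \<rho>_def)
  have \<rho>c: "exp (- (t * card F)) = \<rho> ^ card F" for F :: "nat set"
    by (simp add: \<rho>_def exp_of_nat_mult[symmetric] mult.commute)
  define u where "u F = (1 - \<rho> ^ card F) / (1 + \<eta>)" for F :: "nat set"
  have u01: "0 \<le> u F" "u F < 1" for F
  proof -
    have "0 < \<rho> ^ card F" "\<rho> ^ card F \<le> 1" using \<rho> by (auto simp: power_le_one)
    then show "0 \<le> u F" "u F < 1" using \<eta>0 by (auto simp: u_def)
  qed
  have "mult m (\<lambda>F. 1 / (1 + \<eta>) * (1 - \<rho> ^ card F)) (\<bar>1 / (1 + \<eta>)\<bar> * (1 + 1))"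
    by (intro mult_scale mult_minus mult_one mult_noise) (use \<rho> in auto)
  then have u: "mult m u (2 / (1 + \<eta>))" using \<eta>0 by (simp add: u_def[abs_def])
  have "mult m (\<lambda>F. (1 / (1 + \<eta>)) ^ k * (1 - \<rho> ^ card F) ^ k) (\<bar>(1 / (1 + \<eta>)) ^ k\<bar> * (2 ^ k - 1 / 2))"
    by (intro mult_scale mult_one_minus_noise k big) (use \<rho> in auto)
  then have uk: "mult m (\<lambda>F. u F ^ k) q" using \<eta>0 by (simp add: u_def q power_divide power_abs)
  have uk1: "u F ^ k \<noteq> 1" for F
  proof -
    have "u F ^ k < 1 ^ k" using u01[of F] k by (intro power_strict_mono) auto
    then show ?thesis by simp
  qed
  have "mult m (\<lambda>F. 1 / (1 + \<eta>) * ((\<Sum>s<k. u F ^ s) * (1 / (1 - u F ^ k))))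
      (\<bar>1 / (1 + \<eta>)\<bar> * ((\<Sum>s<k. (2 / (1 + \<eta>)) ^ s) * (1 / (1 - q))))"
    by (intro mult_scale mult_prod mult_sum mult_power u mult_inverse uk q1 uk1)
  moreover have "1 / (1 + \<eta>) * ((\<Sum>s<k. u F ^ s) * (1 / (1 - u F ^ k))) = 1 / (\<eta> + \<rho> ^ card F)" for F
  proof -
    have "1 - u F ^ k = (1 - u F) * (\<Sum>s<k. u F ^ s)" by (rule one_diff_power_eq)
    moreover from this uk1[of F] have "(\<Sum>s<k. u F ^ s) \<noteq> 0" by auto
    ultimately have "(\<Sum>s<k. u F ^ s) * (1 / (1 - u F ^ k)) = 1 / (1 - u F)" by simp
    moreover have "(1 + \<eta>) * (1 - u F) = \<eta> + \<rho> ^ card F" using \<eta>0 by (simp add: u_def field_simps)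
    moreover have "1 / (1 + \<eta>) * (1 / (1 - u F)) = 1 / ((1 + \<eta>) * (1 - u F))" by simp
    ultimately show ?thesis by (simp only:)
  qed
  ultimately show "mult m (\<lambda>F. 1 / (\<eta> + exp (- (t * card F))))
    (1 / (1 + \<eta>) * ((\<Sum>s<k. (2 / (1 + \<eta>)) ^ s) * (1 / (1 - q))))"
    using \<eta>0 by (simp add: \<rho>c)
qed

end

lemma sum_walsh_mult:
  assumes "t \<in> signs m" "s \<in> signs m"
  shows "(\<Sum>A\<in>Pow {..<m}. walsh A t * walsh A s) = (if s = t then 2 ^ m else 0)"
proof -
  have "(\<Prod>i<m. t i * s i + 1) = (\<Sum>A\<in>Pow {..<m}. (\<Prod>i\<in>A. t i * s i) * (\<Prod>i\<in>{..<m} - A. 1))"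
    by (rule prod_add) simp
  then have *: "(\<Sum>A\<in>Pow {..<m}. walsh A t * walsh A s) = (\<Prod>i<m. t i * s i + 1)"
    by (simp add: walsh_def prod.distrib)
  show ?thesis
  proof (cases "s = t")
    case True
    have "t i * t i = 1" if "i < m" for i using signs_cases[OF assms(1) that] by auto
    then have "(\<Prod>i<m. t i * s i + 1) = (\<Prod>i<m. 2)" using True by (intro prod.cong) auto
    then show ?thesis unfolding * using True by simp
  next
    case False
    then obtain i where i: "i < m" "s i \<noteq> t i"
      using assms unfolding signs_def by (metis PiE_ext lessThan_iff)
    then have "t i * s i + 1 = 0" using signs_cases[OF assms(1) i(1)] signs_cases[OF assms(2) i(1)] by auto
    then have "(\<Prod>i<m. t i * s i + 1) = 0" using i(1) by (intro prod_zero) auto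
    then show ?thesis unfolding * using False by simp
  qed
qed

context seminorm_fun
begin

lemma Lnorm_mean:
  "Lnorm m (\<lambda>t k. (\<Sum>s\<in>signs m. f s k) / 2 ^ m) \<le> Lnorm m f"
proof -
  let ?a = "N (\<lambda>k. (\<Sum>s\<in>signs m. f s k) / 2 ^ m)"
  have "?a \<le> (\<Sum>s\<in>signs m. N (f s)) / 2 ^ m"
    using N_scale[of "1 / 2 ^ m" "\<lambda>k. \<Sum>s\<in>signs m. f s k"] N_sum[of "\<lambda>s. f s" "signs m"]
    by (simp add: divide_right_mono)
  then have "?a\<^sup>2 \<le> ((\<Sum>s\<in>signs m. N (f s)) / 2 ^ m)\<^sup>2" by (intro power_mono N_nonneg)
  moreover have "(\<Sum>s\<in>signs m. N (f s) * 1)\<^sup>2 \<le> (\<Sum>s\<in>signs m. (N (f s))\<^sup>2) * (\<Sum>s\<in>signs m. 1\<^sup>2)"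
    by (rule Cauchy_Schwarz_ineq_sum)
  ultimately have "?a\<^sup>2 * (2 ^ m)\<^sup>2 \<le> (\<Sum>s\<in>signs m. (N (f s))\<^sup>2) * 2 ^ m"
    by (simp add: card_signs power_divide field_simps)
  then have "2 ^ m * (2 ^ m * ?a\<^sup>2) \<le> 2 ^ m * (\<Sum>s\<in>signs m. (N (f s))\<^sup>2)"
    by (simp only: power2_eq_square mult_ac)
  then have "2 ^ m * ?a\<^sup>2 \<le> (\<Sum>s\<in>signs m. (N (f s))\<^sup>2)"
    by (rule mult_left_le_imp_le) simp
  then show ?thesis by (simp add: cube_norm_def L2_set_def card_signs)
qed

lemma rademacher_projection_bound:
  assumes K: "mult m (\<lambda>F. if card F = 1 then 1 else 0) K"
  shows "Lnorm m (\<lambda>t k. \<Sum>i<m. t i * ((\<Sum>s\<in>signs m. s i * f s k) / 2 ^ m)) \<le> 2 * K * Lnorm m f"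
proof -
  define x where "x F k = (\<Sum>s\<in>signs m. walsh F s * f s k) / 2 ^ m" for F k
  have split: "wpoly m x t k = f t k - (\<Sum>s\<in>signs m. f s k) / 2 ^ m" if t: "t \<in> signs m" for t k
  proof -
    have "(\<Sum>F\<in>Pow {..<m}. walsh F t * x F k)
        = (\<Sum>s\<in>signs m. (\<Sum>F\<in>Pow {..<m}. walsh F t * walsh F s) * f s k) / 2 ^ m"
      unfolding x_def sum_distrib_right sum_divide_distrib sum_distrib_left
      by (subst sum.swap) (simp add: mult_ac)
    also have "\<dots> = (\<Sum>s\<in>signs m. if s = t then 2 ^ m * f s k else 0) / 2 ^ m"
      using t by (intro arg_cong[where f = "\<lambda>a. a / 2 ^ m"] sum.cong) (auto simp: sum_walsh_mult)
    also have "\<dots> = f t k" using t by simp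
    finally have "(\<Sum>F\<in>Pow {..<m}. walsh F t * x F k) = f t k" .
    moreover have "(\<Sum>F\<in>Pow {..<m}. walsh F t * x F k) = walsh {} t * x {} k + wpoly m x t k"
      unfolding wpoly_def freqs_def by (subst sum.remove[of _ "{}"]) auto
    ultimately show ?thesis by (simp add: walsh_def x_def)
  qed
  have "Lnorm m (wpoly m x) = Lnorm m (\<lambda>t k. f t k - (\<Sum>s\<in>signs m. f s k) / 2 ^ m)"
    by (rule Lnorm_cong) (simp add: split fun_eq_iff)
  also have "\<dots> \<le> Lnorm m f + Lnorm m (\<lambda>t k. (\<Sum>s\<in>signs m. f s k) / 2 ^ m)" by (rule Lnorm_diff)
  also have "\<dots> \<le> 2 * Lnorm m f" using Lnorm_mean[of m f] by simp
  finally have xf: "Lnorm m (wpoly m x) \<le> 2 * Lnorm m f" .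
  have "wpoly m (\<lambda>F k. (if card F = 1 then 1 else 0) * x F k) t k
      = (\<Sum>i<m. t i * ((\<Sum>s\<in>signs m. s i * f s k) / 2 ^ m))" for t k
  proof -
    have "(\<Sum>i<m. t i * ((\<Sum>s\<in>signs m. s i * f s k) / 2 ^ m)) = (\<Sum>i<m. walsh {i} t * x {i} k)"
      by (simp add: walsh_def x_def)
    also have "\<dots> = (\<Sum>F\<in>(\<lambda>i. {i}) ` {..<m}. walsh F t * x F k)"
      by (subst sum.reindex) (auto simp: inj_on_def)
    also have "(\<lambda>i. {i}) ` {..<m} = {F \<in> freqs m. card F = 1}"
      by (auto simp: freqs_def card_1_singleton_iff)
    also have "(\<Sum>F\<in>\<dots>. walsh F t * x F k) = wpoly m (\<lambda>F k. (if card F = 1 then 1 else 0) * x F k) t k"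
      unfolding wpoly_def by (intro sum.mono_neutral_cong_left) auto
    finally show ?thesis by simp
  qed
  then have "Lnorm m (\<lambda>t k. \<Sum>i<m. t i * ((\<Sum>s\<in>signs m. s i * f s k) / 2 ^ m))
      = Lnorm m (wpoly m (\<lambda>F k. (if card F = 1 then 1 else 0) * x F k))"
    by (intro Lnorm_cong) (simp add: fun_eq_iff)
  also have "\<dots> \<le> K * Lnorm m (wpoly m x)" by (rule multD[OF K])
  also have "\<dots> \<le> K * (2 * Lnorm m f)" using xf mult_nonneg[OF K] by (rule mult_left_mono)
  finally show ?thesis by simp
qed

end

text \<open>
  Pisier's theorem that type \<open>p > 1\<close> implies \<open>K\<close>-convexity, with the order of the quantifiers that
  matters here: the constant depends neither on the norm nor on the dimension of the cube.
\<close>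

theorem K_convexity:
  fixes p C :: real
  assumes p: "1 < p"
  shows "\<exists>A>0. \<forall>N m f. type_fun N p C \<longrightarrow>
    cube_norm N m (\<lambda>t k. \<Sum>i<m. t i * ((\<Sum>s\<in>signs m. s i * f s k) / 2 ^ m)) \<le> A * cube_norm N m f"
proof -
  \<comment> \<open>For large \<open>k\<close> the type bound \<open>C k\<^sup>1\<^sup>/\<^sup>p\<close> is at most half of the trivial bound \<open>k\<close>.\<close>
  define e where "e = 1 - 1 / p"
  have e: "0 < e" using p by (simp add: e_def)
  have "filterlim (\<lambda>k. real k powr e) at_top sequentially"
    using e by real_asymp
  then have "\<forall>\<^sub>F k in sequentially. 2 * C \<le> real k powr e \<and> 0 < k"
    by (intro eventually_conj eventually_gt_at_top) (simp add: filterlim_at_top)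
  then obtain k where k: "2 * C \<le> real k powr e" "0 < k"
    by (auto simp: eventually_sequentially)
  have big: "C * k powr (1 / p) \<le> k / 2"
  proof -
    have "2 * C * k powr (1 / p) \<le> k powr e * k powr (1 / p)" by (intro mult_right_mono k) simp
    also have "\<dots> = k" using k(2) by (simp add: e_def flip: powr_add)
    finally show ?thesis by simp
  qed
  define \<eta> where "\<eta> = 1 - 1 / (real k * 2 ^ (k + 1))"
  define q where "q = (2 ^ k - 1 / 2) / (1 + \<eta>) ^ k"
  define M where "M = 1 / (1 + \<eta>) * ((\<Sum>s<k. (2 / (1 + \<eta>)) ^ s) * (1 / (1 - q)))"
  define \<beta> where "\<beta> = - ln \<eta>"
  define K where "K = M * (\<beta>\<^sup>2 + pi\<^sup>2) * sqrt (\<beta>\<^sup>2 + pi\<^sup>2) / (pi * pi\<^sup>2 * exp (- ((1 + pi\<^sup>2) / \<beta>)))"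
  show ?thesis
  proof (intro exI[of _ "\<bar>2 * K\<bar> + 1"] conjI allI impI)
    fix N m f assume "type_fun N p C"
    then interpret type_fun N p C .
    note inv = mult_inverse_noise[OF k(2) big _ \<eta>_def q_def]
    have "mult m (\<lambda>F. if card F = 1 then 1 else 0) K"
      unfolding K_def
      by (rule mult_degree_one[OF _ _ \<beta>_def]) (use inv[of 1] inv(1) in \<open>auto simp: M_def\<close>)
    from rademacher_projection_bound[OF this, of f]
    have "cube_norm N m (\<lambda>t k. \<Sum>i<m. t i * ((\<Sum>s\<in>signs m. s i * f s k) / 2 ^ m)) \<le> 2 * K * cube_norm N m f" .
    also have "\<dots> \<le> (\<bar>2 * K\<bar> + 1) * cube_norm N m f"
      using Lnorm_nonneg by (intro mult_right_mono) auto
    finally show "cube_norm N m (\<lambda>t k. \<Sum>i<m. t i * ((\<Sum>s\<in>signs m. s i * f s k) / 2 ^ m))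
        \<le> (\<bar>2 * K\<bar> + 1) * cube_norm N m f" .
  qed auto
qed

section \<open>Linear maps and the product Lebesgue measure\<close>

abbreviation lebm :: "nat \<Rightarrow> (nat \<Rightarrow> real) measure" where
  "lebm m \<equiv> \<Pi>\<^sub>M i\<in>{..<m}. lborel"

interpretation lebm: product_sigma_finite "\<lambda>i :: nat. lborel :: real measure"
  by standard

definition lin :: "nat \<Rightarrow> real mat \<Rightarrow> (nat \<Rightarrow> real) \<Rightarrow> nat \<Rightarrow> real" where
  "lin m A x = (\<lambda>i\<in>{..<m}. \<Sum>j<m. A $$ (i, j) * x j)"

lemma lin_rspace [simp]: "lin m A x \<in> rspace m"
  by (simp add: lin_def rspace_def)

lemma space_lebm: "space (lebm m) = rspace m"
  by (simp add: space_PiM rspace_def)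

lemma lin_measurable [measurable]: "lin m A \<in> measurable (lebm m) (lebm m)"
  unfolding lin_def by (rule measurable_restrict) measurable

lemma mat_mult_entry:
  assumes "A \<in> carrier_mat m m" "B \<in> carrier_mat m m" "i < m" "j < m"
  shows "(A * B) $$ (i, j) = (\<Sum>l<m. A $$ (i, l) * B $$ (l, j))"
  using assms by (simp add: scalar_prod_def lessThan_atLeast0)

lemma lin_mult:
  assumes "A \<in> carrier_mat m m" "B \<in> carrier_mat m m"
  shows "lin m (A * B) x = lin m A (lin m B x)"
proof -
  have "(\<Sum>j<m. (A * B) $$ (i, j) * x j) = (\<Sum>l<m. A $$ (i, l) * (\<Sum>j<m. B $$ (l, j) * x j))"
    if "i < m" for i
  proof -
    have "(\<Sum>j<m. (A * B) $$ (i, j) * x j) = (\<Sum>j<m. \<Sum>l<m. A $$ (i, l) * (B $$ (l, j) * x j))"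
      using assms that
      by (intro sum.cong refl) (simp add: mat_mult_entry sum_distrib_right mult.assoc del: index_mult_mat)
    also have "\<dots> = (\<Sum>l<m. \<Sum>j<m. A $$ (i, l) * (B $$ (l, j) * x j))" by (rule sum.swap)
    finally show ?thesis by (simp add: sum_distrib_left)
  qed
  then show ?thesis by (simp add: lin_def fun_eq_iff restrict_def)
qed

text \<open>Preimages avoid any discussion of measurability of images.\<close>

definition scales :: "nat \<Rightarrow> real mat \<Rightarrow> bool" where
  "scales m A \<longleftrightarrow> (\<forall>S\<in>sets (lebm m).
     ennreal \<bar>det A\<bar> * emeasure (lebm m) (lin m A -` S \<inter> space (lebm m)) = emeasure (lebm m) S)"

lemma scales_mult:
  assumes AB: "A \<in> carrier_mat m m" "B \<in> carrier_mat m m" and sc: "scales m A" "scales m B"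
  shows "scales m (A * B)"
  unfolding scales_def
proof
  fix S assume S: "S \<in> sets (lebm m)"
  let ?S' = "lin m A -` S \<inter> space (lebm m)"
  have S': "?S' \<in> sets (lebm m)" using S by measurable
  have "lin m (A * B) -` S \<inter> space (lebm m) = lin m B -` ?S' \<inter> space (lebm m)"
    by (auto simp: lin_mult[OF AB] space_lebm)
  then have "ennreal \<bar>det (A * B)\<bar> * emeasure (lebm m) (lin m (A * B) -` S \<inter> space (lebm m))
      = ennreal \<bar>det A\<bar> * (ennreal \<bar>det B\<bar> * emeasure (lebm m) (lin m B -` ?S' \<inter> space (lebm m)))"
    using AB by (simp add: det_mult abs_mult ennreal_mult mult.assoc)
  also have "\<dots> = ennreal \<bar>det A\<bar> * emeasure (lebm m) ?S'"
    using sc(2)[unfolded scales_def, rule_format, OF S'] by (rule arg_cong)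
  also have "\<dots> = emeasure (lebm m) S"
    using sc(1) S by (simp add: scales_def)
  finally show "ennreal \<bar>det (A * B)\<bar> * emeasure (lebm m) (lin m (A * B) -` S \<inter> space (lebm m)) = emeasure (lebm m) S" .
qed

text \<open>These matrices alone suffice for Gaussian elimination; they cover scalings and shears.\<close>

definition rowrep :: "nat \<Rightarrow> nat \<Rightarrow> (nat \<Rightarrow> real) \<Rightarrow> real mat" where
  "rowrep m k c = mat m m (\<lambda>(i, j). if i = k then c j else if i = j then 1 else 0)"

lemma rowrep_carrier [simp]: "rowrep m k c \<in> carrier_mat m m"
  by (simp add: rowrep_def)

lemma rowrep_entry: "i < m \<Longrightarrow> j < m \<Longrightarrow>
    rowrep m k c $$ (i, j) = (if i = k then c j else if i = j then 1 else 0)"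
  by (simp add: rowrep_def)

lemma mult_rowrep_entry:
  assumes "A \<in> carrier_mat m m" "i < m" "j < m" "k < m"
  shows "(A * rowrep m k c) $$ (i, j) = A $$ (i, k) * c j + (if j = k then 0 else A $$ (i, j))"
proof -
  have "(A * rowrep m k c) $$ (i, j) = (\<Sum>l<m. A $$ (i, l) * (if l = k then c j else if l = j then 1 else 0))"
    using assms by (simp add: mat_mult_entry rowrep_entry del: index_mult_mat)
  also have "\<dots> = A $$ (i, k) * c j + (\<Sum>l\<in>{..<m}-{k}. A $$ (i, l) * (if l = j then 1 else 0))"
    using assms by (subst sum.remove[of _ k]) auto
  also have "(\<Sum>l\<in>{..<m}-{k}. A $$ (i, l) * (if l = j then 1 else 0)) = (if j = k then 0 else A $$ (i, j))"
    using assms by (simp add: mult_delta_right sum.delta)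
  finally show ?thesis .
qed

lemma permutes_fix_all_but_one:
  assumes "p permutes S" "\<And>i. i \<in> S \<Longrightarrow> i \<noteq> k \<Longrightarrow> p i = i"
  shows "p = id"
proof (rule ext)
  fix i show "p i = id i"
  proof (cases "p i = i")
    case False
    then have "i \<in> S" using assms(1) by (auto simp: permutes_def)
    then have "i = k" using False assms(2) by auto
    have "p i \<in> S" using assms(1) \<open>i \<in> S\<close> by (simp add: permutes_in_image)
    moreover have "p i \<noteq> k" using False \<open>i = k\<close> by simp
    ultimately have "p (p i) = p i" using assms(2) by blast
    then have "p i = i" using permutes_inj[OF assms(1)] by (simp add: inj_eq)
    then show ?thesis by simp
  qed simp
qed

lemma det_rowrep:
  assumes "k < m"
  shows "det (rowrep m k c) = c k"
proof -
  have "det (rowrep m k c) = (\<Sum>p\<in>{p. p permutes {0..<m}}. signof p * (\<Prod>i = 0..<m. rowrep m k c $$ (i, p i)))"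
    by (simp add: det_def')
  also have "\<dots> = (\<Sum>p\<in>{id}. signof p * (\<Prod>i = 0..<m. rowrep m k c $$ (i, p i)))"
  proof (rule sum.mono_neutral_right)
    show "\<forall>p\<in>{p. p permutes {0..<m}} - {id}. signof p * (\<Prod>i = 0..<m. rowrep m k c $$ (i, p i)) = 0"
    proof
      fix p assume p: "p \<in> {p. p permutes {0..<m}} - {id}"
      then obtain i where i: "i < m" "i \<noteq> k" "p i \<noteq> i"
        using permutes_fix_all_but_one[of p "{0..<m}" k] by auto
      then have "p i < m" using p permutes_in_image[of p "{0..<m}" i] by auto
      with i have "rowrep m k c $$ (i, p i) = 0" by (simp add: rowrep_entry)
      then have "(\<Prod>i = 0..<m. rowrep m k c $$ (i, p i)) = 0"
        using i by (intro prod_zero) auto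
      then show "signof p * (\<Prod>i = 0..<m. rowrep m k c $$ (i, p i)) = 0" by simp
    qed
  qed (auto simp: finite_permutations permutes_id)
  also have "\<dots> = (\<Prod>i = 0..<m. if i = k then c k else 1)"
    by (auto simp: sign_id rowrep_entry simp del: prod.delta prod.delta' intro!: prod.cong)
  also have "\<dots> = c k" using assms by (simp add: prod.delta)
  finally show ?thesis .
qed

text \<open>A single row is handled by Fubini's theorem and the affine substitution in one variable.\<close>

lemma scales_rowrep:
  assumes k: "k < m" and ck: "c k \<noteq> 0"
  shows "scales m (rowrep m k c)"
  unfolding scales_def
proof
  fix S assume S: "S \<in> sets (lebm m)"
  let ?J = "{..<m} - {k}"
  let ?MJ = "\<Pi>\<^sub>M i\<in>?J. lborel :: real measure"
  have ins: "insert k ?J = {..<m}" using k by auto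
  have pre: "lin m (rowrep m k c) -` S \<inter> space (lebm m) \<in> sets (lebm m)"
    using S by measurable
  have em: "emeasure (lebm m) X = (\<integral>\<^sup>+x. (\<integral>\<^sup>+y. indicator X (x(k := y)) \<partial>lborel) \<partial>?MJ)"
    if "X \<in> sets (lebm m)" for X
  proof -
    have "indicator X \<in> borel_measurable (Pi\<^sub>M (insert k ?J) (\<lambda>_. lborel :: real measure))"
      using that unfolding ins by simp
    from lebm.product_nn_integral_insert[OF _ _ this] show ?thesis
      using that unfolding ins by simp
  qed
  have line: "lin m (rowrep m k c) (x(k := y)) = x(k := (\<Sum>j\<in>?J. c j * x j) + c k * y)"
    if x: "x \<in> space ?MJ" for x y
  proof
    fix i
    have xe: "x \<in> ?J \<rightarrow>\<^sub>E UNIV" using x by (simp add: space_PiM)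
    show "lin m (rowrep m k c) (x(k := y)) i = (x(k := (\<Sum>j\<in>?J. c j * x j) + c k * y)) i"
    proof (cases "i < m")
      case False
      then show ?thesis using xe k by (auto simp: lin_def PiE_def extensional_def)
    next
      case True
      show ?thesis
      proof (cases "i = k")
        case True
        have "(\<Sum>j<m. rowrep m k c $$ (k, j) * (x(k := y)) j) = (\<Sum>j<m. c j * (x(k := y)) j)"
          using k by (intro sum.cong) (auto simp: rowrep_entry)
        also have "\<dots> = c k * y + (\<Sum>j\<in>?J. c j * x j)"
          using k by (subst sum.remove[of _ k]) auto
        finally show ?thesis using True k by (simp add: lin_def)
      next
        case False
        have "(\<Sum>j<m. rowrep m k c $$ (i, j) * (x(k := y)) j) = (\<Sum>j<m. if i = j then (x(k := y)) j else 0)"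
          using \<open>i < m\<close> False by (intro sum.cong) (auto simp: rowrep_entry)
        also have "\<dots> = x i" using \<open>i < m\<close> False by simp
        finally show ?thesis using False \<open>i < m\<close> by (simp add: lin_def)
      qed
    qed
  qed
  have meas: "(\<lambda>y. indicator S (x(k := y)) :: ennreal) \<in> borel_measurable borel" if x: "x \<in> space ?MJ" for x
  proof -
    have "(\<lambda>y. x(k := y)) \<in> measurable lborel (Pi\<^sub>M (insert k ?J) (\<lambda>_. lborel))"
      by (rule measurable_component_update[OF x]) simp
    then have "(\<lambda>y. x(k := y)) \<in> measurable lborel (lebm m)" by (simp only: ins)
    then have "(\<lambda>y. indicator S (x(k := y)) :: ennreal) \<in> borel_measurable lborel"
      using S by measurable
    then show ?thesis by simp
  qed
  have "ennreal \<bar>c k\<bar> * emeasure (lebm m) (lin m (rowrep m k c) -` S \<inter> space (lebm m))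
      = ennreal \<bar>c k\<bar> * (\<integral>\<^sup>+x. (\<integral>\<^sup>+y. indicator S (x(k := (\<Sum>j\<in>?J. c j * x j) + c k * y)) \<partial>lborel) \<partial>?MJ)"
  proof -
    have "indicator (lin m (rowrep m k c) -` S \<inter> space (lebm m)) (x(k := y))
        = (indicator S (x(k := (\<Sum>j\<in>?J. c j * x j) + c k * y)) :: ennreal)" if x: "x \<in> space ?MJ" for x y
    proof -
      have "x(k := y) \<in> rspace m" using x k by (auto simp: space_PiM rspace_def PiE_def extensional_def)
      then show ?thesis using line[OF x, of y] by (simp add: indicator_def space_lebm)
    qed
    then show ?thesis unfolding em[OF pre] by (simp cong: nn_integral_cong)
  qed
  also have "\<dots> = (\<integral>\<^sup>+x. ennreal \<bar>c k\<bar> * (\<integral>\<^sup>+y. indicator S (x(k := (\<Sum>j\<in>?J. c j * x j) + c k * y)) \<partial>lborel) \<partial>?MJ)"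
  proof (rule nn_integral_cmult[symmetric])
    have "(\<lambda>(x, y). x(k := (\<Sum>j\<in>?J. c j * x j) + c k * y)) \<in> measurable (?MJ \<Otimes>\<^sub>M lborel) (Pi\<^sub>M (insert k ?J) (\<lambda>_. lborel))"
      by measurable
    then have "(\<lambda>(x, y). x(k := (\<Sum>j\<in>?J. c j * x j) + c k * y)) \<in> measurable (?MJ \<Otimes>\<^sub>M lborel) (lebm m)"
      by (simp only: ins)
    from measurable_compose[OF this, of "indicator S :: _ \<Rightarrow> ennreal" borel]
    have "(\<lambda>(x, y). indicator S (x(k := (\<Sum>j\<in>?J. c j * x j) + c k * y)) :: ennreal) \<in> borel_measurable (?MJ \<Otimes>\<^sub>M lborel)"
      using S by (simp add: case_prod_beta)
    then show "(\<lambda>x. \<integral>\<^sup>+y. indicator S (x(k := (\<Sum>j\<in>?J. c j * x j) + c k * y)) \<partial>lborel) \<in> borel_measurable ?MJ"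
      by (intro lborel.borel_measurable_nn_integral) (simp add: case_prod_beta)
  qed
  also have "\<dots> = (\<integral>\<^sup>+x. (\<integral>\<^sup>+y. indicator S (x(k := y)) \<partial>lborel) \<partial>?MJ)"
    by (rule nn_integral_cong) (simp add: nn_integral_real_affine[OF meas ck, symmetric])
  also have "\<dots> = emeasure (lebm m) S" by (rule em[OF S, symmetric])
  finally show "ennreal \<bar>det (rowrep m k c)\<bar> * emeasure (lebm m) (lin m (rowrep m k c) -` S \<inter> space (lebm m))
      = emeasure (lebm m) S"
    by (simp add: det_rowrep[OF k])
qed

lemma scales_one: "scales m (1\<^sub>m m)"
proof -
  have "lin m (1\<^sub>m m) x = x" if "x \<in> rspace m" for x
  proof
    fix i show "lin m (1\<^sub>m m) x i = x i"
    proof (cases "i < m")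
      case True
      then have "(\<Sum>j<m. 1\<^sub>m m $$ (i, j) * x j) = (\<Sum>j<m. if i = j then x j else 0)"
        by (intro sum.cong) auto
      then show ?thesis using True by (simp add: lin_def)
    qed (use that in \<open>auto simp: lin_def rspace_def PiE_def extensional_def\<close>)
  qed
  then have "lin m (1\<^sub>m m) -` S \<inter> space (lebm m) = S" if "S \<in> sets (lebm m)" for S
    using sets.sets_into_space[OF that] by (auto simp: space_lebm)
  then show ?thesis by (simp add: scales_def)
qed

definition rowinv :: "nat \<Rightarrow> (nat \<Rightarrow> real) \<Rightarrow> nat \<Rightarrow> real" where
  "rowinv k c j = (if j = k then 1 / c k else - c j / c k)"

lemma rowrep_rowinv:
  assumes "k < m" "c k \<noteq> 0"
  shows "rowrep m k (rowinv k c) * rowrep m k c = 1\<^sub>m m"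
  by (rule eq_matI)
    (use assms in \<open>auto simp: mult_rowrep_entry rowrep_entry rowinv_def field_simps simp del: index_mult_mat(1)\<close>,
     auto simp: rowrep_def)

lemma scales_peel:
  assumes A: "A \<in> carrier_mat m m" and k: "k < m" "c k \<noteq> 0"
    and sc: "scales m (A * rowrep m k (rowinv k c))"
  shows "scales m A"
proof -
  have "A = (A * rowrep m k (rowinv k c)) * rowrep m k c"
    using A rowrep_rowinv[of k m c, OF k] by (simp add: assoc_mult_mat[of A m m _ m _ m])
  moreover have "scales m ((A * rowrep m k (rowinv k c)) * rowrep m k c)"
    by (rule scales_mult[OF _ _ sc scales_rowrep]) (use A k in auto)
  ultimately show ?thesis by simp
qed

text \<open>
  Gaussian elimination by column operations. If the first \<open>k\<close> rows are those of the identity and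
  the pivot is nonzero, dividing by the matrix with row \<open>k\<close> of \<open>A\<close> makes one more row trivial. A zero
  pivot is first replaced by adding a later column; if the row had no entry beyond the diagonal,
  the determinant would vanish.
\<close>

lemma scales_partial_identity:
  assumes "k \<le> m" "A \<in> carrier_mat m m" "det A \<noteq> 0"
    "\<And>i j. i < k \<Longrightarrow> j < m \<Longrightarrow> A $$ (i, j) = (if i = j then 1 else 0)"
  shows "scales m A"
  using assms
proof (induction k arbitrary: A rule: inc_induct)
  case base
  then have "A = 1\<^sub>m m" by (intro eq_matI) auto
  then show ?case by (simp add: scales_one)
next
  case (step k)
  note A = step.prems(1)
  have pivot: "scales m A'" if A': "A' \<in> carrier_mat m m" "det A' \<noteq> 0" "A' $$ (k, k) \<noteq> 0"
    and rows: "\<And>i j. i < k \<Longrightarrow> j < m \<Longrightarrow> A' $$ (i, j) = (if i = j then 1 else 0)" for A'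
  proof (rule scales_peel[OF A'(1), of k "\<lambda>j. A' $$ (k, j)"])
    let ?R = "rowrep m k (rowinv k (\<lambda>j. A' $$ (k, j)))"
    show "scales m (A' * ?R)"
    proof (rule step.IH)
      show "det (A' * ?R) \<noteq> 0"
        using A' step.hyps by (simp add: det_mult[of _ m] det_rowrep rowinv_def)
      show "(A' * ?R) $$ (i, j) = (if i = j then 1 else 0)" if "i < Suc k" "j < m" for i j
        using that A' rows[of i] step.hyps
        by (auto simp: mult_rowrep_entry rowinv_def less_Suc_eq simp del: index_mult_mat(1))
    qed (use A' in auto)
  qed (use A' step.hyps in auto)
  show ?case
  proof (cases "A $$ (k, k) = 0")
    case False
    then show ?thesis using step.prems by (intro pivot) auto
  next
    case True
    have "\<exists>j. k < j \<and> j < m \<and> A $$ (k, j) \<noteq> 0"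
    proof (rule ccontr)
      assume no: "\<not> ?thesis"
      define v where "v = vec m (\<lambda>l. if l < k then - A $$ (k, l) else if l = k then 1 else 0)"
      have "transpose_mat A *\<^sub>v v = 0\<^sub>v m"
      proof (rule eq_vecI)
        fix j assume "j < dim_vec (0\<^sub>v m :: real vec)"
        then have j: "j < m" by simp
        have "(transpose_mat A *\<^sub>v v) $ j = (\<Sum>l<m. A $$ (l, j) * v $ l)"
          using A j by (simp add: scalar_prod_def v_def lessThan_atLeast0)
        also have "\<dots> = (\<Sum>l<m. (if l < k then - A $$ (k, l) * (if l = j then 1 else 0) else 0)
            + (if l = k then A $$ (k, j) else 0))"
          using step.prems(3) j by (intro sum.cong) (auto simp: v_def)
        also have "\<dots> = (\<Sum>l<m. if l = j then (if j < k then - A $$ (k, j) else 0) else 0) + A $$ (k, j)"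
        proof -
          have "(\<Sum>l<m. if l < k then - A $$ (k, l) * (if l = j then 1 else 0) else 0)
              = (\<Sum>l<m. if l = j then (if j < k then - A $$ (k, j) else 0) else 0)"
            by (rule sum.cong) auto
          then show ?thesis using step.hyps by (simp add: sum.distrib)
        qed
        also have "\<dots> = 0"
        proof (cases "j < k")
          case False
          then have "A $$ (k, j) = 0" using j no True by (cases "j = k") auto
          then show ?thesis using False by simp
        qed (use j in simp)
        finally show "(transpose_mat A *\<^sub>v v) $ j = 0\<^sub>v m $ j" using j by simp
      qed (use A in simp)
      moreover have "v \<noteq> 0\<^sub>v m"
      proof
        assume "v = 0\<^sub>v m"
        then have "v $ k = 0" using step.hyps by simp
        then show False using step.hyps by (simp add: v_def)
      qed
      moreover have "v \<in> carrier_vec m" by (simp add: v_def)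
      ultimately have "det (transpose_mat A) = 0"
        using det_0_iff_vec_prod_zero_field[of "transpose_mat A" m] A by auto
      then show False using step.prems(2) A by (simp add: det_transpose[of _ m])
    qed
    then obtain j where j: "k < j" "j < m" "A $$ (k, j) \<noteq> 0" by blast
    define c where "c l = (if l = j then 1 else if l = k then -1 else (0::real))" for l
    have inv: "rowinv j c = (\<lambda>l. if l = j \<or> l = k then 1 else 0)"
      using j by (auto simp: rowinv_def c_def fun_eq_iff)
    show ?thesis
    proof (rule scales_peel[OF A, of j c])
      show "scales m (A * rowrep m j (rowinv j c))"
      proof (rule pivot)
        show "det (A * rowrep m j (rowinv j c)) \<noteq> 0"
          using A j step.prems(2) by (simp add: det_mult[of _ m] det_rowrep inv)
        show "(A * rowrep m j (rowinv j c)) $$ (k, k) \<noteq> 0"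
          using A j True by (simp add: mult_rowrep_entry inv del: index_mult_mat(1))
        show "(A * rowrep m j (rowinv j c)) $$ (i, l) = (if i = l then 1 else 0)" if "i < k" "l < m" for i l
          using A j that step.prems(3)
          by (auto simp: mult_rowrep_entry inv simp del: index_mult_mat(1))
      qed (use A in auto)
    qed (use j in \<open>auto simp: c_def\<close>)
  qed
qed

theorem emeasure_lin_vimage:
  assumes "A \<in> carrier_mat m m" "det A \<noteq> 0" "S \<in> sets (lebm m)"
  shows "ennreal \<bar>det A\<bar> * emeasure (lebm m) (lin m A -` S \<inter> rspace m) = emeasure (lebm m) S"
  using scales_partial_identity[of 0 m A] assms by (simp add: scales_def space_lebm)

section \<open>Lewis' position\<close>

text \<open>
  A norm on the first \<open>d\<close> coordinates, given as a function of sequences that ignores the other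
  coordinates.
\<close>

locale norm_fun = seminorm_fun +
  fixes d :: nat and R :: real
  assumes N_cong: "(\<And>i. i < d \<Longrightarrow> x i = y i) \<Longrightarrow> N x = N y"
    and N_lower: "i < d \<Longrightarrow> \<bar>x i\<bar> \<le> R * N x"
    and R_pos: "0 < R"
begin

definition unit :: "nat \<Rightarrow> nat \<Rightarrow> real" where
  "unit i = (\<lambda>k. if k = i then 1 else 0)"

lemma N_upper: "N x \<le> (\<Sum>i<d. \<bar>x i\<bar> * N (unit i))"
proof -
  have "N x = N (\<lambda>k. \<Sum>i<d. x i * unit i k)"
    by (rule N_cong) (simp add: unit_def mult_delta_right)
  also have "\<dots> \<le> (\<Sum>i<d. \<bar>x i\<bar> * N (unit i))" by (rule N_sum_scale)
  finally show ?thesis .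
qed

lemma N_Lipschitz: "\<bar>N x - N y\<bar> \<le> (\<Sum>i<d. \<bar>x i - y i\<bar> * N (unit i))"
proof -
  have "N x \<le> N y + N (\<lambda>k. x k - y k)" for x y
    using N_add[of y "\<lambda>k. x k - y k"] by simp
  from this[of x y] this[of y x] show ?thesis
    using N_upper[of "\<lambda>k. x k - y k"] N_upper[of "\<lambda>k. y k - x k"] by (simp add: abs_minus_commute)
qed

lemma continuous_on_N:
  assumes "\<And>i. i < d \<Longrightarrow> continuous_on S (\<lambda>u. x u i)"
  shows "continuous_on S (\<lambda>u. N (x u))"
  unfolding continuous_on_def
proof
  fix a assume a: "a \<in> S"
  have "((\<lambda>u. \<Sum>i<d. \<bar>x u i - x a i\<bar> * N (unit i)) \<longlongrightarrow> (\<Sum>i<d. \<bar>x a i - x a i\<bar> * N (unit i))) (at a within S)"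
    using assms a by (intro tendsto_intros) (auto simp: continuous_on_def)
  then have lim: "((\<lambda>u. \<Sum>i<d. \<bar>x u i - x a i\<bar> * N (unit i)) \<longlongrightarrow> 0) (at a within S)" by simp
  have "((\<lambda>u. N (x u) - N (x a)) \<longlongrightarrow> 0) (at a within S)"
    by (rule Lim_null_comparison[OF _ lim]) (simp add: N_Lipschitz)
  then show "((\<lambda>u. N (x u)) \<longlongrightarrow> N (x a)) (at a within S)" by (rule Lim_null[THEN iffD2])
qed

lemma N_eq_0: "N x = 0 \<Longrightarrow> i < d \<Longrightarrow> x i = 0"
  using N_lower[of i x] by simp

definition dot :: "(nat \<Rightarrow> real) \<Rightarrow> (nat \<Rightarrow> real) \<Rightarrow> real" where
  "dot v x = (\<Sum>i<d. v i * x i)"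

text \<open>The norm whose unit ball is the polar of the unit ball of \<open>N\<close>.\<close>

definition dual_norm :: "(nat \<Rightarrow> real) \<Rightarrow> real" where
  "dual_norm v = (SUP x\<in>{x. N x \<le> 1}. dot v x)"

lemma dot_scale: "dot v (\<lambda>k. c * x k) = c * dot v x" "dot (\<lambda>k. c * v k) x = c * dot v x"
  by (simp_all add: dot_def sum_distrib_left mult_ac)

lemma dot_add: "dot (\<lambda>k. v k + w k) x = dot v x + dot w x" "dot v (\<lambda>k. x k + y k) = dot v x + dot v y"
  by (simp_all add: dot_def distrib_right distrib_left sum.distrib)

lemma dot_bound: "N x \<le> 1 \<Longrightarrow> dot v x \<le> (\<Sum>i<d. \<bar>v i\<bar> * R)"
  unfolding dot_def
proof (rule sum_mono)
  fix i assume x: "N x \<le> 1" and i: "i \<in> {..<d}"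
  have "R * N x \<le> R * 1" using x R_pos by (intro mult_left_mono) auto
  then have "\<bar>x i\<bar> \<le> R" using N_lower[of i x] i by simp
  then have "\<bar>v i\<bar> * \<bar>x i\<bar> \<le> \<bar>v i\<bar> * R" by (intro mult_left_mono) auto
  then show "v i * x i \<le> \<bar>v i\<bar> * R" using abs_ge_self[of "v i * x i"] by (simp add: abs_mult)
qed

lemma dual_norm_bdd: "bdd_above (dot v ` {x. N x \<le> 1})"
  by (rule bdd_aboveI2[where M = "\<Sum>i<d. \<bar>v i\<bar> * R"]) (simp add: dot_bound)

lemma dot_le_dual_norm1: "N x \<le> 1 \<Longrightarrow> dot v x \<le> dual_norm v"
  unfolding dual_norm_def by (rule cSUP_upper[OF _ dual_norm_bdd]) simp

lemma dot_le_dual_norm: "dot v x \<le> dual_norm v * N x"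
proof (cases "N x = 0")
  case True
  then have "dot v x = 0" using N_eq_0[OF True] by (simp add: dot_def)
  with True show ?thesis by simp
next
  case False
  then have Nx: "0 < N x" using N_nonneg[of x] by simp
  have "dot v (\<lambda>k. 1 / N x * x k) \<le> dual_norm v"
    by (rule dot_le_dual_norm1) (use Nx N_scale[of "1 / N x" x] in simp)
  then have "dot v x / N x \<le> dual_norm v" using dot_scale(1)[of v "1 / N x" x] by simp
  then show ?thesis using Nx by (simp add: field_simps)
qed

lemma unit_ball_nonempty: "{x. N x \<le> 1} \<noteq> {}"
  using N_zero by (metis empty_iff mem_Collect_eq zero_le_one)

lemma dual_norm_le: "(\<And>x. N x \<le> 1 \<Longrightarrow> dot v x \<le> b) \<Longrightarrow> dual_norm v \<le> b"
  unfolding dual_norm_def by (rule cSUP_least[OF unit_ball_nonempty]) simp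

lemma dual_norm_nonneg: "0 \<le> dual_norm v"
  using dot_le_dual_norm1[of "\<lambda>k. 0" v] by (simp add: N_zero dot_def)

lemma dual_norm_approx:
  obtains x where "N x \<le> 1" "dual_norm v \<le> 2 * dot v x"
proof (cases "dual_norm v = 0")
  case True
  then show ?thesis using that[of "\<lambda>k. 0"] by (simp add: N_zero dot_def)
next
  case False
  then have "dual_norm v / 2 < dual_norm v" using dual_norm_nonneg[of v] by simp
  then obtain x where "N x \<le> 1" "dual_norm v / 2 < dot v x"
    unfolding dual_norm_def using less_cSUP_iff[OF unit_ball_nonempty dual_norm_bdd] by blast
  then show ?thesis using that[of x] by simp
qed

lemma seminorm_dual_norm: "seminorm_fun dual_norm"
proof
  show "dual_norm (\<lambda>k. v k + w k) \<le> dual_norm v + dual_norm w" for v w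
    by (rule dual_norm_le) (simp add: dot_add add_mono dot_le_dual_norm1)
  have scale: "dual_norm (\<lambda>k. c * v k) \<le> \<bar>c\<bar> * dual_norm v" for c v
  proof (rule dual_norm_le)
    fix x assume x: "N x \<le> 1"
    define \<sigma> where "\<sigma> = (if c < 0 then -1 else 1 :: real)"
    have "dot (\<lambda>k. c * v k) x = \<bar>c\<bar> * dot v (\<lambda>k. \<sigma> * x k)"
      unfolding dot_scale by (simp add: \<sigma>_def)
    also have "\<dots> \<le> \<bar>c\<bar> * dual_norm v"
      using x by (intro mult_left_mono dot_le_dual_norm1) (simp_all add: N_scale \<sigma>_def)
    finally show "dot (\<lambda>k. c * v k) x \<le> \<bar>c\<bar> * dual_norm v" .
  qed
  show "dual_norm (\<lambda>k. c * v k) = \<bar>c\<bar> * dual_norm v" for c v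
  proof (cases "c = 0")
    case True
    then show ?thesis using scale[of 0 v] dual_norm_nonneg[of "\<lambda>k. 0 * v k"] by simp
  next
    case False
    have "dual_norm v \<le> \<bar>1 / c\<bar> * dual_norm (\<lambda>k. c * v k)"
      using scale[of "1 / c" "\<lambda>k. c * v k"] False by simp
    then show ?thesis using scale[of c v] False by (simp add: field_simps)
  qed
qed

text \<open>\<open>mrad U\<close> is the Rademacher norm of the columns of \<open>U\<close>, without the normalisation \<open>2\<^sup>-\<^sup>d\<^sup>/\<^sup>2\<close>.\<close>

definition mrad :: "(nat \<Rightarrow> nat \<Rightarrow> real) \<Rightarrow> real" where
  "mrad U = cube_norm N d (\<lambda>t k. \<Sum>i<d. t i * U k i)"

lemma mrad_add: "mrad (\<lambda>k i. U k i + W k i) \<le> mrad U + mrad W"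
  unfolding mrad_def using Lnorm_add[of d "\<lambda>t k. \<Sum>i<d. t i * U k i" "\<lambda>t k. \<Sum>i<d. t i * W k i"]
  by (simp add: distrib_left sum.distrib)

lemma mrad_scale: "mrad (\<lambda>k i. c * U k i) = \<bar>c\<bar> * mrad U"
  unfolding mrad_def using Lnorm_scale[of d c "\<lambda>t k. \<Sum>i<d. t i * U k i"]
  by (simp add: sum_distrib_left mult_ac)

lemma mrad_nonneg: "0 \<le> mrad U"
  by (simp add: mrad_def Lnorm_nonneg)

lemma mrad_cong: "(\<And>k i. k < d \<Longrightarrow> i < d \<Longrightarrow> U k i = W k i) \<Longrightarrow> mrad U = mrad W"
  unfolding mrad_def cube_norm_def by (intro L2_set_cong refl N_cong sum.cong) auto

lemma column_le_mrad:
  assumes i: "i < d"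
  shows "N (\<lambda>k. U k i) \<le> mrad U"
proof -
  define f where "f t k = (\<Sum>j<d. t j * U k j)" for t k
  have sum_t: "(\<Sum>t\<in>signs d. t i * t j) = (if j = i then 2 ^ d else 0)" if "j < d" for j
  proof (cases "j = i")
    case True
    then have "(\<Sum>t\<in>signs d. t i * t j) = (\<Sum>t\<in>signs d. 1)"
      using signs_cases[of _ d i] i by (intro sum.cong) force+
    then show ?thesis using True by (simp add: card_signs)
  next
    case False
    let ?F = "\<lambda>t :: nat \<Rightarrow> real. t(i := - t i)"
    have bij: "bij_betw ?F (signs d) (signs d)"
      by (rule bij_betwI[where g = ?F])
        (use i in \<open>auto simp: signs_def PiE_def Pi_def extensional_def fun_eq_iff\<close>)
    have "(\<Sum>t\<in>signs d. t i * t j) = (\<Sum>t\<in>signs d. ?F t i * ?F t j)"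
      using sum.reindex_bij_betw[OF bij, of "\<lambda>t. t i * t j"] by simp
    also have "\<dots> = - (\<Sum>t\<in>signs d. t i * t j)" using False by (simp add: sum_negf)
    finally show ?thesis using False by simp
  qed
  have "(\<Sum>t\<in>signs d. t i * f t k) = 2 ^ d * U k i" for k
  proof -
    have "(\<Sum>t\<in>signs d. t i * f t k) = (\<Sum>j<d. (\<Sum>t\<in>signs d. t i * t j) * U k j)"
      unfolding f_def sum_distrib_left sum_distrib_right by (subst sum.swap) (simp add: mult_ac)
    also have "\<dots> = (\<Sum>j<d. if j = i then 2 ^ d * U k j else 0)"
      by (intro sum.cong refl) (simp add: sum_t)
    finally show ?thesis using i by simp
  qed
  then have "2 ^ d * N (\<lambda>k. U k i) = N (\<lambda>k. \<Sum>t\<in>signs d. t i * f t k)"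
    using N_scale[of "2 ^ d" "\<lambda>k. U k i"] by simp
  also have "\<dots> \<le> (\<Sum>t\<in>signs d. \<bar>t i\<bar> * N (f t))" by (rule N_sum_scale)
  also have "\<dots> \<le> (\<Sum>t\<in>signs d. mrad U)"
  proof (rule sum_mono)
    fix t assume t: "t \<in> signs d"
    have "N (f t) \<le> mrad U"
      unfolding mrad_def cube_norm_def f_def by (rule member_le_L2_set[OF finite_signs t])
    moreover have "\<bar>t i\<bar> = 1" using signs_cases[OF t i] by auto
    ultimately show "\<bar>t i\<bar> * N (f t) \<le> mrad U" by simp
  qed
  finally show ?thesis by (simp add: card_signs)
qed

lemma continuous_on_entry: "continuous_on S (\<lambda>U :: nat \<Rightarrow> nat \<Rightarrow> real. U i j)"
proof -
  have "continuous_on S (\<lambda>U :: nat \<Rightarrow> nat \<Rightarrow> real. U i)"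
    by (rule continuous_on_subset[OF continuous_on_product_coordinates]) simp
  then show ?thesis by (rule continuous_on_product_then_coordinatewise)
qed

abbreviation matf :: "(nat \<Rightarrow> nat \<Rightarrow> real) \<Rightarrow> real mat" where
  "matf U \<equiv> mat d d (\<lambda>(i, j). U i j)"

lemma continuous_on_det_matf: "continuous_on S (\<lambda>U :: nat \<Rightarrow> nat \<Rightarrow> real. det (matf U))"
proof -
  have "det (matf U) = (\<Sum>p\<in>{p. p permutes {0..<d}}. signof p * (\<Prod>i = 0..<d. U i (p i)))" for U
    by (subst det_def') (auto intro!: sum.cong prod.cong simp: permutes_in_image)
  then show ?thesis by (simp only:) (intro continuous_on_sum continuous_on_mult continuous_on_const continuous_on_prod continuous_on_entry)
qed

lemma continuous_on_mrad: "continuous_on S mrad"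
proof -
  have "continuous_on S (\<lambda>U :: nat \<Rightarrow> nat \<Rightarrow> real. N (\<lambda>k. \<Sum>i<d. t i * U k i))" for t
    by (intro continuous_on_N continuous_on_sum continuous_on_mult continuous_on_const continuous_on_entry)
  then have "continuous_on S (\<lambda>U. sqrt (\<Sum>t\<in>signs d. (N (\<lambda>k. \<Sum>i<d. t i * U k i))\<^sup>2))"
    by (intro continuous_on_real_sqrt continuous_on_sum continuous_on_power)
  then show ?thesis by (simp add: mrad_def[abs_def] cube_norm_def L2_set_def)
qed

text \<open>A matrix of largest determinant in the unit ball of \<open>mrad\<close> exists by compactness.\<close>

lemma maximal_det:
  assumes s: "0 < s"
  obtains U where "det (matf U) \<noteq> 0" "mrad U \<le> s"
    "\<And>W. \<bar>det (matf W)\<bar> * s ^ d \<le> \<bar>det (matf U)\<bar> * mrad W ^ d"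
proof -
  define bx where "bx = (PiE UNIV (\<lambda>k. PiE UNIV (\<lambda>i. if k < d \<and> i < d then {- (R * s)..R * s} else {0::real})))"
  have cpt1: "compact (PiE UNIV T)" if "\<And>i. compact (T i)" for T :: "nat \<Rightarrow> 'b::topological_space set"
    using compactin_PiE[of "\<lambda>_. euclidean" UNIV T] that by (simp add: euclidean_product_topology)
  have "compact bx" unfolding bx_def by (intro cpt1) auto
  define Fs where "Fs = bx \<inter> {U. mrad U \<le> s}"
  have "closed {U. mrad U \<le> s}"
    by (intro closed_Collect_le continuous_on_mrad continuous_on_const)
  then have cpt: "compact Fs" unfolding Fs_def using \<open>compact bx\<close> by (rule compact_Int_closed[rotated])
  have trunc: "(\<lambda>k i. if k < d \<and> i < d then W k i else 0) \<in> Fs" if "mrad W \<le> s" for W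
  proof -
    have "\<bar>W k i\<bar> \<le> R * s" if "k < d" "i < d" for k i
    proof -
      have "\<bar>W k i\<bar> \<le> R * N (\<lambda>k. W k i)" using N_lower[of k "\<lambda>k. W k i"] that by simp
      also have "\<dots> \<le> R * s"
        using column_le_mrad[OF that(2), of W] \<open>mrad W \<le> s\<close> R_pos by (intro mult_left_mono) auto
      finally show ?thesis .
    qed
    then have "(\<lambda>k i. if k < d \<and> i < d then W k i else 0) \<in> bx"
      by (auto simp: bx_def abs_le_iff minus_le_iff)
    moreover have "mrad (\<lambda>k i. if k < d \<and> i < d then W k i else 0) = mrad W"
      by (rule mrad_cong) auto
    ultimately show ?thesis using that by (simp add: Fs_def)
  qed
  have "Fs \<noteq> {}" using trunc[of "\<lambda>k i. 0"] s mrad_scale[of 0 "\<lambda>k i. 0"] by auto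
  moreover have "continuous_on Fs (\<lambda>U. \<bar>det (matf U)\<bar>)"
    by (intro continuous_on_rabs continuous_on_det_matf)
  ultimately obtain U where U: "U \<in> Fs" "\<And>W. W \<in> Fs \<Longrightarrow> \<bar>det (matf W)\<bar> \<le> \<bar>det (matf U)\<bar>"
    using continuous_attains_sup[OF cpt] by blast
  have max: "\<bar>det (matf W)\<bar> \<le> \<bar>det (matf U)\<bar>" if "mrad W \<le> s" for W
  proof -
    have "matf (\<lambda>k i. if k < d \<and> i < d then W k i else 0) = matf W" by (rule eq_matI) auto
    then show ?thesis using U(2)[OF trunc[OF that]] by simp
  qed
  have scale: "\<bar>det (matf (\<lambda>k i. c * W k i))\<bar> = \<bar>c\<bar> ^ d * \<bar>det (matf W)\<bar>" for c W
  proof -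
    have "matf (\<lambda>k i. c * W k i) = c \<cdot>\<^sub>m matf W" by (rule eq_matI) auto
    then show ?thesis by (simp add: abs_mult power_abs)
  qed
  have scaled: "\<bar>det (matf W)\<bar> * s ^ d \<le> \<bar>det (matf U)\<bar> * mrad W ^ d" if "0 < mrad W" for W
  proof -
    have "mrad (\<lambda>k i. s / mrad W * W k i) = s" using that s by (simp only: mrad_scale) simp
    then have "\<bar>det (matf (\<lambda>k i. s / mrad W * W k i))\<bar> \<le> \<bar>det (matf U)\<bar>" by (intro max) simp
    then have "(s / mrad W) ^ d * \<bar>det (matf W)\<bar> \<le> \<bar>det (matf U)\<bar>" using that s by (simp only: scale) simp
    then show ?thesis using that by (simp add: power_divide field_simps)
  qed
  show ?thesis
  proof (rule that)
    show "mrad U \<le> s" using U(1) by (simp add: Fs_def)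
    show "\<bar>det (matf W)\<bar> * s ^ d \<le> \<bar>det (matf U)\<bar> * mrad W ^ d" for W
    proof (cases "mrad W = 0")
      case True
      have "W k i = 0" if "k < d" "i < d" for k i
      proof -
        have "N (\<lambda>k. W k i) = 0" using column_le_mrad[OF that(2), of W] True N_nonneg[of "\<lambda>k. W k i"] by simp
        then show ?thesis using N_eq_0[of "\<lambda>k. W k i" k] that by simp
      qed
      then have "matf W = matf (\<lambda>k i. 0 * W k i)" by (intro eq_matI) auto
      then have "\<bar>det (matf W)\<bar> = 0 ^ d * \<bar>det (matf W)\<bar>" using scale[of 0 W] by simp
      then show ?thesis using True max[of W] s by (cases "d = 0") (auto simp: power_0_left)
    next
      case False
      then show ?thesis using scaled mrad_nonneg[of W] by simp
    qed
    show "det (matf U) \<noteq> 0"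
    proof
      assume 0: "det (matf U) = 0"
      let ?I = "\<lambda>k i. if k = i then 1 else (0::real)"
      have "matf ?I = 1\<^sub>m d" by (rule eq_matI) auto
      then have dI: "det (matf ?I) = 1" by simp
      show False
      proof (cases "mrad ?I = 0")
        case True
        then show False using max[of ?I] 0 dI s by simp
      next
        case False
        then have "s ^ d \<le> 0" using scaled[of ?I] mrad_nonneg[of ?I] 0 dI by simp
        then show False using zero_less_power[OF s, of d] by linarith
      qed
    qed
  qed
qed

end

text \<open>Only the identity permutation contributes: the others have two factors vanishing at \<open>0\<close>.\<close>

lemma det_derivative_trace:
  assumes A: "A \<in> carrier_mat n n"
  shows "((\<lambda>t. det (1\<^sub>m n + t \<cdot>\<^sub>m A)) has_real_derivative (\<Sum>i<n. A $$ (i, i))) (at 0)"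
proof -
  let ?f = "\<lambda>p i t. (if i = p i then 1 else 0) + t * A $$ (i, p i)"
  have det: "det (1\<^sub>m n + t \<cdot>\<^sub>m A) = (\<Sum>p\<in>{p. p permutes {0..<n}}. signof p * (\<Prod>i = 0..<n. ?f p i t))" for t
    using A by (subst det_def'[of _ n]) (auto intro!: sum.cong prod.cong simp: permutes_in_image)
  have deriv: "((\<lambda>t. \<Prod>i = 0..<n. ?f p i t) has_real_derivative
      (\<Sum>i = 0..<n. A $$ (i, p i) * (\<Prod>j\<in>{0..<n} - {i}. ?f p j 0))) (at 0)" for p
    by (rule has_field_derivative_prod) (auto intro!: derivative_eq_intros)
  have "((\<lambda>t. det (1\<^sub>m n + t \<cdot>\<^sub>m A)) has_real_derivative
      (\<Sum>p\<in>{p. p permutes {0..<n}}. signof p * (\<Sum>i = 0..<n. A $$ (i, p i) * (\<Prod>j\<in>{0..<n} - {i}. ?f p j 0)))) (at 0)"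
    unfolding det by (intro DERIV_sum DERIV_cmult deriv)
  also have "(\<Sum>p\<in>{p. p permutes {0..<n}}. signof p * (\<Sum>i = 0..<n. A $$ (i, p i) * (\<Prod>j\<in>{0..<n} - {i}. ?f p j 0)))
      = (\<Sum>p\<in>{id}. signof p * (\<Sum>i = 0..<n. A $$ (i, p i) * (\<Prod>j\<in>{0..<n} - {i}. ?f p j 0)))"
  proof (rule sum.mono_neutral_right)
    show "\<forall>p\<in>{p. p permutes {0..<n}} - {id}. signof p * (\<Sum>i = 0..<n. A $$ (i, p i) * (\<Prod>j\<in>{0..<n} - {i}. ?f p j 0)) = 0"
    proof
      fix p assume p: "p \<in> {p. p permutes {0..<n}} - {id}"
      have "(\<Prod>j\<in>{0..<n} - {i}. ?f p j 0) = 0" for i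
      proof -
        obtain j where "j \<in> {0..<n}" "j \<noteq> i" "p j \<noteq> j"
          using permutes_fix_all_but_one[of p "{0..<n}" i] p by auto
        then show ?thesis by (intro prod_zero bexI[of _ j]) auto
      qed
      then show "signof p * (\<Sum>i = 0..<n. A $$ (i, p i) * (\<Prod>j\<in>{0..<n} - {i}. ?f p j 0)) = 0"
        by (simp only: mult_zero_right sum.neutral_const)
    qed
  qed (auto simp: finite_permutations permutes_id)
  also have "\<dots> = (\<Sum>i<n. A $$ (i, i))" by (simp add: sign_id lessThan_atLeast0)
  finally show ?thesis .
qed

context norm_fun
begin

text \<open>
  Lewis' theorem. If \<open>U\<close> maximises the determinant, then \<open>det (1 + t V W) \<le> (1 + t mrad W / s)\<^sup>d\<close> for
  all \<open>t \<ge> 0\<close>, where \<open>V\<close> is the inverse of \<open>U\<close>. Both sides are \<open>1\<close> at \<open>t = 0\<close>, and comparing the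
  derivatives bounds the trace of \<open>V W\<close>.
\<close>

lemma lewis_position:
  assumes s: "0 < s"
  obtains U V where "U \<in> carrier_mat d d" "V \<in> carrier_mat d d" "V * U = 1\<^sub>m d"
    "mrad (\<lambda>k i. U $$ (k, i)) \<le> s"
    "\<And>W. (\<Sum>i<d. \<Sum>k<d. V $$ (i, k) * W k i) \<le> d * mrad W / s"
proof -
  obtain U0 where U0: "det (matf U0) \<noteq> 0" "mrad U0 \<le> s"
    "\<And>W. \<bar>det (matf W)\<bar> * s ^ d \<le> \<bar>det (matf U0)\<bar> * mrad W ^ d"
    using maximal_det[OF s] by blast
  define U where "U = matf U0"
  have U: "U \<in> carrier_mat d d" "det U \<noteq> 0" using U0 by (auto simp: U_def)
  obtain V where V: "V \<in> carrier_mat d d" "V * U = 1\<^sub>m d" "U * V = 1\<^sub>m d"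
    using det_non_zero_imp_unit[OF U, of "()"] by (auto simp: Units_def ring_mat_def)
  have radU: "mrad (\<lambda>k i. U $$ (k, i)) = mrad U0" by (rule mrad_cong) (simp add: U_def)
  show ?thesis
  proof (rule that[OF U(1) V(1,2)])
    show "mrad (\<lambda>k i. U $$ (k, i)) \<le> s" using U0(2) radU by simp
    fix W
    define A where "A = V * matf W"
    have A: "A \<in> carrier_mat d d" using V by (simp add: A_def)
    have tr: "(\<Sum>i<d. A $$ (i, i)) = (\<Sum>i<d. \<Sum>k<d. V $$ (i, k) * W k i)"
      unfolding A_def using V
      by (intro sum.cong refl) (simp add: mat_mult_entry[of _ d] del: index_mult_mat)
    define g where "g t = (1 + t * (mrad W / s)) ^ d - det (1\<^sub>m d + t \<cdot>\<^sub>m A)" for t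
    have g0: "g 0 = 0"
    proof -
      have "1\<^sub>m d + 0 \<cdot>\<^sub>m A = 1\<^sub>m d" using A by (intro eq_matI) auto
      then show ?thesis by (simp add: g_def)
    qed
    have gpos: "0 \<le> g t" if t: "0 \<le> t" for t
    proof -
      have "U * (1\<^sub>m d + t \<cdot>\<^sub>m A) = U + t \<cdot>\<^sub>m (U * A)"
        using U A by (simp add: mult_add_distrib_mat[of _ d d _ d] mult_smult_distrib[of _ d d _ d])
      also have "U * A = matf W"
        unfolding A_def using U V by (simp add: assoc_mult_mat[symmetric, of U d d V d _ d])
      finally have UA: "U * (1\<^sub>m d + t \<cdot>\<^sub>m A) = matf (\<lambda>k i. U $$ (k, i) + t * W k i)"
        using U by (auto intro!: eq_matI)
      have "\<bar>det U\<bar> * \<bar>det (1\<^sub>m d + t \<cdot>\<^sub>m A)\<bar> * s ^ d = \<bar>det (matf (\<lambda>k i. U $$ (k, i) + t * W k i))\<bar> * s ^ d"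
        unfolding UA[symmetric] using U A by (simp add: det_mult[of _ d] abs_mult)
      also have "\<dots> \<le> \<bar>det U\<bar> * mrad (\<lambda>k i. U $$ (k, i) + t * W k i) ^ d"
        using U0(3) by (simp add: U_def)
      also have "\<dots> \<le> \<bar>det U\<bar> * (s + t * mrad W) ^ d"
      proof (intro mult_left_mono power_mono mrad_nonneg)
        have "mrad (\<lambda>k i. U $$ (k, i) + t * W k i) \<le> mrad (\<lambda>k i. U $$ (k, i)) + \<bar>t\<bar> * mrad W"
          using mrad_add[of "\<lambda>k i. U $$ (k, i)" "\<lambda>k i. t * W k i"] by (simp add: mrad_scale)
        then show "mrad (\<lambda>k i. U $$ (k, i) + t * W k i) \<le> s + t * mrad W"
          using U0(2) radU t by simp
      qed simp
      also have "s + t * mrad W = s * (1 + t * (mrad W / s))" using s by (simp add: field_simps)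
      finally have "\<bar>det U\<bar> * s ^ d * \<bar>det (1\<^sub>m d + t \<cdot>\<^sub>m A)\<bar> \<le> \<bar>det U\<bar> * s ^ d * (1 + t * (mrad W / s)) ^ d"
        by (simp add: power_mult_distrib mult_ac)
      then have "\<bar>det (1\<^sub>m d + t \<cdot>\<^sub>m A)\<bar> \<le> (1 + t * (mrad W / s)) ^ d"
        by (rule mult_left_le_imp_le) (use U s in simp)
      then show ?thesis by (simp add: g_def)
    qed
    have "(g has_real_derivative (d * (mrad W / s) - (\<Sum>i<d. A $$ (i, i)))) (at 0)"
      unfolding g_def
      by (rule DERIV_diff[OF _ det_derivative_trace[OF A]]) (use s in \<open>auto intro!: derivative_eq_intros\<close>)
    then have "\<not> d * (mrad W / s) - (\<Sum>i<d. A $$ (i, i)) < 0"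
    proof (intro notI)
      assume "(g has_real_derivative (d * (mrad W / s) - (\<Sum>i<d. A $$ (i, i)))) (at 0)"
        "d * (mrad W / s) - (\<Sum>i<d. A $$ (i, i)) < 0"
      from DERIV_neg_dec_right[OF this] obtain e where e: "0 < e" "\<And>h. 0 < h \<Longrightarrow> h < e \<Longrightarrow> g (0 + h) < g 0"
        by blast
      from e(2)[of "e / 2"] e(1) gpos[of "e / 2"] g0 show False by simp
    qed
    then show "(\<Sum>i<d. \<Sum>k<d. V $$ (i, k) * W k i) \<le> d * mrad W / s" by (simp add: tr)
  qed
qed

text \<open>
  \<open>K\<close>-convexity turns the trace bound of Lewis' theorem into a bound on the Rademacher average
  of the dual basis in the dual norm: pair the average with a function \<open>f\<close> that almost norms it,
  and note that the pairing sees only the Rademacher projection of \<open>f\<close>.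
\<close>

lemma dual_position:
  fixes A s :: real
  assumes Kconv: "\<And>f. cube_norm N d (\<lambda>t k. \<Sum>i<d. t i * ((\<Sum>s\<in>signs d. s i * f s k) / 2 ^ d)) \<le> A * cube_norm N d f"
    and V: "V \<in> carrier_mat d d" and s: "0 < s" and s2: "s\<^sup>2 = 2 ^ d" and A: "0 \<le> A"
    and tr: "\<And>W. (\<Sum>i<d. \<Sum>k<d. V $$ (i, k) * W k i) \<le> d * mrad W / s"
  shows "cube_norm dual_norm d (\<lambda>t k. \<Sum>i<d. t i * V $$ (i, k)) \<le> 2 * d * A * s"
proof -
  define v where "v t k = (\<Sum>i<d. t i * V $$ (i, k))" for t k
  define H where "H = cube_norm dual_norm d v"
  have H0: "0 \<le> H" by (simp add: H_def cube_norm_def L2_set_nonneg)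
  obtain y where y: "\<And>t. N (y t) \<le> 1" "\<And>t. dual_norm (v t) \<le> 2 * dot (v t) (y t)"
  proof -
    have "\<forall>t. \<exists>x. N x \<le> 1 \<and> dual_norm (v t) \<le> 2 * dot (v t) x" using dual_norm_approx by metis
    then show ?thesis using that by metis
  qed
  define f where "f t k = dual_norm (v t) * y t k" for t k
  define W where "W k i = (\<Sum>t\<in>signs d. t i * f t k) / 2 ^ d" for k i
  have "cube_norm N d f \<le> H"
    unfolding H_def cube_norm_def
  proof (rule L2_set_mono)
    fix t
    have "dual_norm (v t) * N (y t) \<le> dual_norm (v t) * 1" by (intro mult_left_mono y dual_norm_nonneg)
    then show "N (f t) \<le> dual_norm (v t)" by (simp add: f_def[abs_def] N_scale dual_norm_nonneg)
  qed (rule N_nonneg)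
  moreover have "mrad W \<le> A * cube_norm N d f"
    using Kconv[of f] by (simp add: mrad_def W_def)
  ultimately have radW: "mrad W \<le> A * H" using A by (meson mult_left_mono order_trans)
  have "H\<^sup>2 = (\<Sum>t\<in>signs d. (dual_norm (v t))\<^sup>2)" by (simp add: H_def cube_norm_sq)
  also have "\<dots> \<le> (\<Sum>t\<in>signs d. 2 * dot (v t) (f t))"
  proof (rule sum_mono)
    fix t
    have "dual_norm (v t) * dual_norm (v t) \<le> dual_norm (v t) * (2 * dot (v t) (y t))"
      by (intro mult_left_mono y dual_norm_nonneg)
    then show "(dual_norm (v t))\<^sup>2 \<le> 2 * dot (v t) (f t)"
      unfolding f_def[abs_def] dot_scale by (simp add: power2_eq_square mult_ac)
  qed
  also have "\<dots> = 2 * 2 ^ d * (\<Sum>i<d. \<Sum>k<d. V $$ (i, k) * W k i)"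
  proof -
    have "(\<Sum>t\<in>signs d. dot (v t) (f t)) = (\<Sum>t\<in>signs d. \<Sum>k<d. \<Sum>i<d. V $$ (i, k) * (t i * f t k))"
      unfolding dot_def v_def sum_distrib_right by (intro sum.cong refl) (simp add: mult_ac)
    also have "\<dots> = (\<Sum>k<d. \<Sum>t\<in>signs d. \<Sum>i<d. V $$ (i, k) * (t i * f t k))" by (rule sum.swap)
    also have "\<dots> = (\<Sum>k<d. \<Sum>i<d. \<Sum>t\<in>signs d. V $$ (i, k) * (t i * f t k))"
      by (intro sum.cong refl sum.swap)
    also have "\<dots> = (\<Sum>i<d. \<Sum>k<d. \<Sum>t\<in>signs d. V $$ (i, k) * (t i * f t k))" by (rule sum.swap)
    also have "\<dots> = (\<Sum>i<d. \<Sum>k<d. 2 ^ d * (V $$ (i, k) * W k i))"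
      by (intro sum.cong refl) (simp add: W_def flip: sum_distrib_left)
    finally show ?thesis by (simp add: mult.assoc flip: sum_distrib_left)
  qed
  also have "\<dots> \<le> 2 * 2 ^ d * (d * mrad W / s)" by (intro mult_left_mono tr) simp
  also have "\<dots> \<le> 2 * 2 ^ d * (d * (A * H) / s)"
    using s by (intro mult_left_mono divide_right_mono radW) auto
  also have "\<dots> = 2 * d * A * s * H"
    using s by (simp add: s2[symmetric] power2_eq_square)
  finally have "H * H \<le> 2 * d * A * s * H" by (simp add: power2_eq_square)
  then have "H \<le> 2 * d * A * s"
    using H0 A s by (cases "H = 0") auto
  then show ?thesis by (simp add: H_def v_def[abs_def])
qed

end

section \<open>Volume of the unit ball from Rademacher averages\<close>

text \<open>A point of the cube \<open>[-1, 1]\<^sup>d\<close> is the barycentre of the vertices with these weights.\<close>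

definition vweight :: "nat \<Rightarrow> (nat \<Rightarrow> real) \<Rightarrow> (nat \<Rightarrow> real) \<Rightarrow> real" where
  "vweight d t s = (\<Prod>i<d. (1 + t i * s i) / 2)"

definition cube :: "nat \<Rightarrow> (nat \<Rightarrow> real) set" where
  "cube d = {..<d} \<rightarrow>\<^sub>E {-1..1}"

lemma sum_signs_prod:
  "(\<Sum>t\<in>signs d. \<Prod>i<d. g i (t i)) = (\<Prod>i<d. g i (-1) + (g i 1 :: real))"
  using prod_sum_PiE[of "{..<d}" "\<lambda>_. {-1, 1}" g] by (simp add: signs_def)

lemma sum_vweight_coord:
  assumes j: "j < d"
  shows "(\<Sum>t\<in>signs d. vweight d t s * t j) = s j"
proof -
  let ?g = "\<lambda>i \<tau>. (1 + \<tau> * s i) / 2 * (if i = j then \<tau> else 1)"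
  have "vweight d t s * t j = (\<Prod>i<d. ?g i (t i))" for t
    unfolding vweight_def prod.distrib using j by simp
  then have "(\<Sum>t\<in>signs d. vweight d t s * t j) = (\<Prod>i<d. ?g i (-1) + ?g i 1)"
    using sum_signs_prod[where d = d and g = ?g] by simp
  also have "\<dots> = (\<Prod>i<d. if i = j then s j else 1)"
    by (rule prod.cong) (auto simp: field_simps)
  finally show ?thesis using j by simp
qed

lemma vweight_nonneg:
  assumes "t \<in> signs d" "s \<in> cube d"
  shows "0 \<le> vweight d t s"
  unfolding vweight_def
proof (rule prod_nonneg)
  fix i assume "i \<in> {..<d}"
  then have "s i \<in> {-1..1}" "t i = 1 \<or> t i = -1"
    using assms signs_cases[OF assms(1)] by (auto simp: cube_def)
  then show "0 \<le> (1 + t i * s i) / 2" by auto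
qed

lemma cube_sets [measurable]: "cube d \<in> sets (lebm d)"
  unfolding cube_def by (intro sets_PiM_I_finite) auto

lemma emeasure_cube: "emeasure (lebm d) (cube d) = 2 ^ d"
proof -
  have "emeasure (lebm d) (cube d) = (\<Prod>i<d. emeasure lborel {-1..1::real})"
    unfolding cube_def by (rule lebm.emeasure_PiM) auto
  also have "\<dots> = 2 ^ d" by (simp add: ennreal_numeral[symmetric] del: ennreal_numeral)
  finally show ?thesis .
qed

lemma nn_integral_vweight:
  assumes t: "t \<in> signs d"
  shows "(\<integral>\<^sup>+s. ennreal (vweight d t s) * indicator (cube d) s \<partial>lebm d) = 1"
proof -
  let ?f = "\<lambda>i x. ennreal ((1 + t i * x) / 2) * indicator {-1..1} (x::real)"
  have eq: "ennreal (vweight d t s) * indicator (cube d) s = (\<Prod>i<d. ?f i (s i))" if sp: "s \<in> space (lebm d)" for s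
  proof (cases "s \<in> cube d")
    case True
    have in1: "-1 \<le> s i \<and> s i \<le> 1" if "i < d" for i
      using PiE_mem[of s "{..<d}" "\<lambda>_. {-1..1}" i] True that by (simp add: cube_def)
    have "ennreal (vweight d t s) = (\<Prod>i<d. ennreal ((1 + t i * s i) / 2))"
      unfolding vweight_def
    proof (rule prod_ennreal[symmetric])
      fix i assume "i \<in> {..<d}"
      then show "0 \<le> (1 + t i * s i) / 2" using in1[of i] signs_cases[OF t, of i] by auto
    qed
    also have "\<dots> = (\<Prod>i<d. ?f i (s i))" using in1 by (intro prod.cong) auto
    finally show ?thesis using True by simp
  next
    case False
    then obtain i where "i < d" "s i \<notin> {-1..1}"
      using sp by (auto simp: cube_def space_PiM PiE_iff)
    then have "(\<Prod>i<d. ?f i (s i)) = 0" by (intro prod_zero bexI[of _ i]) auto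
    then show ?thesis using False by simp
  qed
  have "(\<integral>\<^sup>+s. ennreal (vweight d t s) * indicator (cube d) s \<partial>lebm d) = (\<integral>\<^sup>+s. (\<Prod>i<d. ?f i (s i)) \<partial>lebm d)"
    by (rule nn_integral_cong) (rule eq)
  also have "\<dots> = (\<Prod>i<d. \<integral>\<^sup>+x. ?f i x \<partial>lborel)"
    by (rule lebm.product_nn_integral_prod) auto
  also have "\<dots> = (\<Prod>i<d. 1)"
  proof (rule prod.cong)
    fix i assume "i \<in> {..<d}"
    then have ti: "t i = 1 \<or> t i = -1" using signs_cases[OF t] by auto
    let ?F = "\<lambda>x. (x + t i * x\<^sup>2 / 2) / 2"
    have "(\<integral>\<^sup>+x. ?f i x \<partial>lborel) = ennreal (?F 1 - ?F (-1))"
      by (rule nn_integral_FTC_Icc) (use ti in \<open>auto intro!: derivative_eq_intros\<close>)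
    moreover have "?F 1 - ?F (-1) = 1" by (rule disjE[OF ti]) simp_all
    ultimately show "(\<integral>\<^sup>+x. ?f i x \<partial>lborel) = 1" by (simp only: ennreal_1)
  qed simp
  finally show ?thesis by simp
qed

text \<open>
  A norm averaged over the vertices dominates its average over the solid cube, so at least half of
  the cube is mapped by \<open>A\<close> into a multiple of the unit ball.
\<close>

lemma emeasure_ball_ge:
  assumes M: "seminorm_fun M" and A: "A \<in> carrier_mat d d" "det A \<noteq> 0"
    and avg: "cube_norm M d (\<lambda>t k. \<Sum>i<d. t i * c i k) \<le> \<tau> * s" and s: "0 < s" "s\<^sup>2 = 2 ^ d" and \<tau>: "0 < \<tau>"
    and S: "S \<in> sets (lebm d)"
    and sub: "\<And>x. x \<in> rspace d \<Longrightarrow> M (\<lambda>k. \<Sum>i<d. x i * c i k) \<le> 2 * \<tau> \<Longrightarrow> lin d A x \<in> S"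
  shows "emeasure (lebm d) S \<ge> ennreal (\<bar>det A\<bar> * 2 ^ d / 2)"
proof -
  interpret M: seminorm_fun M by (rule M)
  define a where "a t = M (\<lambda>k. \<Sum>i<d. t i * c i k)" for t
  define G where "G s = (\<Sum>t\<in>signs d. vweight d t s * a t)" for s
  have a0: "0 \<le> a t" for t by (simp add: a_def M.N_nonneg)
  have aG: "a s \<le> G s" if s: "s \<in> cube d" for s
  proof -
    have "(\<Sum>i<d. s i * c i k) = (\<Sum>t\<in>signs d. vweight d t s * (\<Sum>i<d. t i * c i k))" for k
    proof -
      have "(\<Sum>t\<in>signs d. vweight d t s * (\<Sum>i<d. t i * c i k))
          = (\<Sum>i<d. (\<Sum>t\<in>signs d. vweight d t s * t i) * c i k)"
        unfolding sum_distrib_left sum_distrib_right by (subst sum.swap) (simp add: mult_ac)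
      also have "\<dots> = (\<Sum>i<d. s i * c i k)"
        by (intro sum.cong refl) (simp add: sum_vweight_coord)
      finally show ?thesis by simp
    qed
    then have "a s = M (\<lambda>k. \<Sum>t\<in>signs d. vweight d t s * (\<Sum>i<d. t i * c i k))" by (simp add: a_def)
    also have "\<dots> \<le> (\<Sum>t\<in>signs d. \<bar>vweight d t s\<bar> * a t)" unfolding a_def by (rule M.N_sum_scale)
    also have "\<dots> = G s" unfolding G_def by (intro sum.cong refl) (simp add: vweight_nonneg s)
    finally show ?thesis .
  qed
  have Gm [measurable]: "G \<in> borel_measurable (lebm d)"
    unfolding G_def vweight_def by measurable
  have suma: "(\<Sum>t\<in>signs d. a t) \<le> \<tau> * 2 ^ d"
  proof -
    have "((\<Sum>t\<in>signs d. a t * 1))\<^sup>2 \<le> (\<Sum>t\<in>signs d. (a t)\<^sup>2) * (\<Sum>t\<in>signs d. 1\<^sup>2)"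
      by (rule Cauchy_Schwarz_ineq_sum)
    also have "\<dots> = (cube_norm M d (\<lambda>t k. \<Sum>i<d. t i * c i k))\<^sup>2 * s\<^sup>2"
      by (simp add: cube_norm_sq a_def card_signs s)
    also have "\<dots> \<le> (\<tau> * s)\<^sup>2 * s\<^sup>2"
      by (intro mult_right_mono power_mono avg) (auto simp: cube_norm_def L2_set_nonneg)
    also have "\<dots> = (\<tau> * s\<^sup>2)\<^sup>2" by (simp add: power2_eq_square)
    finally have "((\<Sum>t\<in>signs d. a t))\<^sup>2 \<le> (\<tau> * 2 ^ d)\<^sup>2" by (simp add: s(2))
    then show ?thesis by (rule power2_le_imp_le) (use \<tau> in simp)
  qed
  have intG: "(\<integral>\<^sup>+s. ennreal (G s) * indicator (cube d) s \<partial>lebm d) \<le> ennreal (\<tau> * 2 ^ d)"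
  proof -
    have "(\<integral>\<^sup>+s. ennreal (G s) * indicator (cube d) s \<partial>lebm d)
        = (\<integral>\<^sup>+s. (\<Sum>t\<in>signs d. ennreal (a t) * (ennreal (vweight d t s) * indicator (cube d) s)) \<partial>lebm d)"
    proof (rule nn_integral_cong)
      fix s show "ennreal (G s) * indicator (cube d) s
          = (\<Sum>t\<in>signs d. ennreal (a t) * (ennreal (vweight d t s) * indicator (cube d) s))"
      proof (cases "s \<in> cube d")
        case True
        have "ennreal (G s) = (\<Sum>t\<in>signs d. ennreal (vweight d t s * a t))"
          unfolding G_def by (rule sum_ennreal[symmetric]) (simp add: vweight_nonneg True a0)
        also have "\<dots> = (\<Sum>t\<in>signs d. ennreal (a t) * ennreal (vweight d t s))"
          by (intro sum.cong refl) (simp add: ennreal_mult vweight_nonneg True a0 mult.commute)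
        finally show ?thesis using True by simp
      qed simp
    qed
    also have "\<dots> = (\<Sum>t\<in>signs d. ennreal (a t) * (\<integral>\<^sup>+s. ennreal (vweight d t s) * indicator (cube d) s \<partial>lebm d))"
    proof -
      have [measurable]: "vweight d t \<in> borel_measurable (lebm d)" for t
        unfolding vweight_def by measurable
      show ?thesis by (subst nn_integral_sum) (auto simp: nn_integral_cmult)
    qed
    also have "\<dots> = ennreal (\<Sum>t\<in>signs d. a t)"
      by (simp add: nn_integral_vweight a0 sum_ennreal)
    also have "\<dots> \<le> ennreal (\<tau> * 2 ^ d)" by (rule ennreal_leI[OF suma])
    finally show ?thesis .
  qed
  define Q where "Q = {s \<in> space (lebm d). s \<in> cube d \<and> G s \<le> 2 * \<tau>}"
  define Q' where "Q' = {s \<in> space (lebm d). s \<in> cube d \<and> 2 * \<tau> < G s}"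
  have [measurable]: "Q \<in> sets (lebm d)" "Q' \<in> sets (lebm d)" unfolding Q_def Q'_def by measurable
  have "ennreal (2 * \<tau>) * emeasure (lebm d) Q' = (\<integral>\<^sup>+s. ennreal (2 * \<tau>) * indicator Q' s \<partial>lebm d)"
    by (simp add: nn_integral_cmult)
  also have "\<dots> \<le> (\<integral>\<^sup>+s. ennreal (G s) * indicator (cube d) s \<partial>lebm d)"
    by (intro nn_integral_mono) (auto simp: Q'_def indicator_def intro: ennreal_leI)
  also have "\<dots> \<le> ennreal (\<tau> * 2 ^ d)" by (rule intG)
  also have "\<dots> = ennreal (2 * \<tau>) * ennreal (2 ^ d / 2)" using \<tau> by (simp flip: ennreal_mult)
  finally have Q': "emeasure (lebm d) Q' \<le> ennreal (2 ^ d / 2)"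
    using \<tau> by (subst (asm) ennreal_mult_le_mult_iff) auto
  have "cube d = Q \<union> Q'"
    using sets.sets_into_space[OF cube_sets[of d]] by (auto simp: Q_def Q'_def)
  then have "ennreal (2 ^ d) = emeasure (lebm d) (Q \<union> Q')"
    using emeasure_cube[of d] by (simp flip: ennreal_power ennreal_numeral)
  also have "\<dots> \<le> emeasure (lebm d) Q + emeasure (lebm d) Q'" by (rule emeasure_subadditive) auto
  also have "\<dots> \<le> emeasure (lebm d) Q + ennreal (2 ^ d / 2)" by (rule add_left_mono[OF Q'])
  finally have "ennreal (2 ^ d) - ennreal (2 ^ d / 2) \<le> emeasure (lebm d) Q"
    by (simp add: ennreal_minus_le_iff add.commute)
  then have Q: "ennreal (2 ^ d / 2) \<le> emeasure (lebm d) Q"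
    by (subst (asm) ennreal_minus) auto
  have "Q \<subseteq> lin d A -` S \<inter> rspace d"
    using sub aG by (force simp: Q_def space_lebm a_def)
  then have "emeasure (lebm d) Q \<le> emeasure (lebm d) (lin d A -` S \<inter> rspace d)"
    using S by (intro emeasure_mono) (auto simp: space_lebm[symmetric])
  with Q have "ennreal \<bar>det A\<bar> * ennreal (2 ^ d / 2) \<le> ennreal \<bar>det A\<bar> * emeasure (lebm d) (lin d A -` S \<inter> rspace d)"
    by (intro mult_left_mono) auto
  then show ?thesis using emeasure_lin_vimage[OF A S] by (simp flip: ennreal_mult)
qed

context norm_fun
begin

lemma N_measurable [measurable]: "N \<in> borel_measurable (lebm d)"
proof -
  have "continuous_on UNIV N"
    by (rule continuous_on_N[of UNIV "\<lambda>x. x"]) (rule continuous_on_product_coordinates)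
  then have N: "N \<in> borel_measurable borel" by (rule borel_measurable_continuous_onI)
  have "(\<lambda>x i. if i < d then x i else 0) \<in> measurable (lebm d) (Pi\<^sub>M UNIV (\<lambda>_. borel))"
  proof (rule measurable_PiM_single')
    show "(\<lambda>x. if i < d then x i else 0) \<in> borel_measurable (lebm d)" for i
      by (cases "i < d") auto
  qed auto
  then have "(\<lambda>x i. if i < d then x i else 0) \<in> borel_measurable (lebm d)"
    using measurable_cong_sets[OF refl sets_PiM_equal_borel] by blast
  from measurable_compose[OF this N] have "(\<lambda>x. N (\<lambda>i. if i < d then x i else 0)) \<in> borel_measurable (lebm d)" .
  also have "(\<lambda>x. N (\<lambda>i. if i < d then x i else 0)) = N"
    by (intro ext N_cong) auto
  finally show ?thesis .
qed

definition nball :: "real \<Rightarrow> (nat \<Rightarrow> real) set" where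
  "nball r = {x \<in> rspace d. N x < r}"

lemma nball_sets [measurable]: "nball r \<in> sets (lebm d)"
  unfolding nball_def space_lebm[symmetric] by measurable

lemma nball_scale:
  assumes c: "0 < c"
  shows "emeasure (lebm d) (nball (c * r)) = ennreal (c ^ d) * emeasure (lebm d) (nball r)"
proof -
  let ?A = "c \<cdot>\<^sub>m 1\<^sub>m d :: real mat"
  have "lin d ?A x i = c * x i" if "i < d" for x i
  proof -
    have "(\<Sum>j<d. ?A $$ (i, j) * x j) = (\<Sum>j<d. if i = j then c * x j else 0)"
      using that by (intro sum.cong) auto
    then show ?thesis using that by (simp add: lin_def)
  qed
  then have "N (lin d ?A x) = c * N x" for x
    using N_cong[of "lin d ?A x" "\<lambda>k. c * x k"] c by (simp add: N_scale)
  then have "lin d ?A -` nball (c * r) \<inter> rspace d = nball r"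
    using c by (auto simp: nball_def)
  then show ?thesis
    using emeasure_lin_vimage[of ?A d "nball (c * r)"] c by (simp add: abs_mult power_abs)
qed

end

section \<open>Separation and gauges\<close>

context norm_fun
begin

text \<open>
  The functional is the difference of \<open>z\<close> and an almost nearest point \<open>x0\<close> of the unit ball. Moving
  from \<open>x0\<close> a little towards another point of the ball cannot bring it much closer to \<open>z\<close>.
\<close>

lemma separation:
  assumes z: "1 < N z"
  obtains v where "dual_norm v < dot v z"
proof -
  define L where "L = (\<Sum>i<d. N (unit i))"
  have NL: "(N y)\<^sup>2 \<le> L\<^sup>2 * dot y y" for y
  proof -
    have "\<bar>y i\<bar> \<le> sqrt (dot y y)" if "i < d" for i
    proof -
      have "(y i)\<^sup>2 \<le> (\<Sum>i<d. (y i)\<^sup>2)" using that by (intro member_le_sum) auto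
      then have "(y i)\<^sup>2 \<le> dot y y" by (simp add: dot_def power2_eq_square)
      then show ?thesis by (metis real_sqrt_abs real_sqrt_le_iff)
    qed
    then have "(\<Sum>i<d. \<bar>y i\<bar> * N (unit i)) \<le> (\<Sum>i<d. sqrt (dot y y) * N (unit i))"
      by (intro sum_mono mult_right_mono N_nonneg) auto
    then have "N y \<le> sqrt (dot y y) * L"
      using N_upper[of y] by (simp add: L_def sum_distrib_left)
    then have "(N y)\<^sup>2 \<le> (sqrt (dot y y) * L)\<^sup>2" by (intro power_mono N_nonneg)
    moreover have "0 \<le> dot y y" by (simp add: dot_def sum_nonneg)
    ultimately show ?thesis by (simp add: power_mult_distrib mult.commute)
  qed
  have L: "0 < L\<^sup>2"
  proof -
    have "L \<noteq> 0" using NL[of z] z by auto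
    then show ?thesis by simp
  qed
  define f where "f x = dot (\<lambda>k. z k - x k) (\<lambda>k. z k - x k)" for x
  define \<delta> where "\<delta> = (INF x\<in>{x. N x \<le> 1}. f x)"
  define \<delta>0 where "\<delta>0 = ((N z - 1) / L)\<^sup>2"
  have low: "\<delta>0 \<le> f x" if "N x \<le> 1" for x
  proof -
    have "N z \<le> N (\<lambda>k. z k - x k) + N x" using N_add[of "\<lambda>k. z k - x k" x] by simp
    then have "(N z - 1)\<^sup>2 \<le> (N (\<lambda>k. z k - x k))\<^sup>2" using that z by (intro power_mono) auto
    also have "\<dots> \<le> L\<^sup>2 * f x" unfolding f_def by (rule NL)
    finally show ?thesis using L by (simp add: \<delta>0_def power_divide field_simps)
  qed
  have "0 < \<delta>0" using L z by (simp add: \<delta>0_def)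
  also have "\<delta>0 \<le> \<delta>" unfolding \<delta>_def by (rule cINF_greatest[OF unit_ball_nonempty]) (simp add: low)
  finally have \<delta>: "0 < \<delta>" .
  have bdd: "bdd_below (f ` {x. N x \<le> 1})" using low by (intro bdd_belowI2[of _ \<delta>0]) simp
  have \<delta>le: "\<delta> \<le> f x" if "N x \<le> 1" for x
    unfolding \<delta>_def by (rule cINF_lower[OF bdd]) (simp add: that)
  define Q where "Q = d * (2 * R)\<^sup>2 + 1"
  have Q: "0 < Q" by (simp add: Q_def add_nonneg_pos)
  define s where "s = min 1 (\<delta> / (2 * Q))"
  have s: "0 < s" "s \<le> 1" "s * Q \<le> \<delta> / 2"
  proof -
    show "0 < s" "s \<le> 1" using \<delta> Q by (auto simp: s_def)
    have "s \<le> \<delta> / (2 * Q)" by (simp add: s_def)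
    then show "s * Q \<le> \<delta> / 2" using Q by (simp add: field_simps)
  qed
  have "\<delta> < \<delta> + s * \<delta> / 2" using s \<delta> by simp
  then obtain x0 where x0: "N x0 \<le> 1" "f x0 < \<delta> + s * \<delta> / 2"
    unfolding \<delta>_def using cINF_less_iff[OF unit_ball_nonempty bdd] by blast
  define y where "y = (\<lambda>k. z k - x0 k)"
  have "dual_norm y \<le> dot y x0 + \<delta> / 2"
  proof (rule dual_norm_le)
    fix x assume x: "N x \<le> 1"
    define w where "w = (\<lambda>k. x k - x0 k)"
    have "N (\<lambda>k. (1 - s) * x0 k + s * x k) \<le> (1 - s) * N x0 + s * N x"
      using N_add[of "\<lambda>k. (1 - s) * x0 k" "\<lambda>k. s * x k"] s by (simp add: N_scale)
    also have "\<dots> \<le> (1 - s) * 1 + s * 1" using x x0 s by (intro add_mono mult_left_mono) auto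
    finally have "\<delta> \<le> f (\<lambda>k. (1 - s) * x0 k + s * x k)" by (intro \<delta>le) simp
    also have "\<dots> = f x0 - 2 * s * dot y w + s\<^sup>2 * dot w w"
      unfolding f_def y_def w_def dot_def
      by (simp add: sum_distrib_left sum_subtractf[symmetric] sum.distrib[symmetric] power2_eq_square algebra_simps)
    finally have "2 * s * dot y w \<le> s * \<delta> / 2 + s\<^sup>2 * dot w w" using x0(2) by simp
    also have "dot w w \<le> Q"
    proof -
      have "dot w w \<le> (\<Sum>i<d. (2 * R)\<^sup>2)"
        unfolding dot_def power2_eq_square[symmetric]
      proof (rule sum_mono)
        fix i assume i: "i \<in> {..<d}"
        have "N w \<le> 2" using N_diff[of x x0] x x0 by (simp add: w_def)
        then have "R * N w \<le> R * 2" using R_pos by (intro mult_left_mono) auto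
        then have "\<bar>w i\<bar> \<le> 2 * R" using N_lower[of i w] i by simp
        then have "\<bar>w i\<bar>\<^sup>2 \<le> (2 * R)\<^sup>2" by (intro power_mono) auto
        then show "(w i)\<^sup>2 \<le> (2 * R)\<^sup>2" by simp
      qed
      then show ?thesis by (simp add: Q_def)
    qed
    finally have "2 * s * dot y w \<le> s * \<delta> / 2 + s\<^sup>2 * Q" by (simp add: mult_left_mono)
    then have "s * (2 * dot y w) \<le> s * (\<delta> / 2 + s * Q)" by (simp add: algebra_simps power2_eq_square)
    then have "2 * dot y w \<le> \<delta> / 2 + s * Q" using s(1) by (rule mult_left_le_imp_le)
    then have "dot y w \<le> \<delta> / 2" using s(3) by simp
    moreover have "dot y w = dot y x - dot y x0" by (simp add: w_def dot_def right_diff_distrib sum_subtractf)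
    ultimately show "dot y x \<le> dot y x0 + \<delta> / 2" by simp
  qed
  moreover have "dot y z = dot y x0 + f x0"
  proof -
    have "dot y z = dot y (\<lambda>k. x0 k + y k)" by (simp add: y_def)
    also have "\<dots> = dot y x0 + dot y y" by (rule dot_add(2))
    finally show ?thesis by (simp add: f_def y_def)
  qed
  moreover have "\<delta> \<le> f x0" by (rule \<delta>le[OF x0(1)])
  ultimately have "dual_norm y < dot y z" using \<delta> by linarith
  then show ?thesis by (rule that)
qed

end

lemma vscale_vscale: "vscale m a (vscale m b x) = vscale m (a * b) x"
  by (auto simp: vscale_def fun_eq_iff)

lemma vscale_one: "x \<in> rspace m \<Longrightarrow> vscale m 1 x = x"
  by (auto simp: vscale_def rspace_def fun_eq_iff PiE_def extensional_def)

lemma vscale_rspace: "vscale m a x \<in> rspace m"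
  by (simp add: vscale_def rspace_def)

lemma enorm_vscale: "enorm m (vscale m c x) = \<bar>c\<bar> * enorm m x"
proof -
  have "enorm m (vscale m c x) = L2_set (\<lambda>i. c * x i) {..<m}"
    unfolding enorm_def vscale_def by (rule L2_set_cong) auto
  also have "\<dots> = L2_set (\<lambda>i. \<bar>c\<bar> * x i) {..<m}"
    by (simp add: L2_set_def power_mult_distrib)
  also have "\<dots> = \<bar>c\<bar> * enorm m x" by (simp add: enorm_def L2_set_right_distrib)
  finally show ?thesis .
qed

lemma abs_coord_le_enorm: "i < m \<Longrightarrow> \<bar>x i\<bar> \<le> enorm m x"
proof -
  assume i: "i < m"
  have "\<bar>x i\<bar> \<le> L2_set (\<lambda>i. \<bar>x i\<bar>) {..<m}" by (rule member_le_L2_set) (use i in auto)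
  then show ?thesis by (simp add: enorm_def L2_set_def)
qed

locale sym_body =
  fixes d :: nat and K :: "(nat \<Rightarrow> real) set"
  assumes body: "convex_body d K" and sym: "centrally_symmetric d K"
begin

definition body_norm :: "(nat \<Rightarrow> real) \<Rightarrow> real" where
  "body_norm x = gauge_norm d K (restrict x {..<d})"

lemma K_rspace: "x \<in> K \<Longrightarrow> x \<in> rspace d"
  using body by (auto simp: convex_body_def)

lemma K_convex: "x \<in> K \<Longrightarrow> y \<in> K \<Longrightarrow> 0 \<le> u \<Longrightarrow> 0 \<le> v \<Longrightarrow> u + v = 1 \<Longrightarrow>
    vadd d (vscale d u x) (vscale d v y) \<in> K"
  using body by (auto simp: convex_body_def)

lemma K_sym: "x \<in> K \<Longrightarrow> vscale d (-1) x \<in> K"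
  using sym by (auto simp: centrally_symmetric_def)

text \<open>Every \<open>x\<close> is the midpoint of \<open>a + x\<close> and \<open>- (a - x)\<close>, so a ball at \<open>a\<close> yields one at the origin.\<close>

lemma ball0_in_K:
  obtains r0 where "0 < r0" "\<And>x. x \<in> rspace d \<Longrightarrow> enorm d x < r0 \<Longrightarrow> x \<in> K"
proof -
  obtain a r where a: "a \<in> rspace d" "0 < r" "eball d a r \<subseteq> K"
    using body by (auto simp: convex_body_def)
  have "x \<in> K" if x: "x \<in> rspace d" "enorm d x < r" for x
  proof -
    define y where "y = vadd d a x"
    define y' where "y' = vadd d a (vscale d (-1) x)"
    have "enorm d (\<lambda>i. y i - a i) = enorm d x"
      unfolding enorm_def by (rule L2_set_cong) (auto simp: y_def vadd_def)
    then have "y \<in> eball d a r" using x by (simp add: eball_def) (simp add: y_def vadd_def rspace_def)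
    then have y: "y \<in> K" using a(3) by blast
    have "enorm d (\<lambda>i. y' i - a i) = enorm d (vscale d (-1) x)"
      unfolding enorm_def by (rule L2_set_cong) (auto simp: y'_def vadd_def)
    then have "y' \<in> eball d a r"
      using x by (simp add: eball_def enorm_vscale) (simp add: y'_def vadd_def rspace_def)
    then have "y' \<in> K" using a(3) by blast
    then have "vadd d (vscale d (1/2) y) (vscale d (1/2) (vscale d (-1) y')) \<in> K"
      by (intro K_convex y K_sym) auto
    moreover have "vadd d (vscale d (1/2) y) (vscale d (1/2) (vscale d (-1) y')) = x"
      using x(1) by (auto simp: y_def y'_def vadd_def vscale_def fun_eq_iff rspace_def PiE_def extensional_def field_simps)
    ultimately show ?thesis by simp
  qed
  with a(2) show ?thesis by (rule that)
qed

lemma zero_in_K: "(\<lambda>i\<in>{..<d}. 0) \<in> K"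
proof -
  obtain r0 where "0 < r0" "\<And>x. x \<in> rspace d \<Longrightarrow> enorm d x < r0 \<Longrightarrow> x \<in> K" using ball0_in_K by blast
  moreover have "enorm d (\<lambda>i\<in>{..<d}. 0) = 0" by (simp add: enorm_def L2_set_def)
  ultimately show ?thesis by (simp add: rspace_def)
qed

lemma vscale_image_iff:
  assumes "0 < r"
  shows "restrict x {..<d} \<in> vscale d r ` K \<longleftrightarrow> vscale d (1 / r) x \<in> K"
proof
  assume "restrict x {..<d} \<in> vscale d r ` K"
  then obtain k where k: "k \<in> K" "restrict x {..<d} = vscale d r k" by auto
  have "vscale d (1 / r) x = vscale d (1 / r) (restrict x {..<d})" by (auto simp: vscale_def fun_eq_iff)
  also have "\<dots> = k" using assms k K_rspace by (simp add: vscale_vscale vscale_one)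
  finally show "vscale d (1 / r) x \<in> K" using k by simp
next
  assume "vscale d (1 / r) x \<in> K"
  moreover have "restrict x {..<d} = vscale d r (vscale d (1 / r) x)"
    using assms by (auto simp: vscale_def fun_eq_iff)
  ultimately show "restrict x {..<d} \<in> vscale d r ` K" by blast
qed

lemma body_norm_le: "0 < r \<Longrightarrow> vscale d (1 / r) x \<in> K \<Longrightarrow> body_norm x \<le> r"
  unfolding body_norm_def gauge_norm_def
  by (rule cInf_lower) (auto simp: vscale_image_iff intro: bdd_belowI[of _ 0])

lemma body_norm_set_nonempty: "{r. 0 < r \<and> restrict x {..<d} \<in> vscale d r ` K} \<noteq> {}"
proof -
  obtain r0 where r0: "0 < r0" "\<And>x. x \<in> rspace d \<Longrightarrow> enorm d x < r0 \<Longrightarrow> x \<in> K" using ball0_in_K by blast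
  define r where "r = enorm d x / r0 + 1"
  have r: "0 < r" using r0 by (simp add: r_def enorm_def L2_set_nonneg add_nonneg_pos)
  have "enorm d x < r * r0" using r0 by (simp add: r_def field_simps)
  then have "enorm d (vscale d (1 / r) x) < r0" using r by (simp add: enorm_vscale field_simps)
  then have "vscale d (1 / r) x \<in> K" by (intro r0 vscale_rspace)
  with r show ?thesis by (auto simp: vscale_image_iff)
qed

lemma body_norm_nonneg: "0 \<le> body_norm x"
  unfolding body_norm_def gauge_norm_def by (rule cInf_greatest[OF body_norm_set_nonempty]) auto

lemma body_norm_less: "body_norm x < r \<Longrightarrow> vscale d (1 / r) x \<in> K"
proof -
  assume "body_norm x < r"
  then obtain r' where r': "0 < r'" "restrict x {..<d} \<in> vscale d r' ` K" "r' < r"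
    unfolding body_norm_def gauge_norm_def using cInf_lessD[OF body_norm_set_nonempty] by blast
  then have "vscale d (1 / r') x \<in> K" by (simp add: vscale_image_iff)
  then have "vadd d (vscale d (r' / r) (vscale d (1 / r') x)) (vscale d (1 - r' / r) (\<lambda>i\<in>{..<d}. 0)) \<in> K"
    using r' by (intro K_convex zero_in_K) auto
  moreover have "vadd d (vscale d (r' / r) (vscale d (1 / r') x)) (vscale d (1 - r' / r) (\<lambda>i\<in>{..<d}. 0)) = vscale d (1 / r) x"
    using r' by (auto simp: vadd_def vscale_def fun_eq_iff)
  ultimately show ?thesis by simp
qed

lemma body_norm_add: "body_norm (\<lambda>k. x k + y k) \<le> body_norm x + body_norm y"
proof (rule field_le_epsilon)
  fix e :: real assume e: "0 < e"
  define r where "r = body_norm x + e / 2"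
  define s where "s = body_norm y + e / 2"
  have rs: "0 < r" "0 < s" using e body_norm_nonneg[of x] body_norm_nonneg[of y] by (auto simp: r_def s_def)
  have "vscale d (1 / r) x \<in> K" "vscale d (1 / s) y \<in> K" using e by (auto intro!: body_norm_less simp: r_def s_def)
  then have "vadd d (vscale d (r / (r + s)) (vscale d (1 / r) x)) (vscale d (s / (r + s)) (vscale d (1 / s) y)) \<in> K"
    using rs by (intro K_convex) (auto simp: add_divide_distrib[symmetric])
  moreover have "vadd d (vscale d (r / (r + s)) (vscale d (1 / r) x)) (vscale d (s / (r + s)) (vscale d (1 / s) y))
      = vscale d (1 / (r + s)) (\<lambda>k. x k + y k)"
    using rs by (auto simp: vadd_def vscale_def fun_eq_iff add_divide_distrib)
  ultimately have "body_norm (\<lambda>k. x k + y k) \<le> r + s" using rs by (intro body_norm_le) auto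
  then show "body_norm (\<lambda>k. x k + y k) \<le> body_norm x + body_norm y + e" by (simp add: r_def s_def)
qed

lemma body_norm_scale: "body_norm (\<lambda>k. c * x k) = \<bar>c\<bar> * body_norm x"
proof -
  have le: "body_norm (\<lambda>k. c * x k) \<le> \<bar>c\<bar> * body_norm x" if c: "c \<noteq> 0" for c x
  proof (rule field_le_epsilon)
    fix e :: real assume e: "0 < e"
    define r where "r = body_norm x + e / \<bar>c\<bar>"
    have r: "0 < r" using e c body_norm_nonneg[of x] by (simp add: r_def add_nonneg_pos)
    have K: "vscale d (1 / r) x \<in> K" using e c by (intro body_norm_less) (simp add: r_def)
    have "vscale d (1 / (\<bar>c\<bar> * r)) (\<lambda>k. c * x k) = vscale d (sgn c) (vscale d (1 / r) x)"
      using c r by (auto simp: vscale_def fun_eq_iff sgn_if abs_if)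
    also have "\<dots> \<in> K"
      using K K_sym[OF K] c vscale_one[OF K_rspace[OF K]] by (cases "c < 0") (auto simp: sgn_if)
    finally have "body_norm (\<lambda>k. c * x k) \<le> \<bar>c\<bar> * r" using c r by (intro body_norm_le) auto
    also have "\<dots> = \<bar>c\<bar> * body_norm x + e" using c by (simp add: r_def field_simps)
    finally show "body_norm (\<lambda>k. c * x k) \<le> \<bar>c\<bar> * body_norm x + e" .
  qed
  show ?thesis
  proof (cases "c = 0")
    case True
    have le0: "body_norm (\<lambda>k. 0) \<le> e" if "0 < e" for e
      by (rule body_norm_le[OF that]) (use zero_in_K in \<open>simp add: vscale_def\<close>)
    have "body_norm (\<lambda>k. 0) \<le> 0" by (rule field_le_epsilon) (simp add: le0)
    then have "body_norm (\<lambda>k. 0) = 0" using body_norm_nonneg[of "\<lambda>k. 0"] by simp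
    then show ?thesis using True by simp
  next
    case False
    have "body_norm x \<le> \<bar>1 / c\<bar> * body_norm (\<lambda>k. c * x k)" using le[of "1 / c" "\<lambda>k. c * x k"] False by simp
    then show ?thesis using le[OF False, of x] False by (simp add: field_simps)
  qed
qed

lemma norm_fun_body_norm: obtains R where "norm_fun body_norm d R"
proof -
  obtain R0 where R0: "\<And>x. x \<in> K \<Longrightarrow> enorm d x \<le> R0" using body by (auto simp: convex_body_def)
  define R where "R = max R0 1"
  have "norm_fun body_norm d R"
  proof unfold_locales
    show "body_norm x = body_norm y" if "\<And>i. i < d \<Longrightarrow> x i = y i" for x y
    proof -
      have "restrict x {..<d} = restrict y {..<d}" using that by (auto simp: fun_eq_iff)
      then show ?thesis by (simp add: body_norm_def)
    qed
    show "\<bar>x i\<bar> \<le> R * body_norm x" if i: "i < d" for x i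
    proof (rule field_le_epsilon)
      fix e :: real assume e: "0 < e"
      define r where "r = body_norm x + e / R"
      have R: "0 < R" by (simp add: R_def)
      have r: "0 < r" using e R body_norm_nonneg[of x] by (simp add: r_def add_nonneg_pos)
      have "enorm d (vscale d (1 / r) x) \<le> R"
        using R0[OF body_norm_less[of x r]] e R by (simp add: r_def R_def)
      moreover have "\<bar>vscale d (1 / r) x i\<bar> \<le> enorm d (vscale d (1 / r) x)" by (rule abs_coord_le_enorm[OF i])
      ultimately have "\<bar>x i\<bar> / r \<le> R" using i r by (simp add: vscale_def)
      then have "\<bar>x i\<bar> \<le> R * r" using r by (simp add: field_simps)
      also have "\<dots> = R * body_norm x + e" using R by (simp add: r_def field_simps)
      finally show "\<bar>x i\<bar> \<le> R * body_norm x + e" .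
    qed
  qed (auto intro: body_norm_add simp: body_norm_scale R_def)
  then show ?thesis by (rule that)
qed

lemma body_norm_K: "x \<in> K \<Longrightarrow> body_norm x \<le> 1"
  by (rule body_norm_le) (simp_all add: vscale_one K_rspace)

lemma body_norm_less_1: "x \<in> rspace d \<Longrightarrow> body_norm x < 1 \<Longrightarrow> x \<in> K"
  using body_norm_less[of x 1] by (simp add: vscale_one)

text \<open>The type constant is an infimum, so the inequality is available for every larger constant.\<close>

lemma type_fun_body_norm:
  assumes p: "1 < p" "p \<le> 2" and T: "0 \<le> T" and type: "type_const d (gauge_norm d K) p \<le> ereal T"
  shows "type_fun body_norm p (T + 1)"
proof -
  have "type_const d (gauge_norm d K) p < ereal (T + 1)" using type by (rule le_less_trans) simp
  then obtain C where C: "0 \<le> C" "type_ineq d (gauge_norm d K) p C" "C < T + 1"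
    unfolding type_const_def by (auto simp: Inf_less_iff)
  interpret seminorm_fun body_norm by standard (auto intro: body_norm_add simp: body_norm_scale)
  show ?thesis
  proof
    fix k and x :: "nat \<Rightarrow> nat \<Rightarrow> real"
    define S where "S = (\<Sum>j<k. body_norm (x j) powr p)"
    define E where "E = (\<Sum>t\<in>signs k. (body_norm (\<lambda>i. \<Sum>j<k. t j * x j i))\<^sup>2) / 2 ^ k"
    have ne: "signs k \<noteq> {}" using card_signs[of k] by auto
    have body_norm: "gauge_norm d K (\<lambda>i\<in>{..<d}. \<Sum>j<k. t j * restrict (x j) {..<d} i) = body_norm (\<lambda>i. \<Sum>j<k. t j * x j i)" for t
      unfolding body_norm_def by (rule arg_cong[where f = "gauge_norm d K"]) (auto simp: fun_eq_iff)
    have "sqrt (measure_pmf.expectation (pmf_of_set (signs k))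
        (\<lambda>t. (gauge_norm d K (\<lambda>i\<in>{..<d}. \<Sum>j<k. t j * restrict (x j) {..<d} i))\<^sup>2))
        \<le> C * (\<Sum>j<k. gauge_norm d K (restrict (x j) {..<d}) powr p) powr (1 / p)"
      using C(2)[unfolded type_ineq_def, rule_format, of k "\<lambda>j. restrict (x j) {..<d}"]
      by (simp add: rspace_def)
    then have "sqrt E \<le> C * S powr (1 / p)"
      unfolding body_norm E_def S_def
      by (simp add: integral_pmf_of_set[OF ne finite_signs] card_signs body_norm_def)
    moreover have E0: "0 \<le> E" by (simp add: E_def sum_nonneg)
    ultimately have "(sqrt E)\<^sup>2 \<le> (C * S powr (1 / p))\<^sup>2" by (intro power_mono) auto
    then have "E \<le> C\<^sup>2 * S powr (2 / p)"
    proof -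
      have "(S powr (1 / p))\<^sup>2 = S powr (2 / p)" by (simp add: powr_powr flip: powr_numeral)
      then show ?thesis using \<open>(sqrt E)\<^sup>2 \<le> (C * S powr (1 / p))\<^sup>2\<close> E0 by (simp add: power_mult_distrib)
    qed
    also have "\<dots> \<le> (T + 1)\<^sup>2 * S powr (2 / p)"
      using C T by (intro mult_right_mono power_mono) auto
    finally show "(\<Sum>t\<in>signs k. (body_norm (\<lambda>i. \<Sum>j<k. t j * x j i))\<^sup>2) / 2 ^ k
        \<le> (T + 1)\<^sup>2 * (\<Sum>j<k. body_norm (x j) powr p) powr (2 / p)"
      by (simp add: E_def S_def)
  qed (use p T in auto)
qed

end

section \<open>Linear symplectic maps\<close>

abbreviation "\<omega> \<equiv> symplectic_form"

lemma symplectic_add: "\<omega> n (\<lambda>i. u i + v i) w = \<omega> n u w + \<omega> n v w" "\<omega> n w (\<lambda>i. u i + v i) = \<omega> n w u + \<omega> n w v"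
  by (simp_all add: symplectic_form_def sum.distrib[symmetric] algebra_simps)

lemma symplectic_diff: "\<omega> n (\<lambda>i. u i - v i) w = \<omega> n u w - \<omega> n v w" "\<omega> n w (\<lambda>i. u i - v i) = \<omega> n w u - \<omega> n w v"
  by (simp_all add: symplectic_form_def sum_subtractf[symmetric] algebra_simps)

lemma symplectic_scale: "\<omega> n (\<lambda>i. c * u i) w = c * \<omega> n u w" "\<omega> n w (\<lambda>i. c * u i) = c * \<omega> n w u"
  by (simp_all add: symplectic_form_def sum_distrib_left algebra_simps)

lemma symplectic_self: "\<omega> n u u = 0"
  by (simp add: symplectic_form_def)

lemma symplectic_swap: "\<omega> n u v = - \<omega> n v u"
  by (simp add: symplectic_form_def sum_negf[symmetric] algebra_simps)

lemma symplectic_cong: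
  assumes "\<And>i. i < 2 * n \<Longrightarrow> u i = u' i" "\<And>i. i < 2 * n \<Longrightarrow> v i = v' i"
  shows "\<omega> n u v = \<omega> n u' v'"
  unfolding symplectic_form_def by (rule sum.cong) (simp_all add: assms)

lemma symplectic_restrict:
  "\<omega> n (\<lambda>i\<in>{..<2 * n}. u i) v = \<omega> n u v" "\<omega> n u (\<lambda>i\<in>{..<2 * n}. v i) = \<omega> n u v"
  by (rule symplectic_cong; simp)+

lemma rspace_eqI: "x \<in> rspace m \<Longrightarrow> y \<in> rspace m \<Longrightarrow> (\<And>i. i < m \<Longrightarrow> x i = y i) \<Longrightarrow> x = y"
  unfolding rspace_def by (rule PiE_ext) auto

definition transvection :: "nat \<Rightarrow> real \<Rightarrow> (nat \<Rightarrow> real) \<Rightarrow> (nat \<Rightarrow> real) \<Rightarrow> nat \<Rightarrow> real" where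
  "transvection n c v z = (\<lambda>i\<in>{..<2 * n}. z i + c * \<omega> n z v * v i)"

lemma transvection_Sp: "transvection n c v \<in> Sp n"
proof -
  have "transvection n c v (vadd (2 * n) x y) = vadd (2 * n) (transvection n c v x) (transvection n c v y)" for x y
    by (auto simp: transvection_def vadd_def fun_eq_iff symplectic_restrict symplectic_add
        distrib_left distrib_right add_ac)
  moreover have "transvection n c v (vscale (2 * n) a x) = vscale (2 * n) a (transvection n c v x)" for a x
    by (auto simp: transvection_def vscale_def fun_eq_iff symplectic_restrict symplectic_scale
        distrib_left mult.assoc mult.left_commute)
  moreover have "\<omega> n (transvection n c v x) (transvection n c v y) = \<omega> n x y" for x y
  proof -
    have "\<omega> n (transvection n c v x) (transvection n c v y)
        = \<omega> n (\<lambda>i. x i + c * \<omega> n x v * v i) (\<lambda>i. y i + c * \<omega> n y v * v i)"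
      by (simp add: transvection_def symplectic_restrict)
    also have "\<dots> = \<omega> n x y"
      using symplectic_swap[of n v y]
      by (simp add: symplectic_add symplectic_scale symplectic_self)
    finally show ?thesis .
  qed
  ultimately show ?thesis
    by (auto simp: Sp_def linear_map_def) (simp add: transvection_def rspace_def)
qed

lemma Sp_rspace: "\<psi> \<in> Sp n \<Longrightarrow> x \<in> rspace (2 * n) \<Longrightarrow> \<psi> x \<in> rspace (2 * n)"
  by (auto simp: Sp_def linear_map_def)

lemma Sp_form: "\<psi> \<in> Sp n \<Longrightarrow> x \<in> rspace (2 * n) \<Longrightarrow> y \<in> rspace (2 * n) \<Longrightarrow> \<omega> n (\<psi> x) (\<psi> y) = \<omega> n x y"
  by (auto simp: Sp_def)

lemma Sp_comp:
  assumes "\<psi> \<in> Sp n" "\<phi> \<in> Sp n"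
  shows "\<psi> \<circ> \<phi> \<in> Sp n"
  using assms by (auto simp: Sp_def linear_map_def Pi_iff)

lemma transvection_move:
  assumes u: "u \<in> rspace (2 * n)" and w: "w \<in> rspace (2 * n)" and ne: "\<omega> n u w \<noteq> 0"
  shows "transvection n (1 / \<omega> n u w) (\<lambda>i. w i - u i) u = w"
  by (rule rspace_eqI[OF _ w])
    (use ne in \<open>auto simp: transvection_def rspace_def symplectic_diff symplectic_self\<close>)

lemma transvection_fix:
  assumes e: "e \<in> rspace (2 * n)" and eq: "\<omega> n e v = 0"
  shows "transvection n c v e = e"
  by (rule rspace_eqI[OF _ e]) (auto simp: transvection_def rspace_def eq)

definition e0 :: "nat \<Rightarrow> nat \<Rightarrow> real" where "e0 n = (\<lambda>i\<in>{..<2 * n}. if i = 0 then 1 else 0)"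
definition e1 :: "nat \<Rightarrow> nat \<Rightarrow> real" where "e1 n = (\<lambda>i\<in>{..<2 * n}. if i = 1 then 1 else 0)"

lemma e01_rspace: "e0 n \<in> rspace (2 * n)" "e1 n \<in> rspace (2 * n)"
  by (simp_all add: e0_def e1_def rspace_def)

lemma symplectic_e01:
  assumes "1 \<le> n"
  shows "\<omega> n z (e1 n) = z 0" "\<omega> n z (e0 n) = - z 1"
proof -
  have "\<omega> n z (e1 n) = (\<Sum>j<n. if j = 0 then z 0 else 0)"
    unfolding symplectic_form_def by (rule sum.cong) (auto simp: e1_def)
  then show "\<omega> n z (e1 n) = z 0" using assms by simp
  have "\<omega> n z (e0 n) = (\<Sum>j<n. if j = 0 then - z 1 else 0)"
    unfolding symplectic_form_def by (rule sum.cong) (auto simp: e0_def)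
  then show "\<omega> n z (e0 n) = - z 1" using assms by simp
qed

lemma Sp_move:
  assumes u: "u \<in> rspace (2 * n)" and w: "w \<in> rspace (2 * n)" and p: "p \<in> rspace (2 * n)"
    and ne: "\<omega> n u p \<noteq> 0" "\<omega> n p w \<noteq> 0"
  shows "\<exists>\<psi>\<in>Sp n. \<psi> u = w \<and>
     (\<forall>e\<in>rspace (2 * n). \<omega> n e u = \<omega> n e p \<longrightarrow> \<omega> n e p = \<omega> n e w \<longrightarrow> \<psi> e = e)"
proof (intro bexI conjI ballI impI)
  let ?\<psi> = "transvection n (1 / \<omega> n p w) (\<lambda>i. w i - p i) \<circ> transvection n (1 / \<omega> n u p) (\<lambda>i. p i - u i)"
  show "?\<psi> \<in> Sp n" by (intro Sp_comp transvection_Sp)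
  show "?\<psi> u = w" by (simp add: transvection_move u w p ne)
  fix e assume e: "e \<in> rspace (2 * n)" "\<omega> n e u = \<omega> n e p" "\<omega> n e p = \<omega> n e w"
  then show "?\<psi> e = e" by (simp add: transvection_fix symplectic_diff)
qed

text \<open>
  A transvection moves \<open>u\<close> to \<open>w\<close> as soon as their symplectic product is nonzero; otherwise an
  intermediate vector \<open>p\<close> helps. The first move takes \<open>a\<close> to the first basis vector. The second one
  must fix that vector, which is the case because both ends of each transvection pair with it to
  the same value.
\<close>

lemma Sp_transitive:
  assumes a: "a \<in> rspace (2 * n)" and b: "b \<in> rspace (2 * n)" and ab: "\<omega> n a b = 1" and n: "1 \<le> n"
  obtains \<psi> where "\<psi> \<in> Sp n" "\<psi> a = e0 n" "\<psi> b = e1 n"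
proof -
  note e = e01_rspace[of n]
  have e01: "\<omega> n (e0 n) (e1 n) = 1" using n by (simp add: symplectic_e01 e0_def)
  have rs: "(\<lambda>i\<in>{..<2 * n}. x i + y i) \<in> rspace (2 * n)" for x y :: "nat \<Rightarrow> real"
    by (simp add: rspace_def)
  have "\<exists>p\<in>rspace (2 * n). \<omega> n a p \<noteq> 0 \<and> \<omega> n p (e0 n) \<noteq> 0"
  proof (cases "\<omega> n b (e0 n) = 0")
    case False
    then show ?thesis using b ab by (intro bexI[of _ b]) auto
  next
    case b0: True
    have e10: "\<omega> n (e1 n) (e0 n) = -1" using symplectic_swap[of n "e1 n" "e0 n"] e01 by simp
    show ?thesis
    proof (cases "\<omega> n a (e1 n) = 0")
      case False
      then show ?thesis using e e10 by force
    next
      case True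
      then have "\<omega> n a (\<lambda>i\<in>{..<2 * n}. b i + e1 n i) \<noteq> 0" "\<omega> n (\<lambda>i\<in>{..<2 * n}. b i + e1 n i) (e0 n) \<noteq> 0"
        using b0 ab e10 by (simp_all add: symplectic_restrict symplectic_add)
      then show ?thesis using rs by blast
    qed
  qed
  then obtain \<psi>1 where \<psi>1: "\<psi>1 \<in> Sp n" "\<psi>1 a = e0 n" using Sp_move[OF a e(1)] by blast
  define b' where "b' = \<psi>1 b"
  have b': "b' \<in> rspace (2 * n)" "\<omega> n (e0 n) b' = 1"
    using Sp_form[OF \<psi>1(1) a b] \<psi>1 ab b Sp_rspace[OF \<psi>1(1) b] by (auto simp: b'_def)
  have b'0: "\<omega> n b' (e0 n) = -1" using symplectic_swap[of n b' "e0 n"] b'(2) by simp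
  have "\<exists>\<psi>2\<in>Sp n. \<psi>2 b' = e1 n \<and> \<psi>2 (e0 n) = e0 n"
  proof (cases "\<omega> n b' (e1 n) = 0")
    case False
    show ?thesis
    proof (intro bexI[of _ "transvection n (1 / \<omega> n b' (e1 n)) (\<lambda>i. e1 n i - b' i)"] conjI)
      show "transvection n (1 / \<omega> n b' (e1 n)) (\<lambda>i. e1 n i - b' i) b' = e1 n"
        by (rule transvection_move[OF b'(1) e(2) False])
      show "transvection n (1 / \<omega> n b' (e1 n)) (\<lambda>i. e1 n i - b' i) (e0 n) = e0 n"
        by (rule transvection_fix[OF e(1)]) (simp add: symplectic_diff e01 b')
    qed (rule transvection_Sp)
  next
    case True
    let ?p = "\<lambda>i\<in>{..<2 * n}. b' i + e0 n i"
    have "\<omega> n b' ?p \<noteq> 0" "\<omega> n ?p (e1 n) \<noteq> 0"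
      using True b'0 e01 by (simp_all add: symplectic_restrict symplectic_add symplectic_self)
    from Sp_move[OF b'(1) e(2) rs this] show ?thesis
      using e(1) by (force simp: symplectic_restrict symplectic_add symplectic_self b' e01)
  qed
  then obtain \<psi>2 where "\<psi>2 \<in> Sp n" "\<psi>2 b' = e1 n" "\<psi>2 (e0 n) = e0 n" by blast
  then show ?thesis using \<psi>1 that[of "\<psi>2 \<circ> \<psi>1"] by (simp add: Sp_comp b'_def)
qed

lemma cylinderI:
  assumes x: "x \<in> rspace (2 * n)" and r: "0 < r" and le: "(x 0)\<^sup>2 + (x 1)\<^sup>2 < r\<^sup>2"
  shows "x \<in> cylinder n r"
proof -
  have "L2_set (\<lambda>i. restrict x {..<2} i - (\<lambda>i\<in>{..<2}. 0) i) {..<2::nat} = sqrt ((x 0)\<^sup>2 + (x 1)\<^sup>2)"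
    by (simp add: L2_set_def numeral_2_eq_2)
  also have "\<dots> < r" using r le by (metis real_sqrt_less_mono real_sqrt_unique less_imp_le)
  finally show ?thesis using x by (simp add: cylinder_def eball0_def eball_def enorm_def rspace_def)
qed

text \<open>
  After a symplectic map that takes \<open>a\<close> and \<open>b\<close> to the first two basis vectors, the first two
  coordinates are the functionals \<open>\<omega> (\<cdot>, b)\<close> and \<open>- \<omega> (\<cdot>, a)\<close>.
\<close>

lemma cZ_lin_le:
  assumes n: "1 \<le> n" and K: "K \<subseteq> rspace (2 * n)" and ab: "\<omega> n a b = 1" and r: "0 < r"
    and small: "\<And>z. z \<in> K \<Longrightarrow> (\<omega> n z a)\<^sup>2 + (\<omega> n z b)\<^sup>2 < r\<^sup>2"
  shows "cZ_lin n K \<le> ereal (pi * r\<^sup>2)"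
proof -
  define a' where "a' = (\<lambda>i\<in>{..<2 * n}. a i)"
  define b' where "b' = (\<lambda>i\<in>{..<2 * n}. b i)"
  have ab': "a' \<in> rspace (2 * n)" "b' \<in> rspace (2 * n)" by (simp_all add: a'_def b'_def rspace_def)
  have "\<omega> n a' b' = 1" by (simp add: a'_def b'_def symplectic_restrict ab)
  then obtain \<psi> where \<psi>: "\<psi> \<in> Sp n" "\<psi> a' = e0 n" "\<psi> b' = e1 n" using Sp_transitive[OF ab' _ n] by blast
  have "\<psi> ` K \<subseteq> cylinder n r"
  proof
    fix y assume "y \<in> \<psi> ` K"
    then obtain z where z: "z \<in> K" "y = \<psi> z" by blast
    have zr: "z \<in> rspace (2 * n)" using z K by blast
    have "\<omega> n z a' = \<omega> n z a" "\<omega> n z b' = \<omega> n z b" by (simp_all add: a'_def b'_def symplectic_restrict)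
    then have "y 0 = \<omega> n z b" "- y 1 = \<omega> n z a"
      using Sp_form[OF \<psi>(1) zr ab'(2)] symplectic_e01(1)[OF n, of y]
        Sp_form[OF \<psi>(1) zr ab'(1)] symplectic_e01(2)[OF n, of y] by (simp_all add: z \<psi>)
    then have "(y 0)\<^sup>2 + (y 1)\<^sup>2 < r\<^sup>2" using small[OF z(1)] by (metis add.commute power2_minus)
    then show "y \<in> cylinder n r" using Sp_rspace[OF \<psi>(1) zr] r z by (intro cylinderI) auto
  qed
  then show ?thesis unfolding cZ_lin_def using \<psi>(1) r by (intro Inf_lower) blast
qed

section \<open>Volume bounds\<close>

text \<open>The complex structure that turns the symplectic form into the inner product.\<close>

definition Jf :: "(nat \<Rightarrow> real) \<Rightarrow> nat \<Rightarrow> real" where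
  "Jf v k = (if even k then v (Suc k) else - v (k - 1))"

lemma Jf_Jf: "Jf (Jf v) = (\<lambda>k. - v k)"
  by (auto simp: Jf_def fun_eq_iff)

lemma Jf_uminus: "Jf (\<lambda>k. - v k) = (\<lambda>k. - Jf v k)"
  by (auto simp: Jf_def fun_eq_iff)

lemma symplectic_Jf: "\<omega> n z w = (\<Sum>i<2 * n. z i * Jf w i)"
proof (induction n)
  case (Suc n)
  have "\<omega> (Suc n) z w = \<omega> n z w + (z (2 * n) * w (2 * n + 1) - z (2 * n + 1) * w (2 * n))"
    by (simp add: symplectic_form_def)
  then show ?case using Suc by (simp add: Jf_def)
qed (simp add: symplectic_form_def)

definition Jm :: "nat \<Rightarrow> real mat" where
  "Jm n = mat (2 * n) (2 * n)
     (\<lambda>(i, j). if even i \<and> j = Suc i then 1 else if odd i \<and> Suc j = i then -1 else 0)"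

lemma Jm_carrier [simp]: "Jm n \<in> carrier_mat (2 * n) (2 * n)"
  by (simp add: Jm_def)

lemma sum_Jm:
  assumes i: "i < 2 * n"
  shows "(\<Sum>j<2 * n. Jm n $$ (i, j) * x j) = Jf x i"
proof (cases "even i")
  case True
  then have Si: "Suc i < 2 * n" using i by (metis Suc_lessI dvd_triv_left even_Suc)
  have "(\<Sum>j<2 * n. Jm n $$ (i, j) * x j) = (\<Sum>j<2 * n. if j = Suc i then x j else 0)"
    using True i by (intro sum.cong) (auto simp: Jm_def)
  then show ?thesis using True Si by (simp add: Jf_def)
next
  case False
  then have "0 < i" by (cases i) auto
  then have "(\<Sum>j<2 * n. Jm n $$ (i, j) * x j) = (\<Sum>j<2 * n. if j = i - 1 then - x j else 0)"
    using False i by (intro sum.cong) (auto simp: Jm_def)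
  then show ?thesis using False i \<open>0 < i\<close> by (simp add: Jf_def)
qed

lemma abs_det_Jm: "\<bar>det (Jm n)\<bar> = 1"
proof -
  have "Jm n * Jm n = (-1) \<cdot>\<^sub>m 1\<^sub>m (2 * n)"
  proof (rule eq_matI)
    fix i j assume ij: "i < dim_row ((-1) \<cdot>\<^sub>m 1\<^sub>m (2 * n) :: real mat)" "j < dim_col ((-1) \<cdot>\<^sub>m 1\<^sub>m (2 * n) :: real mat)"
    then have i: "i < 2 * n" and j: "j < 2 * n" by auto
    have "(Jm n * Jm n) $$ (i, j) = (\<Sum>l<2 * n. Jm n $$ (i, l) * Jm n $$ (l, j))"
      by (rule mat_mult_entry[OF _ _ i j]) simp_all
    also have "\<dots> = Jf (\<lambda>l. Jm n $$ (l, j)) i" by (rule sum_Jm[OF i])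
    also have "\<dots> = (if i = j then -1 else 0)"
    proof (cases "even i")
      case True
      then have "Suc i < 2 * n" using i by (metis Suc_lessI dvd_triv_left even_Suc)
      then show ?thesis using True j by (auto simp: Jf_def Jm_def)
    next
      case False
      then have "0 < i" by (cases i) auto
      then show ?thesis using False i j by (auto simp: Jf_def Jm_def)
    qed
    finally show "(Jm n * Jm n) $$ (i, j) = ((-1) \<cdot>\<^sub>m 1\<^sub>m (2 * n)) $$ (i, j)" using i j by simp
  qed (auto simp: Jm_def)
  then have "det (Jm n) * det (Jm n) = det ((-1) \<cdot>\<^sub>m 1\<^sub>m (2 * n) :: real mat)"
    using det_mult[of "Jm n" "2 * n" "Jm n"] by simp
  also have "\<dots> = 1" by simp
  finally have "\<bar>det (Jm n)\<bar> * \<bar>det (Jm n)\<bar> = 1" by simp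
  then show ?thesis by (metis abs_ge_zero abs_mult_self_eq abs_one real_sqrt_abs2 real_sqrt_one abs_abs)
qed

context norm_fun
begin

lemma emeasure_nball_finite: "emeasure (lebm d) (nball 1) < \<infinity>"
proof -
  have "nball 1 \<subseteq> {..<d} \<rightarrow>\<^sub>E {- R..R}"
  proof
    fix x assume x: "x \<in> nball 1"
    have "- R \<le> x i \<and> x i \<le> R" if "i < d" for i
    proof -
      have "\<bar>x i\<bar> \<le> R * N x" using N_lower[OF that] .
      also have "\<dots> \<le> R * 1" using x R_pos by (intro mult_left_mono) (auto simp: nball_def)
      finally show ?thesis by auto
    qed
    then show "x \<in> {..<d} \<rightarrow>\<^sub>E {- R..R}" using x by (auto simp: nball_def rspace_def PiE_iff)
  qed
  then have "emeasure (lebm d) (nball 1) \<le> emeasure (lebm d) ({..<d} \<rightarrow>\<^sub>E {- R..R})"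
    by (rule emeasure_mono) (intro sets_PiM_I_finite, auto)
  also have "\<dots> = (\<Prod>i<d. emeasure lborel {- R..R})" by (rule lebm.emeasure_PiM) auto
  also have "\<dots> = ennreal (\<Prod>i<d. 2 * R)" using R_pos by (simp add: ennreal_power)
  also have "\<dots> < \<infinity>" by simp
  finally show ?thesis .
qed

definition ball_vol :: real where
  "ball_vol = measure (lebm d) (nball 1)"

lemma emeasure_nball1: "emeasure (lebm d) (nball 1) = ennreal ball_vol"
  using emeasure_nball_finite by (simp add: ball_vol_def emeasure_eq_ennreal_measure less_top)

lemma emeasure_nball: "0 < r \<Longrightarrow> emeasure (lebm d) (nball r) = ennreal (r ^ d * ball_vol)"
  using nball_scale[of r 1] by (simp add: emeasure_nball1 ennreal_mult ball_vol_def)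

text \<open>
  The hypothesis says that the rotated polar body pairs with the polar body to at most \<open>\<mu>\<close>. By the
  bipolar theorem, here the separation lemma, it lies in \<open>\<mu>\<close> times the body itself.
\<close>

lemma N_Jf_le:
  assumes d: "d = 2 * n" and \<mu>: "0 \<le> \<mu>"
    and all: "\<And>a b. \<omega> n a b \<le> \<mu> * dual_norm (Jf a) * dual_norm (Jf b)"
  shows "N (Jf w) \<le> \<mu> * dual_norm w"
proof (rule ccontr)
  assume "\<not> N (Jf w) \<le> \<mu> * dual_norm w"
  then have less: "\<mu> * dual_norm w < N (Jf w)" by simp
  interpret D: seminorm_fun dual_norm by (rule seminorm_dual_norm)
  define c where "c = (\<mu> * dual_norm w + N (Jf w)) / 2"
  have "0 \<le> \<mu> * dual_norm w" using \<mu> dual_norm_nonneg by simp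
  then have c: "0 < c" "\<mu> * dual_norm w \<le> c" "c < N (Jf w)" using less by (auto simp: c_def)
  have "N (\<lambda>k. 1 / c * Jf w k) = 1 / c * N (Jf w)" using c N_scale[of "1 / c"] by simp
  also have "1 < \<dots>" using c by simp
  finally obtain v where v: "dual_norm v < dot v (\<lambda>k. 1 / c * Jf w k)" using separation by blast
  then have cv: "c * dual_norm v < dot v (Jf w)" unfolding dot_scale(1) using c by (simp add: field_simps)
  have "dot v (Jf w) = \<omega> n (Jf w) (\<lambda>k. - Jf v k)"
    unfolding dot_def symplectic_Jf d[symmetric] Jf_uminus Jf_Jf by (simp add: mult.commute)
  also have "\<dots> \<le> \<mu> * dual_norm (Jf (Jf w)) * dual_norm (Jf (\<lambda>k. - Jf v k))" by (rule all)
  also have "\<dots> = \<mu> * dual_norm w * dual_norm v" by (simp add: Jf_uminus Jf_Jf D.N_uminus)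
  also have "\<dots> \<le> c * dual_norm v" using c(2) dual_norm_nonneg by (rule mult_right_mono)
  finally show False using cv by simp
qed

text \<open>
  The heart of the argument: Lewis' position produces two inverse transposed parallelepipeds, one
  half inside a multiple of the unit ball and one half inside a multiple of its polar. By
  hypothesis the symplectic rotation of the polar lies in a multiple of the ball, so the volume of
  the ball is bounded below by both. The product of the two volumes does not depend on the position.
\<close>

lemma volume_lower_bound:
  fixes A \<mu> :: real
  assumes d: "d = 2 * n" and n: "1 \<le> n" and A: "0 < A" and \<mu>: "0 < \<mu>"
    and Kconv: "\<And>f. cube_norm N d (\<lambda>t k. \<Sum>i<d. t i * ((\<Sum>s\<in>signs d. s i * f s k) / 2 ^ d)) \<le> A * cube_norm N d f"
    and all: "\<And>a b. \<omega> n a b \<le> \<mu> * dual_norm (Jf a) * dual_norm (Jf b)"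
  shows "(1 / (18 * \<mu> * n * A)) ^ n \<le> ball_vol"
proof -
  define s where "s = sqrt (2 ^ d)"
  have s: "0 < s" "s\<^sup>2 = 2 ^ d" by (simp_all add: s_def)
  obtain U V where U: "U \<in> carrier_mat d d" and V: "V \<in> carrier_mat d d" and VU: "V * U = 1\<^sub>m d"
    and radU: "mrad (\<lambda>k i. U $$ (k, i)) \<le> s"
    and tr: "\<And>W. (\<Sum>i<d. \<Sum>k<d. V $$ (i, k) * W k i) \<le> d * mrad W / s"
    using lewis_position[OF s(1)] by blast
  have detVU: "det V * det U = 1" using det_mult[OF V U] VU by simp
  then have det: "det U \<noteq> 0" "det V \<noteq> 0" by auto
  define \<rho> where "\<rho> = 2 * d * A"
  have \<rho>: "0 < \<rho>" using A n by (simp add: \<rho>_def d)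
  have dual: "cube_norm dual_norm d (\<lambda>t k. \<Sum>i<d. t i * V $$ (i, k)) \<le> \<rho> * s"
    unfolding \<rho>_def by (rule dual_position[OF Kconv V s _ tr]) (use A in simp)
  have "ennreal (\<bar>det U\<bar> * 2 ^ d / 2) \<le> emeasure (lebm d) (nball 3)"
  proof (rule emeasure_ball_ge[OF seminorm_fun_axioms U det(1) _ s, where c = "\<lambda>i k. U $$ (k, i)" and \<tau> = 1])
    show "cube_norm N d (\<lambda>t k. \<Sum>i<d. t i * U $$ (k, i)) \<le> 1 * s"
      using radU by (simp add: mrad_def)
    fix x assume "x \<in> rspace d" "N (\<lambda>k. \<Sum>i<d. x i * U $$ (k, i)) \<le> 2 * 1"
    moreover have "N (lin d U x) = N (\<lambda>k. \<Sum>i<d. x i * U $$ (k, i))"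
      by (rule N_cong) (simp add: lin_def mult.commute)
    ultimately show "lin d U x \<in> nball 3" by (simp add: nball_def)
  qed auto
  then have 1: "\<bar>det U\<bar> * 2 ^ d / 2 \<le> 3 ^ d * ball_vol"
    by (simp add: emeasure_nball ball_vol_def)
  define B where "B = Jm n * transpose_mat V"
  have B: "B \<in> carrier_mat d d" "\<bar>det B\<bar> = \<bar>det V\<bar>"
  proof -
    have J: "Jm n \<in> carrier_mat d d" and VT: "transpose_mat V \<in> carrier_mat d d"
      using V Jm_carrier[of n] by (auto simp only: d transpose_carrier_mat)
    show "B \<in> carrier_mat d d" unfolding B_def by (rule mult_carrier_mat[OF J VT])
    show "\<bar>det B\<bar> = \<bar>det V\<bar>"
      unfolding B_def using det_mult[OF J VT] det_transpose[OF V] by (simp add: abs_mult abs_det_Jm)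
  qed
  have linB: "lin d B x k = Jf (\<lambda>k. \<Sum>i<d. x i * V $$ (i, k)) k" if k: "k < d" for x k
  proof -
    have "lin d B x k = lin d (Jm n) (lin d (transpose_mat V) x) k"
      unfolding B_def using V d by (subst lin_mult) auto
    also have "\<dots> = (\<Sum>j<2 * n. Jm n $$ (k, j) * lin d (transpose_mat V) x j)"
      using k d by (simp add: lin_def)
    also have "\<dots> = (\<Sum>j<2 * n. Jm n $$ (k, j) * (\<Sum>i<d. x i * V $$ (i, j)))"
      using V d by (intro sum.cong refl) (simp add: lin_def mult.commute)
    also have "\<dots> = Jf (\<lambda>k. \<Sum>i<d. x i * V $$ (i, k)) k" using k d by (intro sum_Jm) simp
    finally show ?thesis .
  qed
  have "ennreal (\<bar>det B\<bar> * 2 ^ d / 2) \<le> emeasure (lebm d) (nball (3 * \<mu> * \<rho>))"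
  proof (rule emeasure_ball_ge[OF seminorm_dual_norm B(1) _ dual s \<rho>])
    show "det B \<noteq> 0" using B(2) det by auto
    fix x assume x: "dual_norm (\<lambda>k. \<Sum>i<d. x i * V $$ (i, k)) \<le> 2 * \<rho>"
    have "N (lin d B x) = N (Jf (\<lambda>k. \<Sum>i<d. x i * V $$ (i, k)))" by (rule N_cong) (rule linB)
    also have "\<dots> \<le> \<mu> * dual_norm (\<lambda>k. \<Sum>i<d. x i * V $$ (i, k))"
      using \<mu> by (intro N_Jf_le[OF d _ all]) simp
    also have "\<dots> \<le> \<mu> * (2 * \<rho>)" using x \<mu> by (intro mult_left_mono) auto
    also have "\<dots> < 3 * \<mu> * \<rho>" using \<mu> \<rho> by simp
    finally show "lin d B x \<in> nball (3 * \<mu> * \<rho>)" by (simp add: nball_def)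
  qed auto
  then have 2: "\<bar>det V\<bar> * 2 ^ d / 2 \<le> (3 * \<mu> * \<rho>) ^ d * ball_vol"
    using \<mu> \<rho> by (simp add: emeasure_nball B ball_vol_def)
  define q where "q = 2 / (9 * \<mu> * \<rho>)"
  have q: "0 < q" using \<mu> \<rho> by (simp add: q_def)
  have "(\<bar>det U\<bar> * 2 ^ d / 2) * (\<bar>det V\<bar> * 2 ^ d / 2) \<le> (3 ^ d * ball_vol) * ((3 * \<mu> * \<rho>) ^ d * ball_vol)"
    by (intro mult_mono 1 2) (auto simp: ball_vol_def)
  moreover have "\<bar>det U\<bar> * \<bar>det V\<bar> = 1" using detVU by (simp add: abs_mult[symmetric] mult.commute)
  then have "(\<bar>det U\<bar> * 2 ^ d / 2) * (\<bar>det V\<bar> * 2 ^ d / 2) = 4 ^ d / 4"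
    by (simp add: power_mult_distrib[symmetric] field_simps)
  moreover have "(3 ^ d * ball_vol) * ((3 * \<mu> * \<rho>) ^ d * ball_vol) = (9 * \<mu> * \<rho>) ^ d * ball_vol\<^sup>2"
    by (simp add: power_mult_distrib[symmetric] power2_eq_square mult_ac)
  ultimately have "4 ^ d / 4 \<le> (9 * \<mu> * \<rho>) ^ d * ball_vol\<^sup>2" by simp
  then have "(4 / (9 * \<mu> * \<rho>)) ^ d / 4 \<le> ball_vol\<^sup>2" using \<mu> \<rho> by (simp add: power_divide field_simps)
  moreover have "(4 / (9 * \<mu> * \<rho>)) ^ d / 4 = ((2 * q) ^ n / 2)\<^sup>2"
  proof -
    have "4 / (9 * \<mu> * \<rho>) = 2 * q" by (simp add: q_def)
    then show ?thesis by (simp only: d power_even_eq power_divide) simp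
  qed
  ultimately have "((2 * q) ^ n / 2)\<^sup>2 \<le> ball_vol\<^sup>2" by simp
  then have "(2 * q) ^ n / 2 \<le> ball_vol" by (rule power2_le_imp_le) (simp add: ball_vol_def)
  moreover have "q ^ n \<le> (2 * q) ^ n / 2"
  proof -
    have "(2::real) ^ 1 \<le> 2 ^ n" using n by (intro power_increasing) auto
    then have "q ^ n * 2 \<le> q ^ n * 2 ^ n" using q by (intro mult_left_mono) auto
    then show ?thesis by (simp add: power_mult_distrib mult.commute)
  qed
  moreover have "q = 1 / (18 * \<mu> * n * A)"
    using n \<mu> A by (simp add: q_def \<rho>_def d field_simps)
  ultimately show ?thesis by simp
qed

lemma ball_vol_pos: "0 < ball_vol"
proof (rule ccontr)
  assume "\<not> 0 < ball_vol"
  then have "ball_vol = 0" by (simp add: ball_vol_def less_le measure_nonneg)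
  define c where "c = (\<Sum>i<d. N (unit i)) + 1"
  have c: "0 < c" by (simp add: c_def add_nonneg_pos sum_nonneg N_nonneg)
  have "cube d \<subseteq> nball c"
  proof
    fix x assume x: "x \<in> cube d"
    have "N x \<le> (\<Sum>i<d. \<bar>x i\<bar> * N (unit i))" by (rule N_upper)
    also have "\<dots> \<le> (\<Sum>i<d. 1 * N (unit i))"
      using x by (intro sum_mono mult_right_mono N_nonneg) (auto simp: cube_def PiE_iff abs_le_iff)
    also have "\<dots> < c" by (simp add: c_def)
    finally show "x \<in> nball c" using x by (auto simp: nball_def cube_def rspace_def PiE_iff)
  qed
  then have "emeasure (lebm d) (cube d) \<le> emeasure (lebm d) (nball c)"
    by (rule emeasure_mono) simp
  then show False using c \<open>ball_vol = 0\<close> by (simp add: emeasure_cube emeasure_nball)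
qed

lemma emeasure_closed_ball: "emeasure (lebm d) {x \<in> rspace d. N x \<le> 1} = ennreal ball_vol"
proof (rule antisym)
  have meas: "{x \<in> rspace d. N x \<le> 1} \<in> sets (lebm d)"
    unfolding space_lebm[symmetric] by measurable
  have "emeasure (lebm d) {x \<in> rspace d. N x \<le> 1} \<le> ennreal ((1 + 1 / Suc k) ^ d * ball_vol)" for k
  proof -
    have "{x \<in> rspace d. N x \<le> 1} \<subseteq> nball (1 + 1 / Suc k)"
      by (auto simp: nball_def intro: le_less_trans)
    then have "emeasure (lebm d) {x \<in> rspace d. N x \<le> 1} \<le> emeasure (lebm d) (nball (1 + 1 / Suc k))"
      by (rule emeasure_mono) simp
    also have "\<dots> = ennreal ((1 + 1 / Suc k) ^ d * ball_vol)" by (rule emeasure_nball) (simp add: add_pos_pos)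
    finally show ?thesis .
  qed
  moreover have "(\<lambda>k. ennreal ((1 + 1 / Suc k) ^ d * ball_vol)) \<longlonglongrightarrow> ennreal ((1 + 0) ^ d * ball_vol)"
    by (intro tendsto_ennrealI tendsto_intros LIMSEQ_Suc lim_1_over_n)
  ultimately show "emeasure (lebm d) {x \<in> rspace d. N x \<le> 1} \<le> ennreal ball_vol"
    by (intro LIMSEQ_le_const[where X = "\<lambda>k. ennreal ((1 + 1 / Suc k) ^ d * ball_vol)"]) auto
  have "emeasure (lebm d) (nball 1) \<le> emeasure (lebm d) {x \<in> rspace d. N x \<le> 1}"
    using meas by (intro emeasure_mono) (auto simp: nball_def)
  then show "ennreal ball_vol \<le> emeasure (lebm d) {x \<in> rspace d. N x \<le> 1}"
    by (simp add: emeasure_nball1)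
qed

text \<open>The open and the closed ball differ by a null set, so \<open>K\<close> is measurable for the completion.\<close>

lemma Vol_between:
  assumes "nball 1 \<subseteq> K" "K \<subseteq> {x \<in> rspace d. N x \<le> 1}"
  shows "Vol d K = ball_vol"
proof -
  let ?C = "{x \<in> rspace d. N x \<le> 1}"
  have meas: "?C \<in> sets (lebm d)" unfolding space_lebm[symmetric] by measurable
  have "emeasure (lebm d) (?C - nball 1) = emeasure (lebm d) ?C - emeasure (lebm d) (nball 1)"
    using meas assms by (intro emeasure_Diff) (auto simp: emeasure_nball1)
  then have "?C - nball 1 \<in> null_sets (lebm d)"
    using meas by (auto simp: null_sets_def emeasure_nball1 emeasure_closed_ball)
  then have "K - nball 1 \<in> null_sets (completion (lebm d))"
    using assms(2) by (intro null_sets_completion_subset[of "K - nball 1" "?C - nball 1"])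
      (auto intro: null_sets_completionI)
  then have "emeasure (completion (lebm d)) (nball 1 \<union> (K - nball 1)) = emeasure (completion (lebm d)) (nball 1)"
    by (intro emeasure_Un_null_set) auto
  moreover have "nball 1 \<union> (K - nball 1) = K" using assms(1) by auto
  ultimately have "emeasure (completion (lebm d)) K = ennreal ball_vol" by (simp add: emeasure_nball1)
  then show ?thesis by (simp add: Vol_def measure_def ball_vol_def)
qed

end

lemma norm_fun_enorm: "norm_fun (enorm d) d 1"
proof
  show "enorm d (\<lambda>k. x k + y k) \<le> enorm d x + enorm d y" for x y
    unfolding enorm_def by (rule L2_set_triangle_ineq)
  show "enorm d (\<lambda>k. c * x k) = \<bar>c\<bar> * enorm d x" for c x
  proof -
    have "enorm d (\<lambda>k. c * x k) = enorm d (vscale d c x)"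
      unfolding enorm_def by (rule L2_set_cong) (auto simp: vscale_def)
    then show ?thesis by (simp add: enorm_vscale)
  qed
  show "enorm d x = enorm d y" if "\<And>i. i < d \<Longrightarrow> x i = y i" for x y
    unfolding enorm_def by (rule L2_set_cong) (auto simp: that)
  show "\<bar>x i\<bar> \<le> 1 * enorm d x" if "i < d" for x i
    using abs_coord_le_enorm[OF that] by simp
qed simp

lemma eball0_1: "eball0 d 1 = {x \<in> rspace d. enorm d x < 1}"
proof -
  have "enorm d (\<lambda>i. x i - (\<lambda>i\<in>{..<d}. 0) i) = enorm d x" for x
    unfolding enorm_def by (rule L2_set_cong) auto
  then show ?thesis by (simp add: eball0_def eball_def)
qed

lemma Vol_eball0_pos: "0 < Vol d (eball0 d 1)"
proof -
  interpret norm_fun "enorm d" d 1 by (rule norm_fun_enorm)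
  have "Vol d (eball0 d 1) = ball_vol"
    by (rule Vol_between) (auto simp: eball0_1 nball_def)
  then show ?thesis using ball_vol_pos by simp
qed

text \<open>On the unit ball \<open>1 \<le> exp (n - n \<bar>x\<bar>\<^sup>2)\<close>, and the integral of the right-hand side is \<open>(\<pi> e / n)\<^sup>n\<close>.\<close>

lemma Vol_eball0_le:
  assumes n: "1 \<le> n"
  shows "Vol (2 * n) (eball0 (2 * n) 1) \<le> (pi * exp 1 / n) ^ n"
proof -
  let ?d = "2 * n"
  interpret norm_fun "enorm ?d" ?d 1 by (rule norm_fun_enorm)
  have V: "Vol ?d (eball0 ?d 1) = ball_vol"
    by (rule Vol_between) (auto simp: eball0_1 nball_def)
  define \<sigma> where "\<sigma> = 1 / sqrt (2 * n)"
  have \<sigma>: "0 < \<sigma>" "\<sigma>\<^sup>2 = 1 / (2 * n)" using n by (simp_all add: \<sigma>_def power_divide)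
  define g where "g x = normal_density 0 \<sigma> x" for x
  have g: "exp (- (n * x\<^sup>2)) = sqrt (pi / n) * g x" for x :: real
    using n by (simp add: g_def normal_density_def \<sigma> real_sqrt_divide)
  have g0: "0 \<le> g x" for x by (simp add: g_def)
  have intg: "(\<integral>\<^sup>+x. ennreal (g x) \<partial>lborel) = 1"
  proof -
    have "emeasure (density lborel (normal_density 0 \<sigma>)) (space (density lborel (normal_density 0 \<sigma>))) = 1"
      by (rule prob_space.emeasure_space_1[OF prob_space_normal_density[OF \<sigma>(1)]])
    then show ?thesis by (simp add: emeasure_density g_def[abs_def])
  qed
  have "ennreal ball_vol = (\<integral>\<^sup>+x. indicator (nball 1) x \<partial>lebm ?d)"
    by (simp add: emeasure_nball1)
  also have "\<dots> \<le> (\<integral>\<^sup>+x. ennreal (exp n * (pi / n) ^ n) * (\<Prod>i<?d. ennreal (g (x i))) \<partial>lebm ?d)"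
  proof (rule nn_integral_mono)
    fix x :: "nat \<Rightarrow> real"
    have prod: "(\<Prod>i<?d. exp (- (n * (x i)\<^sup>2))) = (pi / n) ^ n * (\<Prod>i<?d. g (x i))"
    proof -
      have "(\<Prod>i<?d. exp (- (n * (x i)\<^sup>2))) = (\<Prod>i<?d. sqrt (pi / n) * g (x i))"
        by (intro prod.cong refl) (rule g)
      also have "\<dots> = sqrt (pi / n) ^ ?d * (\<Prod>i<?d. g (x i))"
        by (simp add: prod.distrib)
      also have "sqrt (pi / n) ^ ?d = (pi / n) ^ n" unfolding power_mult by simp
      finally show ?thesis .
    qed
    show "indicator (nball 1) x \<le> ennreal (exp n * (pi / n) ^ n) * (\<Prod>i<?d. ennreal (g (x i)))"
    proof (cases "x \<in> nball 1")
      case True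
      then have "(enorm ?d x)\<^sup>2 \<le> 1\<^sup>2" by (intro power_mono) (auto simp: nball_def N_nonneg)
      then have "(\<Sum>i<?d. (x i)\<^sup>2) \<le> 1" by (simp add: enorm_def L2_set_def sum_nonneg)
      then have "n * (\<Sum>i<?d. (x i)\<^sup>2) \<le> real n * 1" by (intro mult_left_mono) auto
      then have "1 \<le> exp (n - n * (\<Sum>i<?d. (x i)\<^sup>2))" by simp
      also have "\<dots> = exp n * (\<Prod>i<?d. exp (- (n * (x i)\<^sup>2)))"
      proof -
        have "exp (- (n * (\<Sum>i<?d. (x i)\<^sup>2))) = (\<Prod>i<?d. exp (- (n * (x i)\<^sup>2)))"
          by (simp add: exp_sum[symmetric] sum_negf sum_distrib_left del: exp_minus)
        then show ?thesis by (simp add: diff_conv_add_uminus exp_add del: add_uminus_conv_diff)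
      qed
      also have "\<dots> = exp n * (pi / n) ^ n * (\<Prod>i<?d. g (x i))" unfolding prod by simp
      finally have "ennreal 1 \<le> ennreal (exp n * (pi / n) ^ n * (\<Prod>i<?d. g (x i)))" by (rule ennreal_leI)
      also have "\<dots> = ennreal (exp n * (pi / n) ^ n) * (\<Prod>i<?d. ennreal (g (x i)))"
        by (simp add: ennreal_mult prod_nonneg g0 prod_ennreal)
      finally show ?thesis using True by simp
    qed simp
  qed
  also have "\<dots> = ennreal (exp n * (pi / n) ^ n) * (\<integral>\<^sup>+x. (\<Prod>i<?d. ennreal (g (x i))) \<partial>lebm ?d)"
    by (rule nn_integral_cmult) (simp add: g_def)
  also have "(\<integral>\<^sup>+x. (\<Prod>i<?d. ennreal (g (x i))) \<partial>lebm ?d) = (\<Prod>i<?d. \<integral>\<^sup>+x. ennreal (g x) \<partial>lborel)"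
    by (rule lebm.product_nn_integral_prod) (auto simp: g_def)
  also have "\<dots> = 1" by (simp add: intg)
  finally have "ball_vol \<le> exp n * (pi / n) ^ n" by (simp add: ennreal_le_iff)
  also have "\<dots> = (pi * exp 1 / n) ^ n"
    by (simp add: power_divide power_mult_distrib exp_of_nat_mult[symmetric])
  finally show ?thesis by (simp add: V)
qed

section \<open>The capacity estimate\<close>

theorem mainTheorem5:
  fixes p T :: real
  assumes "1 < p" and "p \<le> 2" and "1 \<le> T"
  shows "\<exists>A>0. \<forall>n\<ge>1. \<forall>K. convex_body (2 * n) K \<longrightarrow> centrally_symmetric (2 * n) K \<longrightarrow>
           type_const (2 * n) (gauge_norm (2 * n) K) p \<le> ereal T \<longrightarrow>
           cZ_lin n K / ereal ball_capacity
             \<le> ereal (A * (Vol (2 * n) K / Vol (2 * n) (eball0 (2 * n) 1)) powr (1 / real n))"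
proof -
  obtain A where A: "0 < A" and Kconv: "\<And>N m f. type_fun N p (T + 1) \<Longrightarrow>
    cube_norm N m (\<lambda>t k. \<Sum>i<m. t i * ((\<Sum>s\<in>signs m. s i * f s k) / 2 ^ m)) \<le> A * cube_norm N m f"
    using K_convexity[OF assms(1), of "T + 1"] by blast
  show ?thesis
  proof (intro exI[of _ "72 * A * (pi * exp 1)"] conjI allI impI)
    show "0 < 72 * A * (pi * exp 1)" using A by simp
    fix n :: nat and K :: "(nat \<Rightarrow> real) set"
    assume n: "1 \<le> n" and body: "convex_body (2 * n) K" "centrally_symmetric (2 * n) K"
      and type: "type_const (2 * n) (gauge_norm (2 * n) K) p \<le> ereal T"
    let ?d = "2 * n"
    interpret K: sym_body ?d K by standard (fact body)+
    obtain R where "norm_fun K.body_norm ?d R" using K.norm_fun_body_norm by blast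
    then interpret norm_fun K.body_norm ?d R .
    have type_body_norm: "type_fun K.body_norm p (T + 1)"
      by (rule K.type_fun_body_norm) (use assms type in auto)
    have Vol_K: "Vol ?d K = ball_vol"
      by (rule Vol_between) (auto simp: nball_def K.body_norm_less_1 K.body_norm_K K.K_rspace)
    define v where "v = ball_vol powr (1 / n)"
    have v: "0 < v" "v ^ n = ball_vol"
      using ball_vol_pos n by (simp_all add: v_def powr_powr flip: powr_realpow)
    \<comment> \<open>Half of the value at which the volume bound would be an equality.\<close>
    define \<mu> where "\<mu> = 1 / (36 * n * A * v)"
    have \<mu>: "0 < \<mu>" using n A v by (simp add: \<mu>_def)
    have "\<not> (\<forall>a b. \<omega> n a b \<le> \<mu> * dual_norm (Jf a) * dual_norm (Jf b))"
    proof
      assume "\<forall>a b. \<omega> n a b \<le> \<mu> * dual_norm (Jf a) * dual_norm (Jf b)"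
      then have "(1 / (18 * \<mu> * n * A)) ^ n \<le> ball_vol"
        by (intro volume_lower_bound[OF refl n A \<mu> Kconv[OF type_body_norm]]) auto
      also have "1 / (18 * \<mu> * n * A) = 2 * v" using n A v by (simp add: \<mu>_def)
      finally have "2 ^ n * ball_vol \<le> 1 * ball_vol" by (simp add: power_mult_distrib v)
      then have "(2::real) ^ n \<le> 1" using ball_vol_pos by (rule mult_right_le_imp_le)
      moreover have "(1::real) < 2 ^ n" using n by simp
      ultimately show False by simp
    qed
    then obtain a b where ab: "\<mu> * dual_norm (Jf a) * dual_norm (Jf b) < \<omega> n a b" by (auto simp: not_le)
    define \<alpha> where "\<alpha> = dual_norm (Jf a)"
    define \<beta> where "\<beta> = dual_norm (Jf b)"
    define w where "w = \<omega> n a b"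
    have form: "\<omega> n z c = dot (Jf c) z" for z c
      unfolding symplectic_Jf dot_def by (intro sum.cong refl mult.commute)
    have bound: "\<bar>\<omega> n z c\<bar> \<le> dual_norm (Jf c) * K.body_norm z" for z c
      using dot_le_dual_norm[of "Jf c" z] dot_le_dual_norm[of "Jf c" "\<lambda>k. - z k"] dot_scale(1)[of "Jf c" "-1" z]
      by (simp add: form N_uminus abs_le_iff)
    have "0 \<le> \<mu> * \<alpha> * \<beta>" using \<mu> dual_norm_nonneg by (simp add: \<alpha>_def \<beta>_def)
    then have w: "0 < w" "\<mu> * \<alpha> * \<beta> < w" using ab by (auto simp: \<alpha>_def \<beta>_def w_def)
    have \<beta>: "0 < \<beta>" using bound[of a b] w dual_norm_nonneg[of "Jf b"] by (cases "\<beta> = 0") (auto simp: w_def \<beta>_def less_le)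
    have \<alpha>: "0 < \<alpha>"
      using bound[of b a] w dual_norm_nonneg[of "Jf a"] symplectic_swap[of n a b]
      by (cases "\<alpha> = 0") (auto simp: w_def \<alpha>_def less_le)
    \<comment> \<open>Rescaling to \<open>\<omega> n (x a) (y b) = 1\<close> with both functionals equally large on \<open>K\<close>.\<close>
    define x where "x = sqrt (\<beta> / (\<alpha> * w))"
    define y where "y = sqrt (\<alpha> / (\<beta> * w))"
    have x: "0 < x" "x\<^sup>2 = \<beta> / (\<alpha> * w)" and y: "0 < y" "y\<^sup>2 = \<alpha> / (\<beta> * w)"
      using \<alpha> \<beta> w by (simp_all add: x_def y_def)
    have xy: "x * y * w = 1"
    proof -
      have "(x * y * w)\<^sup>2 = x\<^sup>2 * y\<^sup>2 * w\<^sup>2" by (simp add: power_mult_distrib)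
      also have "\<dots> = 1\<^sup>2" using \<alpha> \<beta> w by (simp add: x(2) y(2) power2_eq_square[of w])
      finally have "(x * y * w)\<^sup>2 = 1\<^sup>2" .
      then show ?thesis by (rule power2_eq_imp_eq) (use x y w in auto)
    qed
    define r where "r = sqrt (2 / \<mu>)"
    have r: "0 < r" "r\<^sup>2 = 2 / \<mu>" using \<mu> by (simp_all add: r_def)
    have "cZ_lin n K \<le> ereal (pi * r\<^sup>2)"
    proof (rule cZ_lin_le[OF n])
      show "K \<subseteq> rspace ?d" using K.K_rspace by blast
      show "\<omega> n (\<lambda>k. x * a k) (\<lambda>k. y * b k) = 1"
        using xy by (simp add: symplectic_scale w_def mult_ac)
      show "0 < r" by (rule r)
      fix z assume z: "z \<in> K"
      have le: "(\<omega> n z c)\<^sup>2 \<le> (dual_norm (Jf c))\<^sup>2" for c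
      proof -
        have "dual_norm (Jf c) * K.body_norm z \<le> dual_norm (Jf c) * 1" using K.body_norm_K[OF z] by (intro mult_left_mono dual_norm_nonneg)
        then have "\<bar>\<omega> n z c\<bar> \<le> dual_norm (Jf c)" using bound[of z c] by simp
        then have "\<bar>\<omega> n z c\<bar>\<^sup>2 \<le> (dual_norm (Jf c))\<^sup>2" by (intro power_mono) auto
        then show ?thesis by simp
      qed
      have small: "\<alpha> * \<beta> / w < 1 / \<mu>" using w \<mu> by (simp add: field_simps)
      have "(\<omega> n z (\<lambda>k. x * a k))\<^sup>2 \<le> x\<^sup>2 * \<alpha>\<^sup>2"
        using mult_left_mono[OF le[of a], of "x\<^sup>2"] by (simp add: symplectic_scale power_mult_distrib \<alpha>_def)
      also have "\<dots> = \<alpha> * \<beta> / w" using \<alpha> by (simp add: x(2) power2_eq_square[of \<alpha>])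
      finally have 1: "(\<omega> n z (\<lambda>k. x * a k))\<^sup>2 < 1 / \<mu>" using small by simp
      have "(\<omega> n z (\<lambda>k. y * b k))\<^sup>2 \<le> y\<^sup>2 * \<beta>\<^sup>2"
        using mult_left_mono[OF le[of b], of "y\<^sup>2"] by (simp add: symplectic_scale power_mult_distrib \<beta>_def)
      also have "\<dots> = \<alpha> * \<beta> / w" using \<beta> by (simp add: y(2) power2_eq_square[of \<beta>])
      finally have "(\<omega> n z (\<lambda>k. y * b k))\<^sup>2 < 1 / \<mu>" using small by simp
      with 1 show "(\<omega> n z (\<lambda>k. x * a k))\<^sup>2 + (\<omega> n z (\<lambda>k. y * b k))\<^sup>2 < r\<^sup>2" by (simp add: r)
    qed
    then have "cZ_lin n K / ereal ball_capacity \<le> ereal (pi * r\<^sup>2) / ereal pi"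
      unfolding ball_capacity_def by (intro ereal_divide_right_mono) auto
    also have "\<dots> = ereal (r\<^sup>2)" by simp
    also have "r\<^sup>2 = 72 * A * (n * v)" by (simp add: r \<mu>_def)
    also have "ereal (72 * A * (n * v)) \<le> ereal (72 * A * (pi * exp 1) * (Vol ?d K / Vol ?d (eball0 ?d 1)) powr (1 / real n))"
    proof -
      define B where "B = Vol ?d (eball0 ?d 1)"
      have B: "0 < B" "B \<le> (pi * exp 1 / n) ^ n"
        using Vol_eball0_pos[of ?d] Vol_eball0_le[OF n] by (auto simp: B_def)
      have "B powr (1 / n) \<le> ((pi * exp 1 / n) ^ n) powr (1 / n)"
        using B by (intro powr_mono2) auto
      also have "\<dots> = pi * exp 1 / n"
        using n by (simp add: powr_powr flip: powr_realpow)
      finally have "n * B powr (1 / n) \<le> pi * exp 1" using n by (simp add: field_simps)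
      then have "n * B powr (1 / n) * (v / B powr (1 / n)) \<le> pi * exp 1 * (v / B powr (1 / n))"
        using v by (intro mult_right_mono) auto
      then have "n * v \<le> pi * exp 1 * (ball_vol / B) powr (1 / n)"
        using B ball_vol_pos by (simp add: v_def powr_divide)
      then show ?thesis using A by (simp add: Vol_K B_def[symmetric] mult.assoc)
    qed
    finally show "cZ_lin n K / ereal ball_capacity
        \<le> ereal (72 * A * (pi * exp 1) * (Vol ?d K / Vol ?d (eball0 ?d 1)) powr (1 / real n))" .
  qed
qed

end
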